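(* Let $J\subset S$ be a square-free monomial ideal with minimal primary decomposition $J=\mathfrak{p}_1\cap\cdots\cap\mathfrak{p}_k$, and suppose that $\Delta(J)$ is shellable with shelling order $F_1,\ldots,F_k$, where $F_i$ corresponds to $\mathfrak{p}_i$. Let $c$ be the common codimension of the $\mathfrak{p}_i$, and for each $1\le j\le k$ let $x_{\ell_{j,1}},\ldots,x_{\ell_{j,b_j}}$ be distinct variables not in $\mathfrak{p}_j$ such that $$\{\mathfrak{p}_\ell+\mathfrak{p}_j\mid1\le\ell\le j-1,\ \mathrm{codim}(\mathfrak{p}_\ell+\mathfrak{p}_j)=c+1\}=\{(\mathfrak{p}_j,x_{\ell_{j,1}}),\ldots,(\mathfrak{p}_j,x_{\ell_{j,b_j}})\}.$$ For $A\subseteq\{1,\ldots,b_j\}$ set $\mathfrak{p}_{j,A}=\mathfrak{p}_j+(x_{\ell_{j,i}}\mid i\in A)$. Let $Z=\mathrm{MultiProj}(S/J)\subset\mathbb{P}=\mathrm{MultiProj}(S)$. Then: (1) $\mathrm{codim}(\mathfrak{p}_{j,A})=\mathrm{codim}(J)+|A|$ for every $1\le j\le k$ and $A\subseteq\{1,\ldots,b_j\}$. (2) The expression $$P_{S/J}(\mathbf{t})=\sum_{j=1}^k\Big(P_{S/\mathfrak{p}_j}(\mathbf{t})+\sum_{\emptyset\ne A\subseteq\{1,\ldots,b_j\}}(-1)^{|A|}P_{S/\mathfrak{p}_{j,A}}(\mathbf{t})\Big)$$ holds and is cancellation-free, i.e. whenever two nonzero summands are scalar multiples of the same product of binomials $\prod_i\binom{t_i+n_i}{n_i}$,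 they occur with the same sign. (3) In particular, $(-1)^{\dim(Z)-|\mathbf{n}|}\deg_{\mathbb{P}}^{\mathbf{n}}(Z)\ge0$ for all $\mathbf{n}\in\mathbb{N}^p$.
   Context: $\Bbbk$ is a field and $S=\Bbbk[x_1,\ldots,x_n]$ is a standard $\mathbb{N}^p$-graded polynomial ring, i.e. $\deg(x_i)\in\{\mathbf{e}_1,\ldots,\mathbf{e}_p\}$ for each $i$. For a finitely generated $\mathbb{Z}^p$-graded $S$-module $M$, $P_M(\mathbf{t})\in\mathbb{Q}[t_1,\ldots,t_p]$ denotes its multigraded Hilbert polynomial: $P_M(\mathbf{v})=\dim_\Bbbk([M]_{\mathbf{v}})$ for all $\mathbf{v}\gg\mathbf{0}$. For a prime $\mathfrak{p}$ generated by variables, $P_{S/\mathfrak{p}}(\mathbf{t})=\prod_{i=1}^p\binom{t_i+n_i(\mathfrak{p})-1}{n_i(\mathfrak{p})-1}$, where $n_i(\mathfrak{p})$ is the number of variables of degree $\mathbf{e}_i$ not in $\mathfrak{p}$ (it is $0$ if some $n_i(\mathfrak{p})=0$). For $Z=\mathrm{MultiProj}(S/J)$, the Hilbert coefficients $\deg_{\mathbb{P}}^{\mathbf{n}}(Z)\in\mathbb{Z}$ are defined by $P_{S/J}(\mathbf{t})=\sum_{\mathbf{n}\in\mathbb{N}^p}\deg_{\mathbb{P}}^{\mathbf{n}}(Z)\prod_{i=1}^p\binom{t_i+n_i}{n_i}$; $|\mathbf{n}|=n_1+\cdots+n_p$. For a square-free monomial ideal $J$, $\Delta(J)$ is its Stanley–Reisner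 complex on the variables; the facet corresponding to a minimal prime $\mathfrak{p}$ of $J$ is the set of variables not in $\mathfrak{p}$. A simplicial complex with facets $F_1,\ldots,F_k$ is shellable with order $F_1,\ldots,F_k$ if it is pure and $\langle F_1,\ldots,F_{i-1}\rangle\cap\langle F_i\rangle$ is pure of dimension $\dim(F_i)-1$ for all $2\le i\le k$. (For a shelling order, variables as in the statement always exist.) *)

theory Defs
  imports
    "HOL-Library.Poly_Mapping"
    "HOL-Library.Extended_Nat"
    "HOL-Algebra.QuotRing"
    "HOL-Algebra.Embedded_Algebras"
    "HOL-Analysis.Abstract_Topology"
begin

section \<open>Commutative algebra\<close>

definition height :: "('a, 'm) ring_scheme \<Rightarrow> 'a set \<Rightarrow> enat" where
  "height R P = (SUP m \<in> {m. \<exists>Q. Q m = P \<and> (\<forall>i\<le>m. primeideal (Q i) R)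
                              \<and> (\<forall>i<m. Q i \<subset> Q (Suc i))}. enat m)"

definition codim :: "('a, 'm) ring_scheme \<Rightarrow> 'a set \<Rightarrow> enat" where
  "codim R I = (INF P \<in> {P. primeideal P R \<and> I \<subseteq> P}. height R P)"

definition radical_ideal :: "('a, 'm) ring_scheme \<Rightarrow> 'a set \<Rightarrow> 'a set" where
  "radical_ideal R I = {a \<in> carrier R. \<exists>m::nat. a [^]\<^bsub>R\<^esub> m \<in> I}"

definition primary_ideal :: "('a, 'm) ring_scheme \<Rightarrow> 'a set \<Rightarrow> bool" where
  "primary_ideal R Q \<longleftrightarrow> ideal Q R \<and> Q \<noteq> carrier R \<and>
     (\<forall>a\<in>carrier R. \<forall>b\<in>carrier R. a \<otimes>\<^bsub>R\<^esub> b \<in> Q \<longrightarrow> a \<in> Q \<or> b \<in> radical_ideal R Q)"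

definition minimal_primary_decomposition ::
    "('a, 'm) ring_scheme \<Rightarrow> 'a set \<Rightarrow> nat \<Rightarrow> (nat \<Rightarrow> 'a set) \<Rightarrow> bool" where
  "minimal_primary_decomposition R I k Q \<longleftrightarrow>
     (\<forall>i\<in>{1..k}. primary_ideal R (Q i)) \<and>
     I = carrier R \<inter> (\<Inter>i\<in>{1..k}. Q i) \<and>
     inj_on (\<lambda>i. radical_ideal R (Q i)) {1..k} \<and>
     (\<forall>i\<in>{1..k}. \<not> carrier R \<inter> (\<Inter>j\<in>{1..k} - {i}. Q j) \<subseteq> Q i)"


section \<open>MultiProj of an N^p-graded ring\<close>

text \<open>
  A graded ring is given by a ring record R together with its graded pieces, G v being the
  piece of degree v. The index type 'p stands for the set of indices 1, ..., p.
\<close>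

definition homogeneous_ideal ::
    "('a, 'm) ring_scheme \<Rightarrow> (('p \<Rightarrow> nat) \<Rightarrow> 'a set) \<Rightarrow> 'a set \<Rightarrow> bool" where
  "homogeneous_ideal R G I \<longleftrightarrow> ideal I R \<and> I = Idl\<^bsub>R\<^esub> (I \<inter> (\<Union>v. G v))"

definition multiproj_points ::
    "('a, 'm) ring_scheme \<Rightarrow> (('p \<Rightarrow> nat) \<Rightarrow> 'a set) \<Rightarrow> 'a set set" where
  "multiproj_points R G =
     {P. primeideal P R \<and> homogeneous_ideal R G P \<and> \<not> (\<Union>v\<in>{v. \<forall>i. 0 < v i}. G v) \<subseteq> P}"

text \<open>The underlying topological space, generated by the basic open sets of homogeneous elements.\<close>

definition multiproj ::
    "('a, 'm) ring_scheme \<Rightarrow> (('p \<Rightarrow> nat) \<Rightarrow> 'a set) \<Rightarrow> 'a set topology" where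
  "multiproj R G =
     topology_generated_by ((\<lambda>f. {P \<in> multiproj_points R G. f \<notin> P}) ` (\<Union>v. G v))"

definition irreducible_closedin :: "'a topology \<Rightarrow> 'a set \<Rightarrow> bool" where
  "irreducible_closedin X T \<longleftrightarrow> closedin X T \<and> T \<noteq> {} \<and>
     (\<forall>A B. closedin X A \<and> closedin X B \<and> T = A \<union> B \<longrightarrow> T = A \<or> T = B)"

text \<open>Krull dimension of a topological space; as an enat, it is 0 for the empty space.\<close>

definition krull_dim :: "'a topology \<Rightarrow> enat" where
  "krull_dim X = (SUP m \<in> {m. \<exists>T. (\<forall>i\<le>m. irreducible_closedin X (T i))
                               \<and> (\<forall>i<m. T i \<subset> T (Suc i))}. enat m)"


section \<open>Polynomial rings\<close>

text \<open>
  The polynomial ring over 'a whose variables are the elements of a finite type 'x: finitely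
  supported coefficient functions on exponent vectors, with convolution as product.
\<close>

type_synonym ('x, 'a) mpoly = "('x \<Rightarrow>\<^sub>0 nat) \<Rightarrow>\<^sub>0 'a"

definition Var :: "'x \<Rightarrow> ('x, 'a::comm_ring_1) mpoly" where
  "Var x = Poly_Mapping.single (Poly_Mapping.single x 1) 1"

definition Const :: "'a::comm_ring_1 \<Rightarrow> ('x, 'a) mpoly" where
  "Const c = Poly_Mapping.single 0 c"

definition mpoly_eval :: "('x::finite, 'a::comm_ring_1) mpoly \<Rightarrow> ('x \<Rightarrow> 'a) \<Rightarrow> 'a" where
  "mpoly_eval f v = (\<Sum>m\<in>Poly_Mapping.keys f. Poly_Mapping.lookup f m *
                        (\<Prod>x\<in>UNIV. v x ^ Poly_Mapping.lookup m x))"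

definition mpoly_ring :: "('x, 'a::comm_ring_1) mpoly ring" where
  "mpoly_ring = \<lparr>carrier = UNIV, mult = (*), one = 1, zero = 0, add = (+)\<rparr>"

definition squarefree_monomial_ideal :: "('x::finite, 'k::field) mpoly set \<Rightarrow> bool" where
  "squarefree_monomial_ideal J \<longleftrightarrow>
     (\<exists>\<F>. J = Idl\<^bsub>mpoly_ring\<^esub> ((\<lambda>F. \<Prod>x\<in>F. Var x) ` \<F>))"

definition add_vars :: "('x, 'k::field) mpoly set \<Rightarrow> 'x set \<Rightarrow> ('x, 'k) mpoly set" where
  "add_vars I X = I <+>\<^bsub>mpoly_ring\<^esub> Idl\<^bsub>mpoly_ring\<^esub> (Var ` X)"


section \<open>Standard multigrading and Hilbert polynomials\<close>

text \<open>
  A standard grading is a map g from variables to indices: the variable x has degree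
  \<open>e\<^sub>i\<close> with \<open>i = g x\<close>.
\<close>

definition multidegree :: "('x::finite \<Rightarrow> 'p) \<Rightarrow> ('x \<Rightarrow>\<^sub>0 nat) \<Rightarrow> 'p \<Rightarrow> nat" where
  "multidegree g m i = (\<Sum>x | g x = i. Poly_Mapping.lookup m x)"

definition graded_piece ::
    "('x::finite \<Rightarrow> 'p) \<Rightarrow> ('p \<Rightarrow> nat) \<Rightarrow> ('x, 'k::field) mpoly set" where
  "graded_piece g v = {f. \<forall>m\<in>Poly_Mapping.keys f. multidegree g m = v}"

text \<open>The degree v piece of S/J, and the copy of the coefficient field in S/J.\<close>

definition quot_piece ::
    "('x::finite \<Rightarrow> 'p) \<Rightarrow> ('x, 'k::field) mpoly set \<Rightarrow> ('p \<Rightarrow> nat) \<Rightarrow> ('x, 'k) mpoly set set" where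
  "quot_piece g J v = (\<lambda>f. J +>\<^bsub>mpoly_ring\<^esub> f) ` graded_piece g v"

definition quot_scalars :: "('x::finite, 'k::field) mpoly set \<Rightarrow> ('x, 'k) mpoly set set" where
  "quot_scalars J = range (\<lambda>c. J +>\<^bsub>mpoly_ring\<^esub> Const c)"

definition hilbert_function ::
    "('x::finite \<Rightarrow> 'p) \<Rightarrow> ('x, 'k::field) mpoly set \<Rightarrow> ('p \<Rightarrow> nat) \<Rightarrow> nat" where
  "hilbert_function g J v = ring.dim (mpoly_ring Quot J) (quot_scalars J) (quot_piece g J v)"

text \<open>The multigraded Hilbert polynomial of S/J.\<close>

definition hilbert_poly ::
    "('x::finite \<Rightarrow> 'p::finite) \<Rightarrow> ('x, 'k::field) mpoly set \<Rightarrow> ('p, rat) mpoly" where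
  "hilbert_poly g J = (THE P. \<exists>N. \<forall>v. (\<forall>i. N \<le> v i) \<longrightarrow>
      mpoly_eval P (\<lambda>i. of_nat (v i)) = of_nat (hilbert_function g J v))"

text \<open>The product over i of the binomials (t_i + n_i choose n_i), as a polynomial in t.\<close>

definition binom_prod :: "('p::finite \<Rightarrow> nat) \<Rightarrow> ('p, rat) mpoly" where
  "binom_prod n =
     (\<Prod>i\<in>UNIV. Const (1 / fact (n i)) * (\<Prod>r\<in>{1..n i}. Var i + Const (of_nat r)))"

definition hilbert_coeff ::
    "('x::finite \<Rightarrow> 'p::finite) \<Rightarrow> ('x, 'k::field) mpoly set \<Rightarrow> ('p \<Rightarrow> nat) \<Rightarrow> int" where
  "hilbert_coeff g J = (THE d. finite {n. d n \<noteq> 0} \<and>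
      hilbert_poly g J = (\<Sum>n | d n \<noteq> 0. of_int (d n) * binom_prod n))"

definition cancellation_free :: "'i set \<Rightarrow> ('i \<Rightarrow> ('p::finite, rat) mpoly) \<Rightarrow> bool" where
  "cancellation_free I s \<longleftrightarrow>
     (\<forall>i\<in>I. \<forall>i'\<in>I. \<forall>n a a'.
        s i \<noteq> 0 \<and> s i' \<noteq> 0 \<and> s i = Const a * binom_prod n \<and> s i' = Const a' * binom_prod n
        \<longrightarrow> sgn a = sgn a')"


section \<open>Simplicial complexes\<close>

definition facets :: "'x set set \<Rightarrow> 'x set set" where
  "facets \<Delta> = {F \<in> \<Delta>. \<forall>G\<in>\<Delta>. F \<subseteq> G \<longrightarrow> G = F}"

definition face_dim :: "'x set \<Rightarrow> int" where
  "face_dim F = int (card F) - 1"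

definition pure_of_dim :: "'x set set \<Rightarrow> int \<Rightarrow> bool" where
  "pure_of_dim \<Delta> d \<longleftrightarrow> (\<forall>F\<in>facets \<Delta>. face_dim F = d)"

definition generated_complex :: "'x set set \<Rightarrow> 'x set set" where
  "generated_complex \<F> = {G. \<exists>F\<in>\<F>. G \<subseteq> F}"

definition shelling_order :: "'x set set \<Rightarrow> nat \<Rightarrow> (nat \<Rightarrow> 'x set) \<Rightarrow> bool" where
  "shelling_order \<Delta> k F \<longleftrightarrow>
     bij_betw F {1..k} (facets \<Delta>) \<and>
     (\<exists>d. pure_of_dim \<Delta> d) \<and>
     (\<forall>i\<in>{2..k}. pure_of_dim (generated_complex (F ` {1..<i}) \<inter> generated_complex {F i})
                              (face_dim (F i) - 1))"

definition stanley_reisner :: "('x::finite, 'k::field) mpoly set \<Rightarrow> 'x set set" where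
  "stanley_reisner J = {F. (\<Prod>x\<in>F. Var x) \<notin> J}"

end

theory Submission
  imports Defs "HOL-Computational_Algebra.Polynomial"
begin

text \<open>
  The primes of the decomposition are generated by the variables outside the facets \<open>F j\<close>, and
  the variables \<open>l j i\<close> form the restriction of \<open>F j\<close>: a face first appears with \<open>F j\<close> in the
  shelling if and only if it lies between the restriction and \<open>F j\<close>. Sorting the monomials outside
  \<open>J\<close> by the first facet that contains their support and counting each class by
  inclusion--exclusion gives the formula for the Hilbert polynomial. In the summand of \<open>A\<close> the
  index \<open>n\<close> satisfies \<open>|n| + r + |A| = |F j|\<close>, where \<open>r\<close> is the number of degrees, so it
  determines the sign.

  Heights and the dimension of MultiProj are bounded by counting: a chain of \<open>m\<close> strict inclusions
  of primes together with \<open>e\<close> elements independent modulo the largest one yields \<open>m + e\<close> elements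
  independent modulo the smallest one, and the number of monomials outside a face ideal with
  exponents at most \<open>N\<close> grows like \<open>N\<close> to the size of the largest face.
\<close>

section \<open>Polynomials in finitely many variables\<close>

text \<open>Hilbert polynomials and Hilbert coefficients are definite descriptions, so both need
  uniqueness: a polynomial vanishing at all large integer vectors is zero, and the binomial products
  are linearly independent. The formula can then be checked by counting monomials at vectors with
  positive entries. Positivity is what makes the count over a face that misses some degree vanish,
  in agreement with its polynomial 0. The components \<open>p j\<close> are given abstractly, and
  \<open>F j\<close> only records the variables outside \<open>p j\<close>. That these primes are
  generated by variables rests on the incomparability of the facets. The number r enters twice and
  cancels: the index of a face is one less than its number of variables in each of the r degrees,
  and the dimension of MultiProj falls short of the size of a facet by r. So dim(Z) - |n| equals |A|
  for every summand with index n. The dimension matters only for a nonzero coefficient, and then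
  some facet has variables of all degrees, which yields a chain of points of the required
  length.\<close>

abbreviation lookup :: "('a \<Rightarrow>\<^sub>0 'b::zero) \<Rightarrow> 'a \<Rightarrow> 'b" where
  "lookup \<equiv> Poly_Mapping.lookup"

abbreviation keys :: "('a \<Rightarrow>\<^sub>0 'b::zero) \<Rightarrow> 'a set" where
  "keys \<equiv> Poly_Mapping.keys"

abbreviation monomial :: "'a \<Rightarrow> 'b \<Rightarrow> ('a \<Rightarrow>\<^sub>0 'b::zero)" where
  "monomial \<equiv> Poly_Mapping.single"

lemma sum_monomials: "f = (\<Sum>m\<in>keys f. monomial m (lookup f m))"
  by (rule poly_mapping_eqI) (auto simp: lookup_sum lookup_single when_def in_keys_iff)

lemma keys_add_nat: "keys (m + m' :: 'x \<Rightarrow>\<^sub>0 nat) = keys m \<union> keys m'"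
  by (auto simp: in_keys_iff lookup_add)

text \<open>With \<open>M\<close> the exponents supported on faces this gives normal forms modulo a
  face ideal; with \<open>M\<close> the exponents of one multidegree it gives homogeneous
  components.\<close>

definition mrestrict :: "'m set \<Rightarrow> ('m \<Rightarrow>\<^sub>0 'a::zero) \<Rightarrow> ('m \<Rightarrow>\<^sub>0 'a)" where
  "mrestrict M f = Abs_poly_mapping (\<lambda>m. lookup f m when m \<in> M)"

lemma lookup_mrestrict [simp]: "lookup (mrestrict M f) m = (lookup f m when m \<in> M)"
proof -
  have "finite {m. (lookup f m when m \<in> M) \<noteq> 0}"
    by (rule finite_subset[OF _ finite_keys[of f]]) (auto simp: in_keys_iff when_def)
  then show ?thesis by (simp add: mrestrict_def)
qed

lemma keys_mrestrict [simp]: "keys (mrestrict M f) = keys f \<inter> M"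
  by (auto simp: in_keys_iff when_def split: if_splits)

lemma mrestrict_add: "mrestrict M (f + g) = mrestrict M f + mrestrict M (g :: 'm \<Rightarrow>\<^sub>0 'a::comm_monoid_add)"
  by (rule poly_mapping_eqI) (simp add: lookup_add when_def)

lemma mrestrict_0 [simp]: "mrestrict M 0 = 0"
  by (rule poly_mapping_eqI) (simp add: when_def)

lemma mrestrict_sum: "mrestrict M (sum f I) = (\<Sum>i\<in>I. mrestrict M (f i :: 'm \<Rightarrow>\<^sub>0 'a::comm_monoid_add))"
  by (induction I rule: infinite_finite_induct) (auto simp: mrestrict_add)

lemma lookup_Const_mult: "lookup (Const c * f) m = c * lookup f m"
  by (simp add: Const_def mult_map_scale_conv_mult[symmetric] Poly_Mapping.map.rep_eq when_def)

lemma Const_add: "Const (a + b) = Const a + Const b"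
  by (simp add: Const_def single_add)

lemma Const_mult: "Const (a * b) = Const a * Const b"
  by (simp add: Const_def mult_single)

lemma Const_0 [simp]: "Const 0 = 0"
  by (simp add: Const_def)

lemma Const_1 [simp]: "Const 1 = 1"
  by (simp add: Const_def)

lemma mult_monomials:
  "f * g = (\<Sum>m\<in>keys f. \<Sum>m'\<in>keys g. monomial (m + m') (lookup f m * lookup g m'))"
  for f g :: "'m::comm_monoid_add \<Rightarrow>\<^sub>0 'a::comm_semiring_1"
proof -
  have "f * g = (\<Sum>m\<in>keys f. monomial m (lookup f m)) * (\<Sum>m'\<in>keys g. monomial m' (lookup g m'))"
    using sum_monomials[of f] sum_monomials[of g] by simp
  then show ?thesis by (simp add: sum_product mult_single)
qed

text \<open>The map \<open>subst\<close> is the ring homomorphism out of the monoid algebra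
  determined by coefficients and monomials. It serves for evaluation at a point and for maps to
  univariate polynomials that detect membership in a prime generated by variables.\<close>

locale mpoly_hom =
  fixes \<iota> :: "'a::comm_ring_1 \<Rightarrow> 'r::comm_ring_1" and h :: "'m::comm_monoid_add \<Rightarrow> 'r"
  assumes add: "\<iota> (a + b) = \<iota> a + \<iota> b" and mult: "\<iota> (a * b) = \<iota> a * \<iota> b" and one: "\<iota> 1 = 1"
    and h_zero: "h 0 = 1" and h_add: "h (m + m') = h m * h m'"
begin

definition subst :: "('m \<Rightarrow>\<^sub>0 'a) \<Rightarrow> 'r" where
  "subst f = (\<Sum>m\<in>keys f. \<iota> (lookup f m) * h m)"

lemma \<iota>_zero: "\<iota> 0 = 0"
  using add[of 0 0] by simp

lemma subst_superset:
  assumes "finite K" "keys f \<subseteq> K"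
  shows "subst f = (\<Sum>m\<in>K. \<iota> (lookup f m) * h m)"
  unfolding subst_def using assms by (intro sum.mono_neutral_left) (auto simp: in_keys_iff \<iota>_zero)

lemma subst_zero [simp]: "subst 0 = 0"
  by (simp add: subst_def)

lemma subst_add: "subst (f + g) = subst f + subst g"
proof -
  let ?K = "keys f \<union> keys g"
  have "subst (f + g) = (\<Sum>m\<in>?K. \<iota> (lookup (f + g) m) * h m)"
    using keys_add[of f g] by (intro subst_superset) auto
  also have "\<dots> = (\<Sum>m\<in>?K. \<iota> (lookup f m) * h m) + (\<Sum>m\<in>?K. \<iota> (lookup g m) * h m)"
    by (simp add: lookup_add add distrib_right sum.distrib)
  finally show ?thesis using subst_superset[of ?K f] subst_superset[of ?K g] by simp
qed

lemma subst_sum: "subst (sum f I) = (\<Sum>i\<in>I. subst (f i))"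
  by (induction I rule: infinite_finite_induct) (auto simp: subst_add)

lemma subst_monomial: "subst (monomial m c) = \<iota> c * h m"
  by (cases "c = 0") (auto simp: subst_def \<iota>_zero)

lemma subst_one [simp]: "subst 1 = 1"
  using subst_monomial[of 0 1] by (simp add: one h_zero)

lemma subst_mult: "subst (f * g) = subst f * subst g"
proof -
  have "subst (f * g) = (\<Sum>m\<in>keys f. \<Sum>m'\<in>keys g. \<iota> (lookup f m * lookup g m') * h (m + m'))"
    by (subst mult_monomials) (simp add: subst_sum subst_monomial)
  also have "\<dots> = subst f * subst g"
    by (simp add: subst_def sum_product mult h_add mult_ac)
  finally show ?thesis .
qed

lemma subst_prod: "subst (prod f I) = (\<Prod>i\<in>I. subst (f i))"
  by (induction I rule: infinite_finite_induct) (auto simp: subst_mult)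

end

section \<open>Evaluation of polynomials at a point\<close>

lemma mpoly_eval_hom: "mpoly_hom id (\<lambda>m. \<Prod>x\<in>UNIV. v x ^ lookup m x)" for v :: "'x::finite \<Rightarrow> 'a::comm_ring_1"
  by unfold_locales (auto simp: lookup_add power_add prod.distrib)

context
  fixes v :: "'x::finite \<Rightarrow> 'a::comm_ring_1"
begin

interpretation mpoly_hom id "\<lambda>m. \<Prod>x\<in>UNIV. v x ^ lookup m x"
  by (rule mpoly_eval_hom)

lemma mpoly_eval_eq_subst: "mpoly_eval f v = subst f"
  by (simp add: mpoly_eval_def subst_def)

lemma mpoly_eval_add [simp]: "mpoly_eval (f + g) v = mpoly_eval f v + mpoly_eval g v"
  and mpoly_eval_mult [simp]: "mpoly_eval (f * g) v = mpoly_eval f v * mpoly_eval g v"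
  and mpoly_eval_0 [simp]: "mpoly_eval 0 v = 0"
  and mpoly_eval_1 [simp]: "mpoly_eval 1 v = 1"
  and mpoly_eval_sum: "mpoly_eval (sum F I) v = (\<Sum>i\<in>I. mpoly_eval (F i) v)"
  and mpoly_eval_prod: "mpoly_eval (prod F I) v = (\<Prod>i\<in>I. mpoly_eval (F i) v)"
  by (simp_all add: mpoly_eval_eq_subst subst_add subst_mult subst_sum subst_prod)

lemma mpoly_eval_Const [simp]: "mpoly_eval (Const c) v = c"
  by (simp add: mpoly_eval_eq_subst Const_def subst_monomial)

lemma mpoly_eval_Var [simp]: "mpoly_eval (Var x) v = v x"
proof -
  have "(\<Prod>y\<in>UNIV. v y ^ lookup (monomial x 1) y) = (\<Prod>y\<in>UNIV. if y = x then v x else 1)"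
    by (intro prod.cong) (auto simp: lookup_single when_def)
  then show ?thesis by (simp add: mpoly_eval_eq_subst Var_def subst_monomial)
qed

lemma mpoly_eval_uminus [simp]: "mpoly_eval (- f) v = - mpoly_eval f v"
  using mpoly_eval_add[of f "- f"] by (simp add: add_eq_0_iff)

lemma mpoly_eval_diff [simp]: "mpoly_eval (f - g) v = mpoly_eval f v - mpoly_eval g v"
  using mpoly_eval_add[of f "- g"] by simp

lemma mpoly_eval_power [simp]: "mpoly_eval (f ^ n) v = mpoly_eval f v ^ n"
  by (induction n) auto

end

text \<open>Kronecker's substitution: finitely many exponent vectors are told apart by one weight.\<close>

lemma separating_weight:
  fixes M :: "('x::finite \<Rightarrow>\<^sub>0 nat) set"
  assumes "finite M"
  obtains w where "\<And>x. 1 \<le> w x" "inj_on (\<lambda>m. \<Sum>x\<in>UNIV. w x * lookup m x) M"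
proof -
  have "\<exists>w. (\<forall>x. 1 \<le> w x) \<and> (\<forall>m\<in>M. \<forall>m'\<in>M. (\<Sum>x\<in>X. w x * lookup m x) = (\<Sum>x\<in>X. w x * lookup m' x)
              \<longrightarrow> (\<forall>x\<in>X. lookup m x = lookup m' x))" for X :: "'x set"
  proof (induction X rule: finite_induct[OF finite])
    case 1
    show ?case by (rule exI[of _ "\<lambda>_. 1"]) simp
  next
    case (2 y X)
    then obtain w where w: "\<forall>x. 1 \<le> w x" and inj: "\<forall>m\<in>M. \<forall>m'\<in>M.
        (\<Sum>x\<in>X. w x * lookup m x) = (\<Sum>x\<in>X. w x * lookup m' x) \<longrightarrow> (\<forall>x\<in>X. lookup m x = lookup m' x)"
      by (elim exE conjE)
    \<comment> \<open>The base exceeds every exponent of \<open>y\<close> in \<open>M\<close>. In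
      base \<open>B\<close> the exponent of \<open>y\<close> is then the last digit of the new
      weight, and the old weight is the rest.\<close>
    define B where "B = Suc (Max ((\<lambda>m. lookup m y) ` M))"
    have B: "lookup m y < B" if "m \<in> M" for m
      unfolding B_def using that assms by (simp add: le_imp_less_Suc)
    have Bpos: "B \<noteq> 0" by (simp add: B_def)
    define w' where "w' x = (if x = y then 1 else B * w x)" for x
    have eq: "(\<Sum>x\<in>insert y X. w' x * lookup m x) = lookup m y + B * (\<Sum>x\<in>X. w x * lookup m x)" for m
    proof -
      have "(\<Sum>x\<in>X. w' x * lookup m x) = (\<Sum>x\<in>X. B * (w x * lookup m x))"
        by (intro sum.cong) (use 2 in \<open>auto simp: w'_def\<close>)
      then show ?thesis using 2 by (simp add: w'_def sum_distrib_left)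
    qed
    show ?case
    proof (rule exI[of _ w'], intro conjI allI ballI impI)
      show "1 \<le> w' x" for x using spec[OF w, of x] by (simp add: w'_def B_def)
    next
      fix m m' x assume m: "m \<in> M" "m' \<in> M"
        and e: "(\<Sum>x\<in>insert y X. w' x * lookup m x) = (\<Sum>x\<in>insert y X. w' x * lookup m' x)"
        and x: "x \<in> insert y X"
      have *: "lookup m y + B * (\<Sum>x\<in>X. w x * lookup m x) = lookup m' y + B * (\<Sum>x\<in>X. w x * lookup m' x)"
        using e by (simp only: eq)
      have "lookup m y = lookup m' y"
        using arg_cong[OF *, of "\<lambda>a. a mod B"] B[OF m(1)] B[OF m(2)] by (simp only: mod_mult_self2 mod_less)
      moreover have "(\<Sum>x\<in>X. w x * lookup m x) = (\<Sum>x\<in>X. w x * lookup m' x)"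
        using arg_cong[OF *, of "\<lambda>a. a div B"] B[OF m(1)] B[OF m(2)] by (simp add: div_mult_self2[of B] Bpos)
      ultimately show "lookup m x = lookup m' x" using inj m x by blast
    qed
  qed
  from this[of UNIV] obtain w where w: "\<forall>x. 1 \<le> w x" and
    inj: "\<forall>m\<in>M. \<forall>m'\<in>M. (\<Sum>x\<in>UNIV. w x * lookup m x) = (\<Sum>x\<in>UNIV. w x * lookup m' x) \<longrightarrow> (\<forall>x\<in>UNIV. lookup m x = lookup m' x)"
    by (elim exE conjE)
  show ?thesis
  proof (rule that[of w])
    show "1 \<le> w x" for x using w by blast
    show "inj_on (\<lambda>m. \<Sum>x\<in>UNIV. w x * lookup m x) M"
    proof (rule inj_onI)
      fix m m' assume "m \<in> M" "m' \<in> M" "(\<Sum>x\<in>UNIV. w x * lookup m x) = (\<Sum>x\<in>UNIV. w x * lookup m' x)"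
      with inj have "\<forall>x. lookup m x = lookup m' x" by blast
      then show "m = m'" by (intro poly_mapping_eqI) blast
    qed
  qed
qed

text \<open>Replacing variable \<open>i\<close> by \<open>t ^ w i\<close>, with \<open>w\<close>
  separating the exponents of \<open>P\<close>, gives a univariate polynomial with the same
  coefficients, and every large integer \<open>t\<close> is a root of it.\<close>

lemma mpoly_eq_0_if_eventually:
  fixes P :: "('p::finite, rat) mpoly"
  assumes "\<And>v. (\<And>i. N \<le> v i) \<Longrightarrow> mpoly_eval P (\<lambda>i. of_nat (v i)) = 0"
  shows "P = 0"
proof -
  obtain w :: "'p \<Rightarrow> nat" where w: "\<And>x. 1 \<le> w x" and inj: "inj_on (\<lambda>m. \<Sum>x\<in>UNIV. w x * lookup m x) (keys P)"
    using separating_weight[of "keys P"] by auto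
  let ?code = "\<lambda>m. \<Sum>x\<in>UNIV. w x * lookup m x"
  define Q where "Q = (\<Sum>m\<in>keys P. monom (lookup P m) (?code m))"
  have coeff: "coeff Q (?code m) = lookup P m" if "m \<in> keys P" for m
  proof -
    have "coeff Q (?code m) = (\<Sum>m'\<in>keys P. if m' = m then lookup P m' else 0)"
      unfolding Q_def coeff_sum using inj that
      by (intro sum.cong) (auto simp: inj_on_def)
    then show ?thesis using that by simp
  qed
  have "poly Q (of_nat t) = 0" if "N + 1 \<le> t" for t
  proof -
    \<comment> \<open>This is where \<open>1 \<le> w i\<close> is used: powers of \<open>t\<close>
      with positive exponent are at least \<open>t\<close>.\<close>
    have "N \<le> t ^ w i" for i
      using that w[of i] self_le_power[of t "w i"] by linarith
    then have "0 = mpoly_eval P (\<lambda>i. of_nat (t ^ w i))"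
      using assms[of "\<lambda>i. t ^ w i"] by simp
    also have "\<dots> = poly Q (of_nat t)"
      by (simp add: Q_def poly_sum poly_monom mpoly_eval_def power_sum power_mult)
    finally show ?thesis by simp
  qed
  then have "of_nat ` {N+1..} \<subseteq> {x. poly Q x = 0}" by auto
  moreover have "infinite (of_nat ` {N+1..} :: rat set)"
    by (subst finite_image_iff) (auto simp: inj_on_def infinite_Ici)
  ultimately have "Q = 0" using poly_roots_finite finite_subset by blast
  then have "lookup P m = 0" for m using coeff[of m] by (auto simp: in_keys_iff)
  then show ?thesis by (intro poly_mapping_eqI) simp
qed

section \<open>Monomial ideals\<close>

lemma mpoly_ring_simps [simp]:
  "carrier mpoly_ring = UNIV" "a \<otimes>\<^bsub>mpoly_ring\<^esub> b = a * b" "a \<oplus>\<^bsub>mpoly_ring\<^esub> b = a + b"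
  "\<zero>\<^bsub>mpoly_ring\<^esub> = 0" "\<one>\<^bsub>mpoly_ring\<^esub> = 1"
  by (simp_all add: mpoly_ring_def)

lemma cring_mpoly_ring: "cring (mpoly_ring :: ('x, 'a::comm_ring_1) mpoly ring)"
proof (intro cringI abelian_groupI comm_monoidI, simp_all only: mpoly_ring_simps)
  show "\<exists>y\<in>UNIV. y + x = 0" for x :: "('x, 'a) mpoly"
    by (rule bexI[of _ "- x"]) simp_all
qed (simp_all add: ac_simps distrib_left)

lemma ring_mpoly_ring: "ring (mpoly_ring :: ('x, 'a::comm_ring_1) mpoly ring)"
  using cring_mpoly_ring by (rule cring.axioms)

lemma a_inv_mpoly_ring [simp]: "\<ominus>\<^bsub>mpoly_ring\<^esub> a = - (a :: ('x, 'a::comm_ring_1) mpoly)"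
proof -
  interpret cring "mpoly_ring :: ('x, 'a) mpoly ring" by (rule cring_mpoly_ring)
  show ?thesis using minus_equality[of "- a" a] by simp
qed

lemma ideal_mpoly_ring_iff:
  fixes I :: "('x, 'a::comm_ring_1) mpoly set"
  shows "ideal I mpoly_ring \<longleftrightarrow> 0 \<in> I \<and> (\<forall>a\<in>I. \<forall>b\<in>I. a + b \<in> I) \<and> (\<forall>a\<in>I. \<forall>r. r * a \<in> I)"
proof
  assume "ideal I mpoly_ring"
  then interpret ideal I "mpoly_ring :: ('x, 'a) mpoly ring" .
  have sg: "additive_subgroup I (mpoly_ring :: ('x, 'a) mpoly ring)" ..
  show "0 \<in> I \<and> (\<forall>a\<in>I. \<forall>b\<in>I. a + b \<in> I) \<and> (\<forall>a\<in>I. \<forall>r. r * a \<in> I)"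
    using additive_subgroup.zero_closed[OF sg] additive_subgroup.a_closed[OF sg] I_l_closed by simp
next
  assume I: "0 \<in> I \<and> (\<forall>a\<in>I. \<forall>b\<in>I. a + b \<in> I) \<and> (\<forall>a\<in>I. \<forall>r. r * a \<in> I)"
  then have neg: "- a \<in> I" if "a \<in> I" for a
    using that by (metis mult_minus1)
  show "ideal I mpoly_ring"
  proof (intro idealI ring_mpoly_ring)
    show "subgroup I (add_monoid mpoly_ring)"
    proof
      show "inv\<^bsub>add_monoid mpoly_ring\<^esub> x \<in> I" if "x \<in> I" for x
        using neg[OF that] a_inv_mpoly_ring[of x] by (simp only: a_inv_def)
    qed (use I in auto)
  qed (use I in \<open>auto simp: mult.commute\<close>)
qed

lemma ideal_mpoly_ring_sum:
  fixes I :: "('x, 'a::comm_ring_1) mpoly set"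
  assumes "ideal I mpoly_ring" "\<And>i. i \<in> A \<Longrightarrow> f i \<in> I"
  shows "sum f A \<in> I"
  using assms(2) by (induction A rule: infinite_finite_induct) (use assms(1) in \<open>auto simp: ideal_mpoly_ring_iff\<close>)

lemma ideal_mpoly_ring_diff:
  fixes I :: "('x, 'a::comm_ring_1) mpoly set"
  assumes "ideal I mpoly_ring" "f \<in> I" "g \<in> I"
  shows "f - g \<in> I"
proof -
  have "f + (- 1) * g \<in> I" using assms unfolding ideal_mpoly_ring_iff by blast
  then show ?thesis by simp
qed

lemma ideal_mpoly_ring_eq_UNIV:
  fixes I :: "('x, 'a::comm_ring_1) mpoly set"
  assumes "ideal I mpoly_ring" "1 \<in> I"
  shows "I = UNIV"
proof -
  have "r * 1 \<in> I" for r using assms unfolding ideal_mpoly_ring_iff by blast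
  then show ?thesis by auto
qed

lemma primeideal_mpoly_ring_iff:
  fixes I :: "('x, 'a::comm_ring_1) mpoly set"
  shows "primeideal I mpoly_ring \<longleftrightarrow>
    ideal I mpoly_ring \<and> I \<noteq> UNIV \<and> (\<forall>a b. a * b \<in> I \<longrightarrow> a \<in> I \<or> b \<in> I)"
proof
  assume "primeideal I mpoly_ring"
  then show "ideal I mpoly_ring \<and> I \<noteq> UNIV \<and> (\<forall>a b. a * b \<in> I \<longrightarrow> a \<in> I \<or> b \<in> I)"
    using primeideal.I_notcarr primeideal.I_prime primeideal.axioms(1) by fastforce
next
  assume "ideal I mpoly_ring \<and> I \<noteq> UNIV \<and> (\<forall>a b. a * b \<in> I \<longrightarrow> a \<in> I \<or> b \<in> I)"
  then show "primeideal I mpoly_ring"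
    by (intro primeidealI cring_mpoly_ring) auto
qed

text \<open>The Stanley-Reisner ideal of a complex, described by its terms instead of its
  generators, so that membership is decided term by term. For \<open>Pow F\<close> it becomes a
  prime generated by variables.\<close>

definition face_ideal :: "'x set set \<Rightarrow> ('x, 'k::field) mpoly set" where
  "face_ideal \<Delta> = {f. \<forall>m\<in>keys f. keys m \<notin> \<Delta>}"

text \<open>The empty family is allowed; \<open>{} \<in> \<Delta>\<close> is a separate hypothesis
  where the quotient ring has to be nonzero.\<close>

definition simplicial_complex :: "'x set set \<Rightarrow> bool" where
  "simplicial_complex \<Delta> \<longleftrightarrow> (\<forall>F\<in>\<Delta>. \<forall>G\<subseteq>F. G \<in> \<Delta>)"

text \<open>The prime ideal generated by the variables outside \<open>F\<close>.\<close>

abbreviation var_ideal :: "'x set \<Rightarrow> ('x, 'k::field) mpoly set" where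
  "var_ideal F \<equiv> face_ideal (Pow F)"

lemma simplicial_complex_Pow [simp]: "simplicial_complex (Pow F)"
  by (auto simp: simplicial_complex_def)

lemma ideal_face_ideal:
  assumes "simplicial_complex \<Delta>"
  shows "ideal (face_ideal \<Delta> :: ('x, 'k::field) mpoly set) mpoly_ring"
  unfolding ideal_mpoly_ring_iff
proof (intro conjI ballI allI)
  show "0 \<in> face_ideal \<Delta>" by (simp add: face_ideal_def)
  fix a :: "('x, 'k) mpoly" assume a: "a \<in> face_ideal \<Delta>"
  show "a + b \<in> face_ideal \<Delta>" if "b \<in> face_ideal \<Delta>" for b
    using a that keys_add[of a b] by (auto simp: face_ideal_def)
  show "r * a \<in> face_ideal \<Delta>" for r
    unfolding face_ideal_def
  proof (intro CollectI ballI notI)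
    fix m assume "m \<in> keys (r * a)" and \<Delta>: "keys m \<in> \<Delta>"
    then obtain m1 m2 where m: "m = m1 + m2" "m2 \<in> keys a" using keys_mult[of r a] by auto
    then have "keys m2 \<in> \<Delta>" using \<Delta> assms by (auto simp: simplicial_complex_def keys_add_nat)
    with m(2) a show False by (auto simp: face_ideal_def)
  qed
qed

lemmas ideal_var_ideal = ideal_face_ideal[OF simplicial_complex_Pow]

lemma Var_in_face_ideal: "Var x \<in> face_ideal \<Delta> \<longleftrightarrow> {x} \<notin> \<Delta>"
  by (simp add: face_ideal_def Var_def)

lemma Var_in_var_ideal [simp]: "Var x \<in> var_ideal F \<longleftrightarrow> x \<notin> F"
  by (simp add: Var_in_face_ideal)

lemma face_ideal_antimono: "\<Delta> \<subseteq> \<Delta>' \<Longrightarrow> face_ideal \<Delta>' \<subseteq> face_ideal \<Delta>"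
  by (auto simp: face_ideal_def)

lemma var_ideal_subset_iff: "var_ideal F \<subseteq> var_ideal G \<longleftrightarrow> G \<subseteq> F"
  by (metis Pow_mono Var_in_var_ideal face_ideal_antimono subset_iff)

lemma one_in_face_ideal: "1 \<in> face_ideal \<Delta> \<longleftrightarrow> {} \<notin> \<Delta>"
  by (simp add: face_ideal_def)

text \<open>The homomorphism to univariate polynomials that kills the variables outside
  \<open>F\<close> and sends a variable \<open>x\<close> in \<open>F\<close> to the power
  \<open>w x\<close> of the indeterminate has values in a domain. Its kernel contains the ideal.
  Conversely, the weight is chosen to separate the terms of the two given factors, so a factor
  mapped to 0 has no term supported in \<open>F\<close>.\<close>

lemma primeideal_var_ideal: "primeideal (var_ideal F :: ('x::finite, 'k::field) mpoly set) mpoly_ring"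
  unfolding primeideal_mpoly_ring_iff
proof (intro conjI allI impI)
  show "ideal (var_ideal F :: ('x, 'k) mpoly set) mpoly_ring" by (rule ideal_var_ideal)
  have "1 \<notin> (var_ideal F :: ('x, 'k) mpoly set)" by (simp add: one_in_face_ideal)
  then show "(var_ideal F :: ('x, 'k) mpoly set) \<noteq> UNIV" by blast
next
  fix f g :: "('x, 'k) mpoly" assume fg: "f * g \<in> var_ideal F"
  obtain w :: "'x \<Rightarrow> nat" where inj: "inj_on (\<lambda>m. \<Sum>x\<in>UNIV. w x * lookup m x) (keys f \<union> keys g)"
    using separating_weight[of "keys f \<union> keys g"] by auto
  let ?code = "\<lambda>m. \<Sum>x\<in>UNIV. w x * lookup m x"
  let ?h = "\<lambda>m. if keys m \<subseteq> F then monom 1 (?code m) else 0 :: 'k poly"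
  interpret mpoly_hom "\<lambda>c::'k. [:c:]" ?h
    by unfold_locales
      (auto simp: keys_add_nat mult_monom lookup_add distrib_left sum.distrib one_pCons mult.commute monom_0)
  have "subst (f * g) = 0"
    unfolding subst_def using fg by (intro sum.neutral) (auto simp: face_ideal_def)
  then have "subst f = 0 \<or> subst g = 0" by (simp add: subst_mult)
  moreover have "e \<in> var_ideal F" if e: "subst e = 0" "inj_on ?code (keys e)" for e
  proof (rule ccontr)
    assume "e \<notin> var_ideal F"
    then obtain m where m: "m \<in> keys e" "keys m \<subseteq> F" by (auto simp: face_ideal_def)
    have "0 = coeff (subst e) (?code m)" using e(1) by simp
    also have "\<dots> = (\<Sum>m'\<in>keys e. if m' = m then lookup e m else 0)"
      unfolding subst_def coeff_sum using e(2) m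
      by (intro sum.cong) (auto simp: inj_on_def)
    also have "\<dots> = lookup e m" using m by simp
    finally show False using m by (simp add: in_keys_iff)
  qed
  ultimately show "f \<in> var_ideal F \<or> g \<in> var_ideal F"
    using inj_on_subset[OF inj] by blast
qed

definition squarefree_exponent :: "'x set \<Rightarrow> 'x \<Rightarrow>\<^sub>0 nat" where
  "squarefree_exponent F = (\<Sum>x\<in>F. monomial x 1)"

lemma prod_Var: "(\<Prod>x\<in>F. Var x) = monomial (squarefree_exponent F) (1::'a::comm_ring_1)"
  unfolding squarefree_exponent_def
  by (induction F rule: infinite_finite_induct) (auto simp: Var_def mult_single)

lemma lookup_squarefree_exponent: "lookup (squarefree_exponent F) y = (if y \<in> F then 1 else 0)" for F :: "'x::finite set"
  by (simp add: squarefree_exponent_def lookup_sum lookup_single when_def)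

lemma keys_squarefree_exponent [simp]: "keys (squarefree_exponent F) = F" for F :: "'x::finite set"
  by (auto simp: in_keys_iff lookup_squarefree_exponent split: if_splits)

lemma prod_Var_in_face_ideal [simp]: "(\<Prod>x\<in>F. Var x) \<in> face_ideal \<Delta> \<longleftrightarrow> F \<notin> \<Delta>" for F :: "'x::finite set"
  by (simp add: face_ideal_def prod_Var)

lemma stanley_reisner_face_ideal [simp]: "stanley_reisner (face_ideal \<Delta> :: ('x::finite, 'k::field) mpoly set) = \<Delta>"
  by (simp add: stanley_reisner_def)

text \<open>A monomial is a multiple of a squarefree generator exactly when its support contains
  that of the generator.\<close>

lemma genideal_squarefree:
  fixes \<F> :: "'x::finite set set"
  shows "Idl\<^bsub>mpoly_ring\<^esub> ((\<lambda>F. \<Prod>x\<in>F. Var x) ` \<F>) =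
    (face_ideal {G. \<not> (\<exists>F\<in>\<F>. F \<subseteq> G)} :: ('x, 'k::field) mpoly set)" (is "?I = face_ideal ?\<Delta>")
proof
  interpret cring "mpoly_ring :: ('x, 'k) mpoly ring" by (rule cring_mpoly_ring)
  show "?I \<subseteq> face_ideal ?\<Delta>"
  proof (rule genideal_minimal)
    show "ideal (face_ideal ?\<Delta> :: ('x, 'k) mpoly set) mpoly_ring"
      by (rule ideal_face_ideal) (auto simp: simplicial_complex_def)
  qed auto
  have I: "ideal ?I mpoly_ring" by (rule genideal_ideal) simp
  show "face_ideal ?\<Delta> \<subseteq> ?I"
  proof
    fix f :: "('x, 'k) mpoly" assume f: "f \<in> face_ideal ?\<Delta>"
    have "monomial m (lookup f m) \<in> ?I" if "m \<in> keys f" for m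
    proof -
      obtain F where F: "F \<in> \<F>" "F \<subseteq> keys m" using f \<open>m \<in> keys f\<close> by (auto simp: face_ideal_def)
      let ?e = "squarefree_exponent F"
      \<comment> \<open>Subtraction of exponents is truncated; it is exact here because
        \<open>F \<subseteq> keys m\<close>.\<close>
      have "m = (m - ?e) + ?e"
        using F(2) by (intro poly_mapping_eqI) (auto simp: lookup_add lookup_minus lookup_squarefree_exponent in_keys_iff)
      then have "monomial m (lookup f m) = monomial ((m - ?e) + ?e) (lookup f m * 1)"
        by simp
      then have "monomial m (lookup f m) = monomial (m - ?e) (lookup f m) * (\<Prod>x\<in>F. Var x)"
        by (simp only: prod_Var mult_single)
      moreover have "(\<Prod>x\<in>F. Var x) \<in> ?I"
        by (rule subsetD[OF genideal_self]) (use F(1) in auto)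
      ultimately show ?thesis using I unfolding ideal_mpoly_ring_iff by simp
    qed
    then have "(\<Sum>m\<in>keys f. monomial m (lookup f m)) \<in> ?I"
      by (rule ideal_mpoly_ring_sum[OF I])
    then show "f \<in> ?I" by (simp only: sum_monomials[symmetric])
  qed
qed

lemma squarefree_monomial_ideal_eq:
  fixes J :: "('x::finite, 'k::field) mpoly set"
  assumes "squarefree_monomial_ideal J"
  shows "J = face_ideal (stanley_reisner J)" "simplicial_complex (stanley_reisner J)"
proof -
  obtain \<F> where "J = Idl\<^bsub>mpoly_ring\<^esub> ((\<lambda>F. \<Prod>x\<in>F. Var x) ` \<F>)"
    using assms by (auto simp: squarefree_monomial_ideal_def)
  then have J: "J = face_ideal {G. \<not> (\<exists>F\<in>\<F>. F \<subseteq> G)}" by (simp add: genideal_squarefree)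
  then show "J = face_ideal (stanley_reisner J)" by (simp only: stanley_reisner_face_ideal)
  show "simplicial_complex (stanley_reisner J)" unfolding J stanley_reisner_face_ideal by (auto simp: simplicial_complex_def)
qed

lemma var_ideal_add: "var_ideal F <+>\<^bsub>mpoly_ring\<^esub> var_ideal G = (var_ideal (F \<inter> G) :: ('x, 'k::field) mpoly set)"
proof
  show "var_ideal F <+>\<^bsub>mpoly_ring\<^esub> var_ideal G \<subseteq> (var_ideal (F \<inter> G) :: ('x, 'k) mpoly set)"
  proof
    fix f :: "('x, 'k) mpoly" assume "f \<in> var_ideal F <+>\<^bsub>mpoly_ring\<^esub> var_ideal G"
    then obtain a b where "f = a + b" "a \<in> var_ideal F" "b \<in> var_ideal G" by (auto simp: set_add_def')
    then show "f \<in> var_ideal (F \<inter> G)" using keys_add[of a b] by (auto simp: face_ideal_def)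
  qed
  show "(var_ideal (F \<inter> G) :: ('x, 'k) mpoly set) \<subseteq> var_ideal F <+>\<^bsub>mpoly_ring\<^esub> var_ideal G"
  proof
    fix f :: "('x, 'k) mpoly" assume f: "f \<in> var_ideal (F \<inter> G)"
    \<comment> \<open>Terms not supported in \<open>F\<close> lie in the first ideal; a remaining
      term is supported in \<open>F\<close>, hence not in \<open>G\<close>.\<close>
    let ?a = "mrestrict {m. \<not> keys m \<subseteq> F} f" and ?b = "mrestrict {m. keys m \<subseteq> F} f"
    have "f = ?a + ?b" by (rule poly_mapping_eqI) (simp add: lookup_add when_def)
    moreover have "?a \<in> var_ideal F" by (simp add: face_ideal_def)
    moreover have "?b \<in> var_ideal G" using f by (auto simp: face_ideal_def)
    ultimately show "f \<in> var_ideal F <+>\<^bsub>mpoly_ring\<^esub> var_ideal G" by (auto simp: set_add_def')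
  qed
qed

lemma add_vars_var_ideal: "add_vars (var_ideal F) X = (var_ideal (F - X) :: ('x::finite, 'k::field) mpoly set)"
proof -
  have "(\<lambda>F. \<Prod>x\<in>F. Var x) ` ((\<lambda>x. {x}) ` X) = (Var ` X :: ('x, 'k) mpoly set)"
    by (auto simp: image_image)
  then have "Idl\<^bsub>mpoly_ring\<^esub> (Var ` X) = (face_ideal {G. \<not> (\<exists>F\<in>(\<lambda>x. {x}) ` X. F \<subseteq> G)} :: ('x, 'k) mpoly set)"
    using genideal_squarefree[of "(\<lambda>x. {x}) ` X", where 'k='k] by simp
  also have "{G. \<not> (\<exists>F\<in>(\<lambda>x. {x}) ` X. F \<subseteq> G)} = Pow (- X)" by auto
  finally show ?thesis by (simp add: add_vars_def var_ideal_add Diff_eq)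
qed

lemma var_ideal_subset:
  fixes I :: "('x::finite, 'k::field) mpoly set"
  assumes "ideal I mpoly_ring" "\<And>x. x \<notin> F \<Longrightarrow> Var x \<in> I"
  shows "var_ideal F \<subseteq> I"
proof -
  \<comment> \<open>Since \<open>var_ideal UNIV\<close> is the zero ideal, adding the variables
    outside \<open>F\<close> to it shows that they generate \<open>var_ideal F\<close>.\<close>
  have "add_vars (var_ideal UNIV) (- F) = (var_ideal (UNIV - - F) :: ('x, 'k) mpoly set)"
    by (rule add_vars_var_ideal)
  moreover have "var_ideal UNIV = ({0} :: ('x, 'k) mpoly set)"
  proof -
    have "f = 0" if "f \<in> var_ideal UNIV" for f :: "('x, 'k) mpoly"
      using sum_monomials[of f] that by (simp add: face_ideal_def)
    then show ?thesis by (auto simp: face_ideal_def)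
  qed
  moreover have "{0} <+>\<^bsub>mpoly_ring\<^esub> I = I" for I :: "('x, 'k) mpoly set"
    by (simp add: set_add_def')
  ultimately have eq: "var_ideal F = Idl\<^bsub>mpoly_ring\<^esub> (Var ` (- F) :: ('x, 'k) mpoly set)"
    by (simp only: add_vars_def) simp
  show ?thesis
    unfolding eq by (rule ring.genideal_minimal[OF ring_mpoly_ring assms(1)]) (use assms(2) in auto)
qed

text \<open>The squarefree monomial of \<open>F\<close> is the witness: it lies outside
  \<open>var_ideal F\<close>, so it cannot lie in the face ideal.\<close>

lemma face_ideal_subset_var_ideal_iff:
  "(face_ideal \<Delta> :: ('x::finite, 'k::field) mpoly set) \<subseteq> var_ideal F \<longleftrightarrow> F \<in> \<Delta>" if "simplicial_complex \<Delta>"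
proof
  assume *: "(face_ideal \<Delta> :: ('x, 'k) mpoly set) \<subseteq> var_ideal F"
  show "F \<in> \<Delta>" using subsetD[OF *, of "\<Prod>x\<in>F. Var x"] by auto
qed (use that in \<open>auto simp: face_ideal_def simplicial_complex_def\<close>)

text \<open>A monomial in the variables of \<open>F j\<close> that lies in all the other components takes
  \<open>p j\<close> into \<open>J\<close>, and \<open>J\<close> lies in the prime of \<open>F j\<close>.\<close>

lemma component_eq_var_ideal:
  fixes p :: "nat \<Rightarrow> ('x::finite, 'k::field) mpoly set"
  assumes F_def: "\<And>i. F i = {x. Var x \<notin> p i}" and \<Delta>: "simplicial_complex \<Delta>" and J: "face_ideal \<Delta> = (\<Inter>i\<in>{1..k}. p i)"
    and p: "\<And>i. i \<in> {1..k} \<Longrightarrow> ideal (p i) mpoly_ring"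
    and F: "bij_betw F {1..k} (facets \<Delta>)" and j: "j \<in> {1..k}"
  shows "p j = var_ideal (F j)"
proof (rule subset_antisym)
  have Fj: "F i \<in> facets \<Delta>" if "i \<in> {1..k}" for i using bij_betw_apply[OF F that] .
  have "\<exists>x. x \<in> F j \<and> x \<notin> F i" if "i \<in> {1..k} - {j}" for i
  proof (rule ccontr)
    assume "\<nexists>x. x \<in> F j \<and> x \<notin> F i"
    then have "F j \<subseteq> F i" by blast
    moreover have "F i \<in> facets \<Delta>" using Fj that by simp
    ultimately have "F i = F j" using Fj[OF j] by (simp add: facets_def)
    then have "i = j" using bij_betw_imp_inj_on[OF F] that j by (simp add: inj_on_eq_iff)
    then show False using that by blast
  qed
  then have "\<forall>i\<in>{1..k} - {j}. \<exists>x. x \<in> F j \<and> x \<notin> F i" by (rule ballI)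
  from bchoice[OF this] obtain x where x: "\<forall>i\<in>{1..k} - {j}. x i \<in> F j \<and> x i \<notin> F i" by (rule exE)
  \<comment> \<open>A variable outside \<open>F i\<close> lies in \<open>p i\<close> by definition
    of \<open>F\<close>, so this product lies in every component with index other than
    \<open>j\<close>. All its factors are in \<open>F j\<close>.\<close>
  let ?h = "\<Prod>i\<in>{1..k} - {j}. Var (x i) :: ('x, 'k) mpoly"
  have hp: "?h \<in> p i" if "i \<in> {1..k} - {j}" for i
  proof -
    have "?h = (\<Prod>i'\<in>{1..k} - {j} - {i}. Var (x i')) * Var (x i)"
      using prod.remove[OF _ that, of "\<lambda>i. Var (x i) :: ('x, 'k) mpoly"] by (simp add: mult.commute)
    moreover have "Var (x i) \<in> p i" using bspec[OF x that] unfolding F_def by simp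
    ultimately show ?thesis using p[of i] that unfolding ideal_mpoly_ring_iff by auto
  qed
  have prime: "a \<in> var_ideal (F j) \<or> b \<in> var_ideal (F j)" if "a * b \<in> var_ideal (F j)" for a b :: "('x, 'k) mpoly"
    using primeideal_var_ideal[of "F j", where 'k='k] that by (simp add: primeideal_mpoly_ring_iff)
  have h: "?h \<notin> (var_ideal (F j) :: ('x, 'k) mpoly set)"
  proof -
    have "(\<Prod>i\<in>A. Var (x i) :: ('x, 'k) mpoly) \<notin> var_ideal (F j)" if "A \<subseteq> {1..k} - {j}" for A
      using finite_subset[OF that, simplified] that
    proof (induction A rule: finite_induct)
      case empty
      show ?case by (simp add: one_in_face_ideal)
    next
      case (insert i A)
      then have "Var (x i) \<notin> (var_ideal (F j) :: ('x, 'k) mpoly set)" using x by simp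
      moreover have "(\<Prod>i\<in>A. Var (x i)) \<notin> (var_ideal (F j) :: ('x, 'k) mpoly set)" using insert by simp
      ultimately have "Var (x i) * (\<Prod>i\<in>A. Var (x i)) \<notin> (var_ideal (F j) :: ('x, 'k) mpoly set)" using prime by blast
      then show ?case using insert.hyps by simp
    qed
    then show ?thesis by blast
  qed
  have "face_ideal \<Delta> \<subseteq> (var_ideal (F j) :: ('x, 'k) mpoly set)"
    using face_ideal_subset_var_ideal_iff[OF \<Delta>, of "F j", where 'k='k] Fj[OF j] unfolding facets_def by simp
  note J_subset = subsetD[OF this]
  show "p j \<subseteq> var_ideal (F j)"
  proof
    fix f assume f: "f \<in> p j"
    have "f * ?h \<in> p i" if "i \<in> {1..k}" for i
    proof (cases "i = j")
      case True
      then have "?h * f \<in> p i" using f p[OF that] unfolding ideal_mpoly_ring_iff by blast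
      then show ?thesis by (simp add: mult.commute)
    next
      case False
      then show ?thesis using hp[of i] p[OF that] that unfolding ideal_mpoly_ring_iff by blast
    qed
    then have "f * ?h \<in> face_ideal \<Delta>" unfolding J by (rule INT_I)
    then have "f * ?h \<in> var_ideal (F j)" by (rule J_subset)
    then show "f \<in> var_ideal (F j)" using prime h by blast
  qed
  show "var_ideal (F j) \<subseteq> p j"
    using p[OF j] by (rule var_ideal_subset) (simp add: F_def)
qed

section \<open>Chains of primes and algebraic independence\<close>

definition power_product :: "('x, 'k::field) mpoly list \<Rightarrow> nat list \<Rightarrow> ('x, 'k) mpoly" where
  "power_product fs es = (\<Prod>i<length fs. fs ! i ^ es ! i)"

text \<open>For an ideal \<open>I\<close> this says that the classes modulo \<open>I\<close> are
  algebraically independent over the field. Exponents are lists, so that an element can be put in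
  front and a relation split by the heads of its exponent lists.\<close>

definition alg_indep_mod :: "('x, 'k::field) mpoly set \<Rightarrow> ('x, 'k) mpoly list \<Rightarrow> bool" where
  "alg_indep_mod I fs \<longleftrightarrow> (\<forall>E c. finite E \<and> (\<forall>es\<in>E. length es = length fs) \<and>
     (\<Sum>es\<in>E. Const (c es) * power_product fs es) \<in> I \<longrightarrow> (\<forall>es\<in>E. c es = 0))"

lemma alg_indep_modD:
  assumes "alg_indep_mod I fs" "finite E" "\<And>es. es \<in> E \<Longrightarrow> length es = length fs"
    "(\<Sum>es\<in>E. Const (c es) * power_product fs es) \<in> I" "es \<in> E"
  shows "c es = 0"
  using assms(1)[unfolded alg_indep_mod_def, rule_format, of E c es] assms(2-5) by blast

lemma alg_indep_mod_antimono: "alg_indep_mod I fs \<Longrightarrow> I' \<subseteq> I \<Longrightarrow> alg_indep_mod I' fs"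
  unfolding alg_indep_mod_def by blast

lemma power_product_Cons: "power_product (f # fs) (e # es) = f ^ e * power_product fs es"
  unfolding power_product_def by (simp add: prod.lessThan_Suc_shift del: prod.lessThan_Suc)

lemma primeideal_power:
  fixes P :: "('x, 'a::comm_ring_1) mpoly set"
  assumes "primeideal P mpoly_ring" "f ^ n \<in> P"
  shows "f \<in> P"
  using assms(2)
proof (induction n)
  case 0
  then show ?case using assms(1) ideal_mpoly_ring_eq_UNIV[of P] by (simp add: primeideal_mpoly_ring_iff)
next
  case (Suc n)
  then show ?case using assms(1) by (auto simp: primeideal_mpoly_ring_iff)
qed

text \<open>Divide a relation by the lowest power of \<open>f\<close> in it and read the quotient modulo \<open>Q\<close>:
  only the terms without \<open>f\<close> survive.\<close>

lemma alg_indep_mod_Cons: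
  fixes P Q :: "('x, 'k::field) mpoly set"
  assumes P: "primeideal P mpoly_ring" and Q: "ideal Q mpoly_ring" and "P \<subseteq> Q"
    and f: "f \<in> Q" "f \<notin> P" and fs: "alg_indep_mod Q fs"
  shows "alg_indep_mod P (f # fs)"
  unfolding alg_indep_mod_def
proof (intro allI impI)
  fix E and c :: "nat list \<Rightarrow> 'k"
  assume "finite E \<and> (\<forall>es\<in>E. length es = length (f # fs)) \<and>
    (\<Sum>es\<in>E. Const (c es) * power_product (f # fs) es) \<in> P"
  then have fin: "finite E" and len: "\<And>es. es \<in> E \<Longrightarrow> length es = Suc (length fs)"
    and sum: "(\<Sum>es\<in>E. Const (c es) * power_product (f # fs) es) \<in> P" by auto
  show "\<forall>es\<in>E. c es = 0"
  proof (rule ccontr)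
    define E' where "E' = {es \<in> E. c es \<noteq> 0}"
    assume "\<not> (\<forall>es\<in>E. c es = 0)"
    then have ne: "E' \<noteq> {}" by (auto simp: E'_def)
    have fin': "finite E'" using fin by (simp add: E'_def)
    define e where "e = Min (hd ` E')"
    have e_le: "e \<le> hd es" if "es \<in> E'" for es using that fin' by (simp add: e_def)
    have "e \<in> hd ` E'" unfolding e_def using fin' ne by (intro Min_in) auto
    then obtain es0 where es0: "es0 \<in> E'" "hd es0 = e" by auto
    have cons: "es = hd es # tl es" if "es \<in> E'" for es
      using len[of es] that by (cases es) (auto simp: E'_def)
    define r where "r es = Const (c es) * power_product fs (tl es)" for es
    have "(\<Sum>es\<in>E. Const (c es) * power_product (f # fs) es) =
        (\<Sum>es\<in>E'. Const (c es) * power_product (f # fs) es)"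
      unfolding E'_def using fin by (intro sum.mono_neutral_right) auto
    also have "\<dots> = (\<Sum>es\<in>E'. f ^ e * (f ^ (hd es - e) * r es))"
    proof (rule sum.cong[OF refl])
      fix es assume es: "es \<in> E'"
      have "power_product (f # fs) es = f ^ hd es * power_product fs (tl es)"
        by (subst cons[OF es]) (simp add: power_product_Cons)
      moreover have "f ^ hd es = f ^ e * f ^ (hd es - e)"
        using e_le[OF es] by (simp flip: power_add)
      ultimately show "Const (c es) * power_product (f # fs) es = f ^ e * (f ^ (hd es - e) * r es)"
        by (simp add: r_def mult_ac)
    qed
    finally have "f ^ e * (\<Sum>es\<in>E'. f ^ (hd es - e) * r es) \<in> P"
      using sum by (simp add: sum_distrib_left)
    moreover have "f ^ e \<notin> P" using f(2) primeideal_power[OF P] by blast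
    ultimately have "(\<Sum>es\<in>E'. f ^ (hd es - e) * r es) \<in> P"
      using P by (auto simp: primeideal_mpoly_ring_iff)
    then have 1: "(\<Sum>es\<in>E'. f ^ (hd es - e) * r es) \<in> Q" using \<open>P \<subseteq> Q\<close> by blast
    define E0 where "E0 = {es \<in> E'. hd es = e}"
    have "(\<Sum>es\<in>E' - E0. f ^ (hd es - e) * r es) \<in> Q"
    proof (rule ideal_mpoly_ring_sum[OF Q])
      fix es assume "es \<in> E' - E0"
      then have "hd es - e \<noteq> 0" using e_le[of es] by (auto simp: E0_def)
      then obtain n where "hd es - e = Suc n" using not0_implies_Suc by blast
      then have "f ^ (hd es - e) * r es = (f ^ n * r es) * f" by (simp add: mult_ac)
      then show "f ^ (hd es - e) * r es \<in> Q"
        using Q f(1) unfolding ideal_mpoly_ring_iff by simp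
    qed
    moreover have "(\<Sum>es\<in>E'. f ^ (hd es - e) * r es) =
        (\<Sum>es\<in>E' - E0. f ^ (hd es - e) * r es) + (\<Sum>es\<in>E0. f ^ (hd es - e) * r es)"
      using fin' by (intro sum.subset_diff) (auto simp: E0_def)
    ultimately have "(\<Sum>es\<in>E0. f ^ (hd es - e) * r es) \<in> Q"
      using ideal_mpoly_ring_diff[OF Q 1] by fastforce
    also have "(\<Sum>es\<in>E0. f ^ (hd es - e) * r es) =
        (\<Sum>es\<in>E0. Const (c (e # tl es)) * power_product fs (tl es))"
      using cons by (intro sum.cong) (auto simp: E0_def r_def)
    \<comment> \<open>All lists in \<open>E0\<close> have head \<open>e\<close>, so they are
      determined by their tails, and the sum becomes a relation among \<open>fs\<close>.\<close>
    also have "\<dots> = (\<Sum>t\<in>tl ` E0. Const (c (e # t)) * power_product fs t)"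
    proof (subst sum.reindex)
      show "inj_on tl E0"
        by (rule inj_onI) (metis (mono_tags, lifting) E0_def cons mem_Collect_eq)
    qed simp
    finally have 2: "(\<Sum>t\<in>tl ` E0. Const (c (e # t)) * power_product fs t) \<in> Q" .
    have "c (e # tl es0) = 0"
    proof (rule alg_indep_modD[OF fs _ _ 2])
      show "finite (tl ` E0)" using fin' by (simp add: E0_def)
      show "length t = length fs" if "t \<in> tl ` E0" for t
        using that len by (auto simp: E0_def E'_def)
      show "tl es0 \<in> tl ` E0" using es0 by (simp add: E0_def)
    qed
    then show False using cons[OF es0(1)] es0 by (simp add: E'_def)
  qed
qed

text \<open>Each strict inclusion supplies an element of \<open>Q (Suc i)\<close> outside
  \<open>Q i\<close>, to be put in front by \<open>alg_indep_mod_Cons\<close>.\<close>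

lemma alg_indep_mod_chain:
  fixes Q :: "nat \<Rightarrow> ('x, 'k::field) mpoly set"
  assumes "\<And>i. i \<le> m \<Longrightarrow> primeideal (Q i) mpoly_ring" "\<And>i. i < m \<Longrightarrow> Q i \<subset> Q (Suc i)"
    and "alg_indep_mod (Q m) ys"
  shows "\<exists>fs. length fs = m + length ys \<and> alg_indep_mod (Q 0) fs"
  using assms
proof (induction m arbitrary: Q)
  case 0
  then show ?case by auto
next
  case (Suc m)
  have "\<exists>fs. length fs = m + length ys \<and> alg_indep_mod (Q (Suc 0)) fs"
    using Suc.prems by (intro Suc.IH[of "\<lambda>i. Q (Suc i)"]) auto
  then obtain fs where fs: "length fs = m + length ys" "alg_indep_mod (Q (Suc 0)) fs" by blast
  have "Q 0 \<subset> Q (Suc 0)" using Suc.prems(2)[of 0] by simp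
  then obtain f where f: "f \<in> Q (Suc 0)" "f \<notin> Q 0" "Q 0 \<subseteq> Q (Suc 0)" by blast
  have "alg_indep_mod (Q 0) (f # fs)"
    using Suc.prems(1)[of 0] Suc.prems(1)[of "Suc 0"] f fs(2)
    by (intro alg_indep_mod_Cons[of "Q 0" "Q (Suc 0)"]) (auto simp: primeideal_mpoly_ring_iff)
  then show ?case using fs(1) by (intro exI[of _ "f # fs"]) simp
qed

text \<open>This trades relations modulo a face ideal for linear relations among honest polynomials,
  so that independence can be counted without forming the quotient.\<close>

lemma mrestrict_eq_0_iff:
  fixes f :: "('x, 'k::field) mpoly"
  shows "mrestrict {m. keys m \<in> \<Delta>} f = 0 \<longleftrightarrow> f \<in> face_ideal \<Delta>"
proof -
  have "mrestrict {m. keys m \<in> \<Delta>} f = 0 \<longleftrightarrow> keys (mrestrict {m. keys m \<in> \<Delta>} f) = {}"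
    by (simp only: keys_eq_empty)
  also have "\<dots> \<longleftrightarrow> f \<in> face_ideal \<Delta>"
    by (auto simp: face_ideal_def simp del: keys_eq_empty)
  finally show ?thesis .
qed

lemma mrestrict_Const_mult: "mrestrict M (Const c * f) = Const c * mrestrict M f"
  by (rule poly_mapping_eqI) (simp add: lookup_Const_mult when_def)

text \<open>Each exponent is bounded separately, not the total degree: the monomials over a set
  \<open>F\<close> then form a box with \<open>(T + 1) ^ card F\<close> elements.\<close>

definition exponents_le :: "('x, 'a::zero) mpoly \<Rightarrow> nat \<Rightarrow> bool" where
  "exponents_le f n \<longleftrightarrow> (\<forall>m\<in>keys f. \<forall>x. lookup m x \<le> n)"

lemma exponents_le_mult:
  fixes f g :: "('x, 'a::comm_ring_1) mpoly"
  assumes "exponents_le f a" "exponents_le g b"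
  shows "exponents_le (f * g) (a + b)"
  using assms keys_mult[of f g] by (fastforce simp: exponents_le_def lookup_add intro: add_mono)

lemma exponents_le_prod:
  fixes f :: "'i \<Rightarrow> ('x, 'a::comm_ring_1) mpoly"
  assumes "\<And>i. i \<in> I \<Longrightarrow> exponents_le (f i) n"
  shows "exponents_le (prod f I) (card I * n)"
  using assms
proof (induction I rule: infinite_finite_induct)
  case (insert i I)
  then show ?case using exponents_le_mult[of "f i" n "prod f I" "card I * n"] by simp
qed (simp_all add: exponents_le_def)

lemma exponents_le_mono: "exponents_le f a \<Longrightarrow> a \<le> b \<Longrightarrow> exponents_le f b"
  unfolding exponents_le_def by (meson le_trans)

lemma exponents_le_exists:
  fixes fs :: "('x::finite, 'a::zero) mpoly list"
  obtains C where "\<And>f. f \<in> set fs \<Longrightarrow> exponents_le f C"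
proof -
  let ?S = "\<Union>f\<in>set fs. \<Union>m\<in>keys f. range (lookup m)"
  have "exponents_le f (Max ?S)" if "f \<in> set fs" for f
    unfolding exponents_le_def using that by (intro ballI allI Max_ge) auto
  then show ?thesis using that by blast
qed

lemma card_exponents_le:
  fixes F :: "'x::finite set"
  shows "finite {m :: 'x \<Rightarrow>\<^sub>0 nat. keys m \<subseteq> F \<and> (\<forall>x. lookup m x \<le> T)}"
    and "card {m :: 'x \<Rightarrow>\<^sub>0 nat. keys m \<subseteq> F \<and> (\<forall>x. lookup m x \<le> T)} \<le> (T + 1) ^ card F"
proof -
  let ?M = "{m :: 'x \<Rightarrow>\<^sub>0 nat. keys m \<subseteq> F \<and> (\<forall>x. lookup m x \<le> T)}"
  let ?r = "\<lambda>m :: 'x \<Rightarrow>\<^sub>0 nat. restrict (lookup m) F"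
  have inj: "inj_on ?r ?M"
  proof (rule inj_onI, rule poly_mapping_eqI)
    fix m m' x assume m: "m \<in> ?M" "m' \<in> ?M" and eq: "?r m = ?r m'"
    show "lookup m x = lookup m' x"
    proof (cases "x \<in> F")
      case True
      then show ?thesis using fun_cong[OF eq, of x] by simp
    next
      case False
      then have "x \<notin> keys m" "x \<notin> keys m'" using m by blast+
      then show ?thesis by (simp add: in_keys_iff)
    qed
  qed
  have sub: "?r ` ?M \<subseteq> PiE F (\<lambda>_. {..T})" by auto
  have fin: "finite (PiE F (\<lambda>_. {..T}))" by (intro finite_PiE) auto
  show "finite ?M" using inj sub fin by (rule inj_on_finite)
  show "card ?M \<le> (T + 1) ^ card F"
    using card_inj_on_le[OF inj sub fin] by (simp add: card_PiE)
qed

text \<open>The \<open>(N + 1) ^ n\<close> power products with exponents at most \<open>N\<close>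
  stay linearly independent after restriction to the faces. Their monomials lie in at most
  \<open>card \<Delta>\<close> boxes of dimension at most \<open>d\<close> and side linear in
  \<open>N\<close>, so for large \<open>N\<close> the exponent \<open>n\<close> cannot exceed
  \<open>d\<close>.\<close>

lemma length_le_dim_if_alg_indep_mod:
  fixes fs :: "('x::finite, 'k::field) mpoly list"
  assumes indep: "alg_indep_mod (face_ideal \<Delta>) fs" and d: "\<And>F. F \<in> \<Delta> \<Longrightarrow> card F \<le> d"
  shows "length fs \<le> d"
proof -
  interpret V: vector_space "\<lambda>c (f :: ('x, 'k) mpoly). Const c * f"
    by unfold_locales (auto simp: distrib_left distrib_right Const_add Const_mult mult_ac)
  define n where "n = length fs"
  obtain C where C: "\<And>f. f \<in> set fs \<Longrightarrow> exponents_le f C" using exponents_le_exists by blast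
  \<comment> \<open>A product of \<open>n\<close> factors, each with exponents at most
    \<open>C\<close> and raised to a power at most \<open>N\<close>, has exponents at most
    \<open>n * C * N\<close>.\<close>
  define K where "K = n * C"
  define D where "D = {m :: 'x \<Rightarrow>\<^sub>0 nat. keys m \<in> \<Delta>}"
  have bound: "(N + 1) ^ n \<le> card \<Delta> * (K + 1) ^ d * (N + 1) ^ d" for N
  proof -
    define E where "E = {es :: nat list. set es \<subseteq> {..N} \<and> length es = n}"
    define b where "b es = mrestrict D (power_product fs es)" for es
    define M where "M = {m \<in> D. \<forall>x. lookup m x \<le> K * N}"
    have finE: "finite E" unfolding E_def by (rule finite_lists_length_eq) simp
    have cardE: "card E = (N + 1) ^ n" unfolding E_def by (simp add: card_lists_length_eq)
    have zero: "c es = 0" if "E' \<subseteq> E" "(\<Sum>es\<in>E'. Const (c es) * b es) = 0" "es \<in> E'" for E' c es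
    proof -
      have "(\<Sum>es\<in>E'. Const (c es) * b es) = mrestrict D (\<Sum>es\<in>E'. Const (c es) * power_product fs es)"
        by (simp add: b_def mrestrict_sum mrestrict_Const_mult)
      then have "(\<Sum>es\<in>E'. Const (c es) * power_product fs es) \<in> face_ideal \<Delta>"
        using that(2) by (simp flip: mrestrict_eq_0_iff add: D_def)
      then show ?thesis
        using alg_indep_modD[OF indep finite_subset[OF that(1) finE]] that by (auto simp: E_def n_def)
    qed
    have inj: "inj_on b E"
    proof (rule inj_onI, rule ccontr)
      fix es es' assume es: "es \<in> E" "es' \<in> E" "b es = b es'" "es \<noteq> es'"
      \<comment> \<open>Two equal restrictions would be a relation with coefficients 1 and -1.
        Injectivity is needed so that passing to the set of restrictions loses no power
        product.\<close>
      have "(\<Sum>t\<in>{es, es'}. Const (if t = es then 1 else - 1) * b t) = 0"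
        using es by (simp add: Const_def single_uminus)
      from zero[OF _ this, of es] es show False by auto
    qed
    have indep_b: "V.independent (b ` E)"
    proof
      assume "V.dependent (b ` E)"
      then obtain u where u: "\<exists>v\<in>b ` E. u v \<noteq> 0" "(\<Sum>v\<in>b ` E. Const (u v) * v) = 0"
        using V.dependent_finite[of "b ` E"] finE by auto
      then have "(\<Sum>es\<in>E. Const (u (b es)) * b es) = 0"
        using inj by (simp add: sum.reindex)
      from zero[OF subset_refl this] u(1) show False by auto
    qed
    have span_b: "b ` E \<subseteq> V.span ((\<lambda>m. monomial m 1) ` M)"
    proof
      fix f assume "f \<in> b ` E"
      then obtain es where es: "es \<in> E" "f = b es" by (elim imageE)
      have "exponents_le (fs ! i ^ es ! i) (C * N)" if "i < n" for i
      proof -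
        have "exponents_le (\<Prod>_<es ! i. fs ! i) (card {..<es ! i} * C)"
          using C[of "fs ! i"] that by (intro exponents_le_prod) (simp add: n_def)
        then have 1: "exponents_le (fs ! i ^ es ! i) (es ! i * C)" by simp
        have "es ! i \<le> N" using es(1) that nth_mem[of i es] by (simp add: E_def subset_iff)
        then have "es ! i * C \<le> C * N" by (simp add: mult.commute)
        with 1 show ?thesis by (rule exponents_le_mono)
      qed
      then have "exponents_le (power_product fs es) (card {..<length fs} * (C * N))"
        unfolding power_product_def by (intro exponents_le_prod) (simp add: n_def)
      then have "exponents_le (power_product fs es) (K * N)"
        by (simp add: K_def n_def mult.assoc)
      then have keys: "keys f \<subseteq> M"
        unfolding es(2) b_def M_def keys_mrestrict exponents_le_def by blast
      have "(\<Sum>m\<in>keys f. Const (lookup f m) * monomial m 1) \<in> V.span ((\<lambda>m. monomial m 1) ` M)"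
        using keys by (intro V.span_sum V.span_scale V.span_base) auto
      moreover have "(\<Sum>m\<in>keys f. Const (lookup f m) * monomial m 1) = f"
        by (simp add: Const_def mult_single flip: sum_monomials)
      ultimately show "f \<in> V.span ((\<lambda>m. monomial m 1) ` M)" by simp
    qed
    let ?B = "\<lambda>F. {m :: 'x \<Rightarrow>\<^sub>0 nat. keys m \<subseteq> F \<and> (\<forall>x. lookup m x \<le> K * N)}"
    have M: "M \<subseteq> (\<Union>F\<in>\<Delta>. ?B F)" by (auto simp: M_def D_def)
    have finU: "finite (\<Union>F\<in>\<Delta>. ?B F)" using card_exponents_le(1) by auto
    have finM: "finite M" by (rule finite_subset[OF M finU])
    have "card (b ` E) \<le> card ((\<lambda>m. monomial m (1::'k)) ` M)"
      using V.independent_span_bound[OF finite_imageI[OF finM] indep_b span_b] by blast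
    also have "\<dots> \<le> card M" using finM by (rule card_image_le)
    also have "\<dots> \<le> card (\<Union>F\<in>\<Delta>. ?B F)" by (rule card_mono[OF finU M])
    also have "\<dots> \<le> (\<Sum>F\<in>\<Delta>. card (?B F))" by (rule card_UN_le) simp
    also have "\<dots> \<le> (\<Sum>F\<in>\<Delta>. (K * N + 1) ^ d)"
    proof (rule sum_mono)
      fix F assume "F \<in> \<Delta>"
      have "card (?B F) \<le> (K * N + 1) ^ card F" by (rule card_exponents_le)
      also have "\<dots> \<le> (K * N + 1) ^ d" using d[OF \<open>F \<in> \<Delta>\<close>] by (intro power_increasing) auto
      finally show "card (?B F) \<le> (K * N + 1) ^ d" .
    qed
    also have "\<dots> = card \<Delta> * (K * N + 1) ^ d" by simp
    \<comment> \<open>The weaker bound separates \<open>K\<close> from \<open>N\<close>, so that a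
      power of \<open>N + 1\<close> can be cancelled later.\<close>
    also have "\<dots> \<le> card \<Delta> * ((K + 1) * (N + 1)) ^ d"
      by (intro mult_le_mono2 power_mono) auto
    finally show ?thesis by (simp only: cardE card_image[OF inj] power_mult_distrib mult.assoc)
  qed
  have "n \<le> d"
  proof (rule ccontr)
    assume "\<not> n \<le> d"
    then obtain e where n: "n = Suc e + d" by (metis add.commute add_Suc less_imp_Suc_add not_le)
    \<comment> \<open>Taking \<open>N\<close> to be the constant factor itself already contradicts
      the bound: a positive power of \<open>N + 1\<close> would be at most \<open>N\<close>.\<close>
    let ?N = "card \<Delta> * (K + 1) ^ d"
    have "(?N + 1) ^ d * (?N + 1) ^ Suc e \<le> (?N + 1) ^ d * ?N"
      using bound[of ?N] unfolding n power_add by (simp only: mult_ac)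
    then have "(?N + 1) ^ Suc e \<le> ?N" by (simp only: mult_le_cancel1) simp
    moreover have "?N + 1 \<le> (?N + 1) ^ Suc e" by (rule self_le_power) auto
    ultimately show False by linarith
  qed
  then show ?thesis by (simp add: n_def)
qed

text \<open>The common upper bound for heights and for dimensions: \<open>ys\<close> consists of the
  variables outside the top prime in the first case, and of one variable per degree in the
  second.\<close>

lemma prime_chain_length_le:
  fixes Q :: "nat \<Rightarrow> ('x::finite, 'k::field) mpoly set"
  assumes "\<And>i. i \<le> m \<Longrightarrow> primeideal (Q i) mpoly_ring" "\<And>i. i < m \<Longrightarrow> Q i \<subset> Q (Suc i)"
    and "alg_indep_mod (Q m) ys" and "face_ideal \<Delta> \<subseteq> Q 0" and "\<And>F. F \<in> \<Delta> \<Longrightarrow> card F \<le> d"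
  shows "m + length ys \<le> d"
proof -
  obtain fs where fs: "length fs = m + length ys" "alg_indep_mod (Q 0) fs"
    using alg_indep_mod_chain[OF assms(1-3)] by blast
  have "alg_indep_mod (face_ideal \<Delta>) fs"
    by (rule alg_indep_mod_antimono[OF fs(2) assms(4)])
  from length_le_dim_if_alg_indep_mod[OF this assms(5)] show ?thesis by (simp add: fs(1))
qed

section \<open>Codimension of face ideals\<close>

lemma mrestrict_face_ideal: "f \<in> face_ideal \<Delta> \<Longrightarrow> mrestrict M f \<in> face_ideal \<Delta>"
  by (simp add: face_ideal_def)

section \<open>Multidegrees and monomials\<close>

lemma multidegree_add: "multidegree g (m + m') i = multidegree g m i + multidegree g m' i"
  by (simp add: multidegree_def lookup_add sum.distrib)

lemma multidegree_sum: "multidegree g (sum f I) i = (\<Sum>j\<in>I. multidegree g (f j) i)"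
  by (simp add: multidegree_def lookup_sum) (rule sum.swap)

lemma multidegree_monomial: "multidegree g (monomial x n) i = (if g x = i then n else 0)"
proof -
  have "multidegree g (monomial x n) i = (\<Sum>y\<in>{y. g y = i}. if y = x then n else 0)"
    unfolding multidegree_def by (intro sum.cong) (auto simp: lookup_single when_def)
  then show ?thesis by simp
qed

lemma lookup_le_multidegree: "lookup m x \<le> multidegree g m (g x)"
  unfolding multidegree_def by (rule member_le_sum) auto

lemma Var_power: "Var x ^ n = (monomial (monomial x n) 1 :: ('x, 'a::comm_ring_1) mpoly)"
proof (induction n)
  case (Suc n)
  then show ?case by (simp add: Var_def mult_single flip: single_add)
qed simp

lemma prod_monomial: "(\<Prod>i\<in>I. monomial (\<mu> i) (1::'a::comm_ring_1)) = monomial (\<Sum>i\<in>I. \<mu> i) 1"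
  by (induction I rule: infinite_finite_induct) (auto simp: mult_single)

lemma monomial_mem_prime:
  fixes P :: "('x::finite, 'k::field) mpoly set"
  assumes P: "primeideal P mpoly_ring" and "c \<noteq> 0" "monomial m c \<in> P"
  obtains x where "x \<in> keys m" "Var x \<in> P"
proof -
  have m: "m = (\<Sum>x\<in>keys m. monomial x (lookup m x))" by (rule sum_monomials)
  have ideal: "ideal P mpoly_ring" and prime: "\<And>a b. a * b \<in> P \<Longrightarrow> a \<in> P \<or> b \<in> P"
    using P by (auto simp: primeideal_mpoly_ring_iff)
  have "monomial m 1 = Const (1 / c) * monomial m c" using \<open>c \<noteq> 0\<close> by (simp add: Const_def mult_single)
  also have "\<dots> \<in> P" using ideal assms(3) by (simp add: ideal_mpoly_ring_iff)
  finally have 1: "(\<Prod>x\<in>keys m. Var x ^ lookup m x) \<in> P"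
    using m by (simp add: Var_power prod_monomial)
  have "\<exists>x\<in>A. Var x \<in> P" if "finite A" "(\<Prod>x\<in>A. Var x ^ lookup m x) \<in> P" for A
    using that
  proof (induction A rule: finite_induct)
    case empty
    then show ?case using P ideal_mpoly_ring_eq_UNIV[OF ideal] by (auto simp: primeideal_mpoly_ring_iff)
  next
    case (insert x A)
    then show ?case using prime[of "Var x ^ lookup m x"] primeideal_power[OF P, of "Var x"] by auto
  qed
  from this[OF finite_keys 1] that show ?thesis by blast
qed

text \<open>Variables of distinct degrees outside a homogeneous prime are independent modulo it:
  their monomials have distinct degrees, so a relation splits into its terms.\<close>

lemma alg_indep_mod_vars:
  fixes P :: "('x::finite, 'k::field) mpoly set" and g :: "'x \<Rightarrow> 'p"
  assumes P: "primeideal P mpoly_ring"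
    and hom: "\<And>f v. f \<in> P \<Longrightarrow> mrestrict {m. multidegree g m = v} f \<in> P"
    and ys: "distinct (map g ys)" "\<And>y. y \<in> set ys \<Longrightarrow> Var y \<notin> P"
  shows "alg_indep_mod P (map Var ys)"
  unfolding alg_indep_mod_def
proof (intro allI impI ballI)
  fix E and c :: "nat list \<Rightarrow> 'k" and es0
  assume "finite E \<and> (\<forall>es\<in>E. length es = length (map Var ys :: ('x, 'k) mpoly list)) \<and>
    (\<Sum>es\<in>E. Const (c es) * power_product (map Var ys) es) \<in> P" and es0: "es0 \<in> E"
  then have fin: "finite E" and len: "\<And>es. es \<in> E \<Longrightarrow> length es = length ys"
    and sum: "(\<Sum>es\<in>E. Const (c es) * power_product (map Var ys) es) \<in> P" by auto
  define \<mu> :: "nat list \<Rightarrow> 'x \<Rightarrow>\<^sub>0 nat" where "\<mu> es = (\<Sum>i<length ys. monomial (ys ! i) (es ! i))" for es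
  have \<mu>: "Const a * power_product (map Var ys) es = monomial (\<mu> es) a" for a :: 'k and es
    by (simp add: power_product_def Var_power prod_monomial Const_def mult_single \<mu>_def)
  \<comment> \<open>No two entries of \<open>ys\<close> share a degree, so the multidegree returns
    each exponent.\<close>
  have deg: "multidegree g (\<mu> es) (g (ys ! i)) = es ! i" if "i < length ys" for es i
  proof -
    have "multidegree g (\<mu> es) (g (ys ! i)) = (\<Sum>j<length ys. if j = i then es ! i else 0)"
      unfolding \<mu>_def multidegree_sum multidegree_monomial
      using ys(1) that nth_eq_iff_index_eq[OF ys(1)] by (intro sum.cong) auto
    then show ?thesis using that by simp
  qed
  have eq: "es = es0" if "es \<in> E" "multidegree g (\<mu> es) = multidegree g (\<mu> es0)" for es
    using deg[of _ es] deg[of _ es0] len[OF that(1)] len[OF es0] that(2) by (intro nth_equalityI) auto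
  let ?v = "multidegree g (\<mu> es0)"
  have "mrestrict {m. multidegree g m = ?v} (\<Sum>es\<in>E. monomial (\<mu> es) (c es)) \<in> P"
    using hom sum by (simp add: \<mu>)
  also have "mrestrict {m. multidegree g m = ?v} (\<Sum>es\<in>E. monomial (\<mu> es) (c es)) =
      (\<Sum>es\<in>E. if es = es0 then monomial (\<mu> es0) (c es0) else 0)"
    unfolding mrestrict_sum
    using eq by (intro sum.cong refl poly_mapping_eqI) (auto simp: lookup_single when_def)
  also have "\<dots> = monomial (\<mu> es0) (c es0)" using fin es0 by simp
  finally have "monomial (\<mu> es0) (c es0) \<in> P" .
  moreover have "x \<in> set ys" if "x \<in> keys (\<mu> es0)" for x
    using that keys_sum[of "\<lambda>i. monomial (ys ! i) (es0 ! i)" "{..<length ys}"]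
    by (auto simp: \<mu>_def split: if_splits)
  ultimately show "c es0 = 0"
    using monomial_mem_prime[OF P] ys(2) by metis
qed

text \<open>Smaller sets of variables have larger ideals, so these sets give ascending chains of
  primes.\<close>

lemma descending_chain:
  fixes G H :: "'x::finite set"
  assumes "G \<subseteq> H"
  obtains T where "T 0 = H" "T (card H - card G) = G" "\<And>i. G \<subseteq> T i" "\<And>i. T i \<subseteq> H"
    "\<And>i. i < card H - card G \<Longrightarrow> T (Suc i) \<subset> T i"
proof -
  obtain xs where xs: "set xs = H - G" "distinct xs" using finite_distinct_list[of "H - G"] by auto
  have len: "length xs = card H - card G"
    using xs distinct_card[OF xs(2)] card_Diff_subset[of G H] assms by simp
  let ?T = "\<lambda>i. G \<union> set (drop i xs)"
  have "?T (Suc i) \<subset> ?T i" if "i < length xs" for i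
  proof -
    have drop: "drop i xs = xs ! i # drop (Suc i) xs" using that by (simp add: Cons_nth_drop_Suc)
    moreover have "xs ! i \<notin> set (drop (Suc i) xs)"
      using distinct_drop[OF xs(2), of i] drop by simp
    moreover have "xs ! i \<notin> G" using nth_mem[OF that] xs(1) by auto
    ultimately show ?thesis by auto
  qed
  then show ?thesis
    using xs(1) assms by (intro that[of ?T]) (auto simp flip: len dest: in_set_dropD)
qed

text \<open>The variables of \<open>F\<close> are independent modulo the ideal, so a chain of length
  \<open>m\<close> ending there satisfies \<open>m + card F \<le> card UNIV\<close>.\<close>

lemma height_var_ideal_le: "height mpoly_ring (var_ideal F :: ('x::finite, 'k::field) mpoly set) \<le> enat (card (- F))"
  unfolding height_def
proof (rule SUP_least, elim CollectE exE conjE)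
  fix m and Q :: "nat \<Rightarrow> ('x, 'k) mpoly set"
  assume Q: "Q m = var_ideal F" "\<forall>i\<le>m. primeideal (Q i) mpoly_ring" "\<forall>i<m. Q i \<subset> Q (Suc i)"
  obtain ys where ys: "set ys = F" "distinct ys" using finite_distinct_list[of F] by auto
  \<comment> \<open>The grading by \<open>id\<close> gives every variable its own degree, so that
    all variables of \<open>F\<close> qualify at once.\<close>
  have "alg_indep_mod (Q m) (map Var ys)"
    unfolding Q(1) using ys
    by (intro alg_indep_mod_vars[where g = id] primeideal_var_ideal mrestrict_face_ideal) auto
  \<comment> \<open>With every set a face, the face ideal is zero.\<close>
  moreover have "face_ideal UNIV \<subseteq> Q 0"
    using Q(2) keys_eq_empty by (auto simp: face_ideal_def primeideal_mpoly_ring_iff ideal_mpoly_ring_iff)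
  ultimately have "m + length (map Var ys :: ('x, 'k) mpoly list) \<le> card (UNIV :: 'x set)"
    using Q(2,3) by (intro prime_chain_length_le[where Q = Q and \<Delta> = UNIV]) (auto simp: card_mono)
  moreover have "length ys = card F" using ys distinct_card by fastforce
  moreover have "card (- F) = card (UNIV :: 'x set) - card F" by (simp add: card_Diff_subset Compl_eq_Diff_UNIV)
  ultimately show "enat m \<le> enat (card (- F))" by simp
qed

text \<open>Variables outside \<open>F\<close> are added to the zero ideal one at a time. Only the
  last member of the chain is replaced by \<open>P\<close>, so the chain ends at \<open>P\<close>
  even when \<open>P\<close> is larger than the ideal of variables.\<close>

lemma height_ge_if_var_ideal_subset:
  fixes P :: "('x::finite, 'k::field) mpoly set"
  assumes P: "primeideal P mpoly_ring" and sub: "var_ideal F \<subseteq> P"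
  shows "enat (card (- F)) \<le> height mpoly_ring P"
proof -
  obtain T where T: "T 0 = UNIV" "T (card (UNIV :: 'x set) - card F) = F" "\<And>i. F \<subseteq> T i" "\<And>i. T i \<subseteq> UNIV"
    "\<And>i. i < card (UNIV :: 'x set) - card F \<Longrightarrow> T (Suc i) \<subset> T i"
    using descending_chain[of F UNIV] by auto
  let ?n = "card (UNIV :: 'x set) - card F"
  let ?Q = "\<lambda>i. if i = ?n then P else var_ideal (T i)"
  have "?Q i \<subset> ?Q (Suc i)" if "i < ?n" for i
  proof -
    have "var_ideal (T i) \<subset> (var_ideal (T (Suc i)) :: ('x, 'k) mpoly set)"
      using T(5)[OF that] by (auto simp: psubset_eq var_ideal_subset_iff dest: equalityD2)
    also have "\<dots> \<subseteq> ?Q (Suc i)" using T(2) sub by auto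
    finally show ?thesis using that by simp
  qed
  moreover have "primeideal (?Q i) mpoly_ring" for i using P primeideal_var_ideal by auto
  ultimately have n: "?n \<in> {m. \<exists>Q. Q m = P \<and> (\<forall>i\<le>m. primeideal (Q i) mpoly_ring) \<and> (\<forall>i<m. Q i \<subset> Q (Suc i))}"
    by (intro CollectI exI[of _ ?Q]) auto
  have "card (- F) = ?n" by (simp add: card_Diff_subset Compl_eq_Diff_UNIV)
  then show ?thesis unfolding height_def by (intro SUP_upper2[OF n]) simp
qed

text \<open>Otherwise the product of all variables outside \<open>P\<close> would lie in the face
  ideal and hence in \<open>P\<close>, and \<open>P\<close> would contain one of them.\<close>

lemma face_of_prime:
  fixes P :: "('x::finite, 'k::field) mpoly set"
  assumes P: "primeideal P mpoly_ring" and sub: "face_ideal \<Delta> \<subseteq> P"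
  shows "{x. Var x \<notin> P} \<in> \<Delta>"
proof (rule ccontr)
  let ?F = "{x. Var x \<notin> P}"
  assume "?F \<notin> \<Delta>"
  then have "(\<Prod>x\<in>?F. Var x) \<in> face_ideal \<Delta>" by simp
  then have "monomial (squarefree_exponent ?F) 1 \<in> P" using sub by (auto simp: prod_Var)
  from monomial_mem_prime[OF P _ this] show False by auto
qed

text \<open>The prime of a largest face gives the upper bound. Any prime over the face ideal
  contains the prime of a face, which has at most \<open>card F\<close> elements, and this bounds
  its height from below.\<close>

lemma codim_face_ideal:
  assumes \<Delta>: "simplicial_complex \<Delta>" "F \<in> \<Delta>" "\<And>G. G \<in> \<Delta> \<Longrightarrow> card G \<le> card F"
  shows "codim mpoly_ring (face_ideal \<Delta> :: ('x::finite, 'k::field) mpoly set) = enat (card (- F))"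
proof (rule antisym)
  have "face_ideal \<Delta> \<subseteq> (var_ideal F :: ('x, 'k) mpoly set)"
    using face_ideal_subset_var_ideal_iff \<Delta> by blast
  then have "codim mpoly_ring (face_ideal \<Delta> :: ('x, 'k) mpoly set) \<le> height mpoly_ring (var_ideal F :: ('x, 'k) mpoly set)"
    unfolding codim_def by (intro INF_lower) (auto simp: primeideal_var_ideal)
  also have "\<dots> \<le> enat (card (- F))" by (rule height_var_ideal_le)
  finally show "codim mpoly_ring (face_ideal \<Delta> :: ('x, 'k) mpoly set) \<le> enat (card (- F))" .
  show "enat (card (- F)) \<le> codim mpoly_ring (face_ideal \<Delta> :: ('x, 'k) mpoly set)"
    unfolding codim_def
  proof (rule INF_greatest, elim CollectE conjE)
    fix P :: "('x, 'k) mpoly set" assume P: "primeideal P mpoly_ring" and sub: "face_ideal \<Delta> \<subseteq> P"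
    let ?G = "{x. Var x \<notin> P}"
    have "var_ideal ?G \<subseteq> P" using P by (intro var_ideal_subset) (auto simp: primeideal_mpoly_ring_iff)
    from height_ge_if_var_ideal_subset[OF P this]
    have "enat (card (- ?G)) \<le> height mpoly_ring P" .
    moreover have "card ?G \<le> card F" by (rule \<Delta>(3)[OF face_of_prime[OF P sub]])
    then have "card (- F) \<le> card (- ?G)" by (simp add: card_Diff_subset Compl_eq_Diff_UNIV[of F] Compl_eq_Diff_UNIV[of ?G])
    ultimately show "enat (card (- F)) \<le> height mpoly_ring P" by (meson enat_ord_simps(1) order_trans)
  qed
qed

lemma codim_var_ideal:
  "codim mpoly_ring (var_ideal F :: ('x::finite, 'k::field) mpoly set) = enat (card (- F))"
  by (rule codim_face_ideal) (auto intro: card_mono)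

section \<open>Hilbert functions of face ideals\<close>

lemma coset_eq_iff:
  fixes J :: "('x, 'a::comm_ring_1) mpoly set"
  assumes "ideal J mpoly_ring"
  shows "J +>\<^bsub>mpoly_ring\<^esub> f = J +>\<^bsub>mpoly_ring\<^esub> f' \<longleftrightarrow> f - f' \<in> J"
proof
  assume "J +>\<^bsub>mpoly_ring\<^esub> f = J +>\<^bsub>mpoly_ring\<^esub> f'"
  moreover have "f \<in> J +>\<^bsub>mpoly_ring\<^esub> f"
    using assms by (auto simp: a_r_coset_def' ideal_mpoly_ring_iff intro: bexI[of _ 0])
  ultimately show "f - f' \<in> J" by (auto simp: a_r_coset_def')
next
  assume *: "f - f' \<in> J"
  have "h + f \<in> J +>\<^bsub>mpoly_ring\<^esub> f'" if "h \<in> J" "f - f' \<in> J" for h f f'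
  proof -
    have "h + (f - f') \<in> J" using that assms by (simp add: ideal_mpoly_ring_iff)
    moreover have "h + f = (h + (f - f')) + f'" by simp
    ultimately show ?thesis by (auto simp: a_r_coset_def' intro!: bexI[of _ "h + (f - f')"])
  qed
  moreover have "f' - f \<in> J" using ideal_mpoly_ring_diff[OF assms _ *, of 0] assms by (simp add: ideal_mpoly_ring_iff)
  ultimately show "J +>\<^bsub>mpoly_ring\<^esub> f = J +>\<^bsub>mpoly_ring\<^esub> f'" using * by (fastforce simp: a_r_coset_def')
qed

lemma Quot_mpoly_ring_simps:
  fixes J :: "('x, 'a::comm_ring_1) mpoly set"
  assumes "ideal J mpoly_ring"
  shows "carrier (mpoly_ring Quot J) = range (\<lambda>f. J +>\<^bsub>mpoly_ring\<^esub> f)"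
    and "(J +>\<^bsub>mpoly_ring\<^esub> f) \<otimes>\<^bsub>mpoly_ring Quot J\<^esub> (J +>\<^bsub>mpoly_ring\<^esub> f') = J +>\<^bsub>mpoly_ring\<^esub> (f * f')"
    and "(J +>\<^bsub>mpoly_ring\<^esub> f) \<oplus>\<^bsub>mpoly_ring Quot J\<^esub> (J +>\<^bsub>mpoly_ring\<^esub> f') = J +>\<^bsub>mpoly_ring\<^esub> (f + f')"
    and "\<zero>\<^bsub>mpoly_ring Quot J\<^esub> = J +>\<^bsub>mpoly_ring\<^esub> 0" and "\<one>\<^bsub>mpoly_ring Quot J\<^esub> = J +>\<^bsub>mpoly_ring\<^esub> 1"
proof -
  interpret ideal J "mpoly_ring :: ('x, 'a) mpoly ring" by (rule assms)
  show "carrier (mpoly_ring Quot J) = range (\<lambda>f. J +>\<^bsub>mpoly_ring\<^esub> f)"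
    by (auto simp: FactRing_def A_RCOSETS_def')
  show "(J +>\<^bsub>mpoly_ring\<^esub> f) \<otimes>\<^bsub>mpoly_ring Quot J\<^esub> (J +>\<^bsub>mpoly_ring\<^esub> f') = J +>\<^bsub>mpoly_ring\<^esub> (f * f')"
    using ring_hom_mult[OF rcos_ring_hom, of f f'] by simp
  show "(J +>\<^bsub>mpoly_ring\<^esub> f) \<oplus>\<^bsub>mpoly_ring Quot J\<^esub> (J +>\<^bsub>mpoly_ring\<^esub> f') = J +>\<^bsub>mpoly_ring\<^esub> (f + f')"
    using ring_hom_add[OF rcos_ring_hom, of f f'] by simp
  show "\<zero>\<^bsub>mpoly_ring Quot J\<^esub> = J +>\<^bsub>mpoly_ring\<^esub> 0"
    by (auto simp: FactRing_def a_r_coset_def')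
  show "\<one>\<^bsub>mpoly_ring Quot J\<^esub> = J +>\<^bsub>mpoly_ring\<^esub> 1"
    by (simp add: FactRing_def)
qed

lemma subfield_range_Const: "subfield (range Const) (mpoly_ring :: ('x, 'k::field) mpoly ring)"
proof -
  interpret cring "mpoly_ring :: ('x, 'k) mpoly ring" by (rule cring_mpoly_ring)
  let ?K = "range (Const :: 'k \<Rightarrow> ('x, 'k) mpoly)"
  have Const_1': "1 = (Const 1 :: ('x, 'k) mpoly)" by simp
  have inj: "Const c = (0 :: ('x, 'k) mpoly) \<longleftrightarrow> c = 0" for c :: 'k
    by (metis Const_def lookup_single_eq lookup_zero single_zero)
  show ?thesis
  proof (rule subfieldI)
    have "- Const c = (Const (- c) :: ('x, 'k) mpoly)" for c :: 'k by (simp add: Const_def single_uminus)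
    then have "subring ?K mpoly_ring"
      by (intro subringI) (auto simp flip: Const_add Const_mult simp: image_iff intro: exI[of _ 1])
    then show "subcring ?K mpoly_ring" by (rule subcringI')
    have "Const c * Const (1 / c) = (1 :: ('x, 'k) mpoly)" if "c \<noteq> 0" for c :: 'k
      using that by (simp flip: Const_mult)
    then have "Const c \<in> Units (mpoly_ring\<lparr>carrier := ?K\<rparr>)" if "c \<noteq> 0" for c
      using that by (auto simp: Units_def mult.commute intro!: exI[of _ "1 / c"])
    moreover have "0 \<notin> Units ((mpoly_ring :: ('x, 'k) mpoly ring)\<lparr>carrier := ?K\<rparr>)"
      by (auto simp: Units_def)
    moreover have "Units (mpoly_ring\<lparr>carrier := ?K\<rparr>) \<subseteq> ?K" by (auto simp: Units_def)
    ultimately show "Units (mpoly_ring\<lparr>carrier := ?K\<rparr>) = ?K - {\<zero>\<^bsub>mpoly_ring\<^esub>}"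
      using inj by auto
  qed
qed

text \<open>The classes of the monomials supported on faces are a basis of the quotient. Since
  \<open>dimension\<close> is defined inductively by line extensions, the basis of one graded piece
  is adjoined monomial by monomial.\<close>

lemma hilbert_function_face_ideal:
  fixes g :: "'x::finite \<Rightarrow> 'p"
  assumes \<Delta>: "simplicial_complex \<Delta>" "{} \<in> \<Delta>"
  shows "hilbert_function g (face_ideal \<Delta> :: ('x, 'k::field) mpoly set) v =
    card {m. keys m \<in> \<Delta> \<and> multidegree g m = v}"
proof -
  let ?J = "face_ideal \<Delta> :: ('x, 'k) mpoly set" and ?R = "mpoly_ring :: ('x, 'k) mpoly ring"
  let ?\<pi> = "\<lambda>f. ?J +>\<^bsub>?R\<^esub> f"
  let ?Q = "?R Quot ?J"
  have J: "ideal ?J ?R" by (rule ideal_face_ideal[OF \<Delta>(1)])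
  interpret hom: ring_hom_ring ?R ?Q ?\<pi>
    using ideal.rcos_ring_hom_ring[OF J] .
  note simps = Quot_mpoly_ring_simps[OF J]
  have "\<one>\<^bsub>?Q\<^esub> \<noteq> \<zero>\<^bsub>?Q\<^esub>"
    using \<Delta>(2) coset_eq_iff[OF J, of 1 0] by (simp add: simps one_in_face_ideal)
  then have K: "subfield (quot_scalars ?J) ?Q"
    using hom.img_is_subfield(2)[OF subfield_range_Const] by (simp add: quot_scalars_def image_image)
  define E where "E M = ?\<pi> ` {f. keys f \<subseteq> M}" for M
  have dim: "hom.S.dimension (card M) (quot_scalars ?J) (E M)"
    if "finite M" "\<And>m. m \<in> M \<Longrightarrow> keys m \<in> \<Delta>" for M
    using that
  proof (induction M rule: finite_induct)
    case empty
    have "E {} = {\<zero>\<^bsub>?Q\<^esub>}" by (simp add: E_def simps)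
    then show ?case by simp
  next
    case (insert m M)
    have "?\<pi> (monomial m 1) \<notin> E M"
    proof
      assume "?\<pi> (monomial m 1) \<in> E M"
      then obtain f where f: "keys f \<subseteq> M" "monomial m 1 - f \<in> ?J"
        using coset_eq_iff[OF J] by (auto simp: E_def)
      have "lookup (monomial m 1 - f) m = 1"
        using f(1) insert.hyps by (auto simp: lookup_minus in_keys_iff)
      then have "m \<in> keys (monomial m 1 - f)" by (simp add: in_keys_iff)
      then show False using f(2) insert.prems[of m] by (auto simp: face_ideal_def)
    qed
    then have "hom.S.dimension (Suc (card M)) (quot_scalars ?J)
        (hom.S.line_extension (quot_scalars ?J) (?\<pi> (monomial m 1)) (E M))"
      using insert by (intro hom.S.dimension.Suc_dim) (auto simp: simps)
    moreover have "hom.S.line_extension (quot_scalars ?J) (?\<pi> (monomial m 1)) (E M) = E (insert m M)"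
    proof (rule subset_antisym; rule subsetI)
      fix u assume "u \<in> hom.S.line_extension (quot_scalars ?J) (?\<pi> (monomial m 1)) (E M)"
      then obtain c f where f: "keys f \<subseteq> M" and u: "u = ?\<pi> (Const c * monomial m 1 + f)"
        unfolding hom.S.line_extension_mem_iff by (auto simp: quot_scalars_def E_def simps)
      have "keys (Const c * monomial m 1 + f) \<subseteq> insert m M"
        using f by (auto simp: in_keys_iff lookup_add lookup_Const_mult lookup_single when_def split: if_splits)
      then show "u \<in> E (insert m M)" unfolding E_def u by blast
    next
      fix u assume "u \<in> E (insert m M)"
      then obtain f where f: "keys f \<subseteq> insert m M" and u: "u = ?\<pi> f" by (auto simp: E_def)
      let ?f = "mrestrict (- {m}) f"
      have "f = Const (lookup f m) * monomial m 1 + ?f"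
        by (rule poly_mapping_eqI) (simp add: lookup_add lookup_Const_mult lookup_single when_def)
      then have "u = ?\<pi> (Const (lookup f m) * monomial m 1 + ?f)" using u by simp
      then have "u = (?\<pi> (Const (lookup f m)) \<otimes>\<^bsub>?Q\<^esub> ?\<pi> (monomial m 1)) \<oplus>\<^bsub>?Q\<^esub> ?\<pi> ?f"
        by (simp only: simps)
      moreover have "?\<pi> ?f \<in> E M" unfolding E_def by (rule imageI) (use f in auto)
      ultimately show "u \<in> hom.S.line_extension (quot_scalars ?J) (?\<pi> (monomial m 1)) (E M)"
        unfolding hom.S.line_extension_mem_iff quot_scalars_def by blast
    qed
    ultimately show ?case using insert.hyps by simp
  qed
  let ?M = "{m. keys m \<in> \<Delta> \<and> multidegree g m = v}"
  have "lookup m x \<le> Max (range (\<lambda>x. v (g x)))" if "multidegree g m = v" for m x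
  proof -
    have "lookup m x \<le> multidegree g m (g x)" by (rule lookup_le_multidegree)
    also have "\<dots> \<le> Max (range (\<lambda>x. v (g x)))" using that by (intro Max_ge) auto
    finally show ?thesis .
  qed
  then have "?M \<subseteq> {m. keys m \<subseteq> UNIV \<and> (\<forall>x. lookup m x \<le> Max (range (\<lambda>x. v (g x))))}" by auto
  from finite_subset[OF this card_exponents_le(1)] have fin: "finite ?M" .
  have "E ?M = quot_piece g ?J v"
  proof
    show "E ?M \<subseteq> quot_piece g ?J v"
      unfolding E_def quot_piece_def graded_piece_def by (intro image_mono) auto
    show "quot_piece g ?J v \<subseteq> E ?M"
    proof
      fix u assume "u \<in> quot_piece g ?J v"
      then obtain f where f: "\<forall>m\<in>keys f. multidegree g m = v" "u = ?\<pi> f"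
        by (auto simp: quot_piece_def graded_piece_def)
      let ?f = "mrestrict {m. keys m \<in> \<Delta>} f"
      have "f - ?f \<in> ?J"
        by (auto simp: face_ideal_def in_keys_iff lookup_minus when_def)
      then have "u = ?\<pi> ?f" using coset_eq_iff[OF J] f(2) by blast
      moreover have "keys ?f \<subseteq> ?M" using f(1) by auto
      ultimately show "u \<in> E ?M" unfolding E_def by blast
    qed
  qed
  then have "hom.S.dimension (card ?M) (quot_scalars ?J) (quot_piece g ?J v)" using dim[OF fin] by simp
  then show ?thesis
    unfolding hilbert_function_def hom.S.dim_def
    by (intro the_equality) (auto intro: hom.S.dimension_is_inj[OF K])
qed

text \<open>The summand counts the monomials of degree \<open>t - a\<close> in \<open>n\<close>
  variables. With truncated subtraction this is also right for \<open>n = 0\<close>, where only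
  \<open>a = t\<close> contributes.\<close>

lemma sum_choose_hockey_stick: "(\<Sum>a\<le>t. (t - a + n - 1) choose (t - a)) = (t + n) choose t" for n t :: nat
proof -
  have "(\<Sum>a\<le>t. (t - a + n - 1) choose (t - a)) = (\<Sum>a\<le>t. (a + n - 1) choose a)"
    by (rule sum.reindex_bij_witness[of _ "\<lambda>a. t - a" "\<lambda>a. t - a"]) auto
  also have "\<dots> = (t + n) choose t"
  proof (cases n)
    case 0
    have "(\<Sum>a\<le>t. (a - 1) choose a) = (\<Sum>a\<le>t. if a = 0 then 1 else 0)"
      by (intro sum.cong) auto
    then show ?thesis using 0 by simp
  next
    case (Suc r)
    then show ?thesis using sum_choose_lower[of r t] by (simp add: add.commute)
  qed
  finally show ?thesis .
qed

text \<open>The binomials on the right are at natural numbers, with \<open>0 - 1 = 0\<close>: an index \<open>i\<close>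
  without variables contributes the indicator of \<open>v i = 0\<close>, as it should.\<close>

lemma card_monomials:
  fixes g :: "'x::finite \<Rightarrow> 'p::finite"
  shows "finite {m. keys m \<subseteq> F \<and> multidegree g m = v} \<and> card {m. keys m \<subseteq> F \<and> multidegree g m = v} =
    (\<Prod>i\<in>UNIV. (v i + card {x\<in>F. g x = i} - 1) choose v i)"
proof (induction F arbitrary: v rule: finite_induct[OF finite])
  case 1
  have "{m. keys m \<subseteq> {} \<and> multidegree g m = v} = (if v = (\<lambda>_. 0) then {0} else {})"
    by (auto simp: multidegree_def)
  moreover have "(\<Prod>i\<in>UNIV. (v i - 1) choose v i) = (if v = (\<lambda>_. 0) then 1 else 0)"
  proof (cases "v = (\<lambda>_. 0)")
    case False
    then obtain i where "v i \<noteq> 0" by (auto simp: fun_eq_iff)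
    then have "(v i - 1) choose v i = 0" by (simp add: binomial_eq_0)
    then show ?thesis using False by (auto simp: prod_zero_iff)
  qed simp
  ultimately show ?case by simp
next
  case (2 y F)
  define S where "S v = {m. keys m \<subseteq> F \<and> multidegree g m = v}" for v
  define t where "t = v (g y)"
  \<comment> \<open>The degree left for the variables of \<open>F\<close> once \<open>y\<close> has
    exponent \<open>a\<close>; only the coordinate of \<open>y\<close> changes.\<close>
  define w where "w a = v(g y := t - a)" for a
  have finS: "finite (S v)" and cardS: "card (S v) = (\<Prod>i\<in>UNIV. (v i + card {x\<in>F. g x = i} - 1) choose v i)" for v
    using 2 by (auto simp: S_def)
  have deg: "multidegree g (m + monomial y a) = v \<longleftrightarrow> a \<le> t \<and> multidegree g m = w a" for m a
    by (auto simp: fun_eq_iff multidegree_add multidegree_monomial w_def t_def)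
  have "{m. keys m \<subseteq> insert y F \<and> multidegree g m = v} = (\<Union>a\<le>t. (\<lambda>m. m + monomial y a) ` S (w a))"
  proof (intro equalityI subsetI)
    fix m assume m: "m \<in> {m. keys m \<subseteq> insert y F \<and> multidegree g m = v}"
    let ?m = "mrestrict (- {y}) m"
    have eq: "m = ?m + monomial y (lookup m y)"
      by (rule poly_mapping_eqI) (simp add: lookup_add lookup_single when_def)
    with m have "multidegree g (?m + monomial y (lookup m y)) = v" by simp
    then have "lookup m y \<le> t" "?m \<in> S (w (lookup m y))" using m unfolding deg by (auto simp: S_def)
    then show "m \<in> (\<Union>a\<le>t. (\<lambda>m. m + monomial y a) ` S (w a))"
      using eq by blast
  next
    fix m assume "m \<in> (\<Union>a\<le>t. (\<lambda>m. m + monomial y a) ` S (w a))"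
    then obtain a m' where "a \<le> t" "m' \<in> S (w a)" "m = m' + monomial y a" by auto
    then show "m \<in> {m. keys m \<subseteq> insert y F \<and> multidegree g m = v}"
      by (auto simp: deg S_def keys_add_nat split: if_splits)
  qed
  moreover have "finite (\<Union>a\<le>t. (\<lambda>m. m + monomial y a) ` S (w a))" using finS by auto
  moreover have "card (\<Union>a\<le>t. (\<lambda>m. m + monomial y a) ` S (w a)) = (\<Sum>a\<le>t. card ((\<lambda>m. m + monomial y a) ` S (w a)))"
  proof (rule card_UN_disjoint)
    have "lookup m y = 0" if "m \<in> S v" for m v using that 2 by (auto simp: S_def in_keys_iff)
    then have L: "lookup m y = a" if "m \<in> (\<lambda>m. m + monomial y a) ` S (w a)" for m a
      using that by (auto simp: lookup_add)
    show "\<forall>a\<in>{..t}. \<forall>b\<in>{..t}. a \<noteq> b \<longrightarrow>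
        (\<lambda>m. m + monomial y a) ` S (w a) \<inter> (\<lambda>m. m + monomial y b) ` S (w b) = {}"
    proof (intro ballI impI equals0I, elim IntE)
      fix a b m
      assume "a \<noteq> b" "m \<in> (\<lambda>m. m + monomial y a) ` S (w a)" "m \<in> (\<lambda>m. m + monomial y b) ` S (w b)"
      then show False using L[of m a] L[of m b] by simp
    qed
  qed (use finS in auto)
  moreover have "card ((\<lambda>m. m + monomial y a) ` S (w a)) = card (S (w a))" for a
    by (intro card_image inj_onI) simp
  moreover have "(\<Sum>a\<le>t. card (S (w a))) = (\<Prod>i\<in>UNIV. (v i + card {x\<in>insert y F. g x = i} - 1) choose v i)"
  proof -
    let ?n = "\<lambda>i. card {x\<in>F. g x = i}"
    let ?rest = "\<Prod>i\<in>UNIV - {g y}. (v i + ?n i - 1) choose v i"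
    have "card (S (w a)) = ((t - a + ?n (g y) - 1) choose (t - a)) * ?rest" for a
    proof -
      have "(\<Prod>i\<in>UNIV - {g y}. (w a i + ?n i - 1) choose w a i) = ?rest"
        by (intro prod.cong) (auto simp: w_def)
      then show ?thesis unfolding cardS
        by (subst prod.remove[of _ "g y"]) (auto simp: w_def)
    qed
    then have "(\<Sum>a\<le>t. card (S (w a))) = ((t + ?n (g y)) choose t) * ?rest"
      by (simp only: sum_choose_hockey_stick flip: sum_distrib_right)
    also have "\<dots> = ((t + card {x\<in>insert y F. g x = g y} - 1) choose t) *
        (\<Prod>i\<in>UNIV - {g y}. (v i + card {x\<in>insert y F. g x = i} - 1) choose v i)"
    proof -
      have "{x\<in>insert y F. g x = g y} = insert y {x\<in>F. g x = g y}" by auto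
      then have "card {x\<in>insert y F. g x = g y} = Suc (?n (g y))" using 2 by simp
      moreover have "{x\<in>insert y F. g x = i} = {x\<in>F. g x = i}" if "i \<noteq> g y" for i using that by auto
      ultimately show ?thesis by simp
    qed
    also have "\<dots> = (\<Prod>i\<in>UNIV. (v i + card {x\<in>insert y F. g x = i} - 1) choose v i)"
      unfolding t_def by (rule prod.remove[OF finite UNIV_I, symmetric])
    finally show ?thesis .
  qed
  ultimately show ?case by simp
qed

section \<open>Binomial products and Hilbert polynomials\<close>

lemma mpoly_eval_binom_prod:
  "mpoly_eval (binom_prod n) u = (\<Prod>i\<in>UNIV. (\<Prod>r\<in>{1..n i}. u i + of_nat r) / fact (n i))"
  by (simp add: binom_prod_def mpoly_eval_prod)

lemma mpoly_eval_binom_prod_of_nat: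
  "mpoly_eval (binom_prod n) (\<lambda>i. of_nat (v i)) = of_nat (\<Prod>i\<in>UNIV. (v i + n i) choose n i)"
proof -
  have "(\<Prod>r\<in>{1..n}. of_nat t + of_nat r) / fact n = (of_nat ((t + n) choose n) :: rat)" for t n :: nat
  proof -
    \<comment> \<open>Multiplication by \<open>fact t\<close> completes the product to a
      factorial.\<close>
    have "fact t * (\<Prod>r\<in>{1..n}. of_nat t + of_nat r) = (fact (t + n) :: rat)"
    proof (induction n)
      case (Suc n)
      have "fact t * (\<Prod>r\<in>{1..Suc n}. of_nat t + of_nat r) =
          (fact t * (\<Prod>r\<in>{1..n}. of_nat t + of_nat r)) * (of_nat t + of_nat (Suc n) :: rat)"
        by (simp add: mult.assoc)
      also have "\<dots> = fact (t + n) * of_nat (Suc (t + n))" by (simp only: Suc.IH) simp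
      finally show ?case by (simp add: mult.commute)
    qed simp
    moreover have "of_nat ((t + n) choose n) = (fact (t + n) / (fact n * fact t) :: rat)"
      by (subst binomial_fact) simp_all
    ultimately have "fact t * (\<Prod>r\<in>{1..n}. of_nat t + of_nat r) = (fact t * (of_nat ((t + n) choose n) * fact n) :: rat)"
      by simp
    then have "(\<Prod>r\<in>{1..n}. of_nat t + of_nat r) = (of_nat ((t + n) choose n) * fact n :: rat)"
      by (simp only: mult_cancel_left) simp
    then show ?thesis by simp
  qed
  then show ?thesis by (simp add: mpoly_eval_binom_prod)
qed

text \<open>The product for \<open>n\<close> vanishes at \<open>t = - u - 1\<close> unless \<open>n \<le> u\<close>, so these
  evaluations form a triangular system.\<close>

lemma binom_prod_linear_independent:
  fixes c :: "('p::finite \<Rightarrow> nat) \<Rightarrow> rat"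
  assumes fin: "finite N" and sum: "(\<Sum>n\<in>N. Const (c n) * binom_prod n) = 0" and "n \<in> N"
  shows "c n = 0"
proof (rule ccontr)
  assume "c n \<noteq> 0"
  define B where "B = {n\<in>N. c n \<noteq> 0}"
  have "B \<noteq> {}" using \<open>n \<in> N\<close> \<open>c n \<noteq> 0\<close> by (auto simp: B_def)
  \<comment> \<open>A minimal total suffices: an index below \<open>u\<close> in every coordinate
    and different from \<open>u\<close> would have a smaller total.\<close>
  then obtain u where u: "u \<in> B" and min: "\<And>n. n \<in> B \<Longrightarrow> sum u UNIV \<le> sum n UNIV"
    using ex_has_least_nat[of "\<lambda>n. n \<in> B" _ "\<lambda>n. sum n UNIV"] by blast
  let ?t = "\<lambda>i. - of_nat (u i) - 1 :: rat"
  have zero: "mpoly_eval (binom_prod n) ?t = 0" if "n \<in> B" "n \<noteq> u" for n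
  proof -
    have "\<exists>i. u i < n i"
    proof (rule ccontr)
      assume "\<nexists>i. u i < n i"
      then have le: "n i \<le> u i" for i by (simp add: not_less)
      obtain i where "n i \<noteq> u i" using \<open>n \<noteq> u\<close> by (auto simp: fun_eq_iff)
      then have "sum n UNIV < sum u UNIV"
        using le by (intro sum_strict_mono_ex1) (auto intro!: exI[of _ i] le_neq_implies_less)
      then show False using min[OF \<open>n \<in> B\<close>] by simp
    qed
    then obtain i where "u i < n i" by blast
    then have "(\<Prod>r\<in>{1..n i}. ?t i + of_nat r) = 0"
      by (intro prod_zero) (auto intro!: bexI[of _ "Suc (u i)"])
    then show ?thesis unfolding mpoly_eval_binom_prod by (intro prod_zero) (auto intro!: exI[of _ i])
  qed
  have "0 = (\<Sum>n\<in>N. c n * mpoly_eval (binom_prod n) ?t)"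
    using arg_cong[OF sum, of "\<lambda>P. mpoly_eval P ?t"] by (simp add: mpoly_eval_sum)
  also have "\<dots> = (\<Sum>n\<in>N. if n = u then c u * mpoly_eval (binom_prod u) ?t else 0)"
    using zero by (intro sum.cong) (auto simp: B_def)
  also have "\<dots> = c u * mpoly_eval (binom_prod u) ?t" using fin u by (simp add: B_def)
  finally have "mpoly_eval (binom_prod u) ?t = 0" using u by (simp add: B_def)
  then obtain i r where "r \<in> {1..u i}" "?t i + of_nat r = 0"
    unfolding mpoly_eval_binom_prod by (auto simp: prod_zero_iff)
  then have "of_nat r = (of_nat (Suc (u i)) :: rat)" by simp
  then show False using \<open>r \<in> {1..u i}\<close> by (simp only: of_nat_eq_iff) simp
qed

lemma hilbert_poly_eqI:
  fixes P :: "('p::finite, rat) mpoly"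
  assumes "\<And>v. (\<And>i. N \<le> v i) \<Longrightarrow> mpoly_eval P (\<lambda>i. of_nat (v i)) = of_nat (hilbert_function g J v)"
  shows "hilbert_poly g J = P"
  unfolding hilbert_poly_def
proof (rule the_equality)
  show "\<exists>N. \<forall>v. (\<forall>i. N \<le> v i) \<longrightarrow> mpoly_eval P (\<lambda>i. of_nat (v i)) = of_nat (hilbert_function g J v)"
    using assms by blast
  fix P' :: "('p, rat) mpoly" assume "\<exists>N. \<forall>v. (\<forall>i. N \<le> v i) \<longrightarrow> mpoly_eval P' (\<lambda>i. of_nat (v i)) = of_nat (hilbert_function g J v)"
  then obtain N' where N': "\<And>v. (\<And>i. N' \<le> v i) \<Longrightarrow> mpoly_eval P' (\<lambda>i. of_nat (v i)) = of_nat (hilbert_function g J v)"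
    by blast
  have "P' - P = 0"
    by (rule mpoly_eq_0_if_eventually[of "max N N'"]) (simp add: assms N')
  then show "P' = P" by simp
qed

text \<open>The index \<open>n i - 1\<close> is only meant for faces with a variable in every degree.\<close>

definition relevant_face :: "('x \<Rightarrow> 'p) \<Rightarrow> 'x set \<Rightarrow> bool" where
  "relevant_face g F \<longleftrightarrow> (\<forall>i. \<exists>x\<in>F. g x = i)"

definition face_index :: "('x \<Rightarrow> 'p) \<Rightarrow> 'x set \<Rightarrow> 'p \<Rightarrow> nat" where
  "face_index g F i = card {x\<in>F. g x = i} - 1"

definition face_poly :: "('x::finite \<Rightarrow> 'p::finite) \<Rightarrow> 'x set \<Rightarrow> ('p, rat) mpoly" where
  "face_poly g F = (if relevant_face g F then binom_prod (face_index g F) else 0)"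

text \<open>On a relevant face both sides agree by symmetry of the binomials. Positivity of
  \<open>v\<close> is for the other faces: a degree without variables contributes
  \<open>(v i - 1) choose v i\<close>, which is 0 as soon as \<open>v i\<close> is positive.\<close>

lemma mpoly_eval_face_poly:
  assumes "\<And>i. 1 \<le> v i"
  shows "mpoly_eval (face_poly g F) (\<lambda>i. of_nat (v i)) =
    of_nat (card {m. keys m \<subseteq> F \<and> multidegree g m = v})"
proof (cases "relevant_face g F")
  case True
  have "((v i + face_index g F i) choose face_index g F i) = ((v i + card {x\<in>F. g x = i} - 1) choose v i)" for i
  proof -
    have "{x\<in>F. g x = i} \<noteq> {}" using True unfolding relevant_face_def by blast
    then have "card {x\<in>F. g x = i} \<ge> 1" by (simp add: Suc_le_eq card_gt_0_iff)
    then have "v i + card {x\<in>F. g x = i} - 1 = v i + face_index g F i" by (simp add: face_index_def)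
    then show ?thesis using binomial_symmetric[of "v i" "v i + face_index g F i"] by simp
  qed
  then show ?thesis
    using True card_monomials[of F g v] by (simp add: face_poly_def mpoly_eval_binom_prod_of_nat)
next
  case False
  then obtain i where i: "{x\<in>F. g x = i} = {}" by (auto simp: relevant_face_def)
  have "(v i + card {x\<in>F. g x = i} - 1) choose v i = (v i - 1) choose v i"
    by (simp only: i card.empty add_0_right)
  also have "\<dots> = 0" using assms[of i] by (simp add: binomial_eq_0)
  finally have "(v i + card {x\<in>F. g x = i} - 1) choose v i = 0" .
  then have "(\<Prod>i\<in>UNIV. (v i + card {x\<in>F. g x = i} - 1) choose v i) = 0"
    by (intro prod_zero bexI[of _ i]) simp_all
  then show ?thesis using False card_monomials[of F g v] by (simp add: face_poly_def)
qed

lemma hilbert_poly_var_ideal: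
  "hilbert_poly g (var_ideal F :: ('x::finite, 'k::field) mpoly set) = face_poly g F"
  by (rule hilbert_poly_eqI[of 1]) (simp add: mpoly_eval_face_poly hilbert_function_face_ideal)

text \<open>Several summands may share an index, so they are first grouped. Uniqueness compares two
  expansions over the union of their supports by linear independence.\<close>

lemma hilbert_coeff_eqI:
  fixes J :: "('x::finite, 'k::field) mpoly set" and s :: "'i \<Rightarrow> int" and n :: "'i \<Rightarrow> 'p::finite \<Rightarrow> nat"
  assumes "finite I" and hp: "hilbert_poly g J = (\<Sum>i\<in>I. of_int (s i) * binom_prod (n i))"
  shows "hilbert_coeff g J u = (\<Sum>i | i \<in> I \<and> n i = u. s i)"
proof -
  define d where "d u = (\<Sum>i | i \<in> I \<and> n i = u. s i)" for u
  let ?supp = "\<lambda>d. {u :: 'p \<Rightarrow> nat. (d u :: int) \<noteq> 0}"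
  have sub: "?supp d \<subseteq> n ` I"
    unfolding d_def by (auto elim: sum.not_neutral_contains_not_neutral)
  have fin: "finite (?supp d)" by (rule finite_subset[OF sub]) (simp add: assms(1))
  have "hilbert_poly g J = (\<Sum>u\<in>n ` I. \<Sum>i | i \<in> I \<and> n i = u. of_int (s i) * binom_prod (n i))"
    unfolding hp using assms(1) by (intro sum.group[symmetric]) auto
  also have "\<dots> = (\<Sum>u\<in>n ` I. of_int (d u) * binom_prod u)"
    by (intro sum.cong) (auto simp: d_def sum_distrib_right)
  also have "\<dots> = (\<Sum>u | d u \<noteq> 0. of_int (d u) * binom_prod u)"
    using assms(1) sub by (intro sum.mono_neutral_right) auto
  finally have d: "hilbert_poly g J = (\<Sum>u | d u \<noteq> 0. of_int (d u) * binom_prod u)" .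
  have "hilbert_coeff g J = d"
    unfolding hilbert_coeff_def
  proof (rule the_equality, intro conjI fin d)
    fix d' assume d': "finite (?supp d') \<and> hilbert_poly g J = (\<Sum>u | d' u \<noteq> 0. of_int (d' u) * binom_prod u)"
    let ?N = "?supp d \<union> ?supp d'"
    have N: "finite ?N" using fin d' by simp
    have ext: "(\<Sum>u | e u \<noteq> 0. of_int (e u) * binom_prod u) = (\<Sum>u\<in>?N. of_int (e u) * (binom_prod u :: ('p, rat) mpoly))"
      if "?supp e \<subseteq> ?N" for e
      using N that by (intro sum.mono_neutral_left) auto
    have "(\<Sum>u\<in>?N. Const (of_int (d' u - d u)) * binom_prod u) =
        (\<Sum>u\<in>?N. of_int (d' u) * binom_prod u) - (\<Sum>u\<in>?N. of_int (d u) * binom_prod u)"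
      by (simp add: Const_def single_diff left_diff_distrib sum_subtractf)
    also have "\<dots> = 0" using d d' ext[of d] ext[of d'] by auto
    finally have zero: "(\<Sum>u\<in>?N. Const (of_int (d' u - d u)) * binom_prod u) = 0" .
    show "d' = d"
    proof
      fix u
      show "d' u = d u"
      proof (cases "u \<in> ?N")
        case True
        have "rat_of_int (d' u - d u) = 0" by (rule binom_prod_linear_independent[OF N zero True])
        then show ?thesis by simp
      qed simp
    qed
  qed
  then show ?thesis by (simp add: d_def)
qed

text \<open>Independence is applied to the pair of products when the indices differ, and to a single
  product when they agree. This lets a sign be read off from a summand.\<close>

lemma binom_prod_scalar_eq:
  assumes "Const a * binom_prod n = Const b * binom_prod n'" "a \<noteq> 0"
  shows "n = n' \<and> a = b"
proof -
  have "n = n'"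
  proof (rule ccontr)
    assume "n \<noteq> n'"
    then have "(\<Sum>u\<in>{n, n'}. Const (if u = n then a else - b) * binom_prod u) = 0"
      using assms(1) by (simp add: Const_def single_uminus)
    from binom_prod_linear_independent[OF _ this, of n] show False using assms(2) by simp
  qed
  moreover have "a - b = 0"
  proof (rule binom_prod_linear_independent[of "{n}" "\<lambda>_. a - b" n])
    have "Const (a - b) * binom_prod n = Const a * binom_prod n - Const b * binom_prod n"
      by (simp add: Const_def single_diff left_diff_distrib)
    then show "(\<Sum>u\<in>{n}. Const (a - b) * binom_prod u) = 0" using assms(1) \<open>n = n'\<close> by simp
  qed auto
  ultimately show ?thesis by simp
qed

section \<open>Shellings\<close>

lemma face_subset_facet:
  fixes \<Delta> :: "'x::finite set set"
  assumes "G \<in> \<Delta>"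
  obtains F where "F \<in> facets \<Delta>" "G \<subseteq> F"
proof -
  obtain F where "F \<in> \<Delta>" "G \<subseteq> F" "\<forall>H\<in>\<Delta>. F \<subseteq> H \<longrightarrow> F = H"
    using finite_has_maximal2[of \<Delta> G] assms by auto
  then show ?thesis by (intro that[of F]) (auto simp: facets_def)
qed

text \<open>The set \<open>L j\<close> is the restriction of the facet \<open>F j\<close>: the faces that \<open>F j\<close>
  adds to the complex are those between \<open>L j\<close> and \<open>F j\<close>.\<close>

lemma shelling_restriction:
  fixes F :: "nat \<Rightarrow> 'x::finite set"
  assumes sh: "shelling_order \<Delta> k F" and j: "j \<in> {1..k}" and "L \<subseteq> F j"
    and L: "{F i \<inter> F j | i. i \<in> {1..<j} \<and> card (F i \<inter> F j) + 1 = card (F j)} = {F j - {x} | x. x \<in> L}"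
    and G: "G \<subseteq> F j"
  shows "L \<subseteq> G \<longleftrightarrow> (\<forall>i\<in>{1..<j}. \<not> G \<subseteq> F i)"
proof
  assume "L \<subseteq> G"
  show "\<forall>i\<in>{1..<j}. \<not> G \<subseteq> F i"
  proof (intro ballI notI)
    fix i assume i: "i \<in> {1..<j}" and "G \<subseteq> F i"
    define \<Gamma> where "\<Gamma> = generated_complex (F ` {1..<j}) \<inter> generated_complex {F j}"
    have "G \<in> \<Gamma>" using i \<open>G \<subseteq> F i\<close> G by (auto simp: \<Gamma>_def generated_complex_def)
    \<comment> \<open>A facet of the intersection lies in some \<open>F i' \<inter> F j\<close>,
      which itself belongs to the intersection, so it equals that set. Purity then makes it
      \<open>F j\<close> without one element, and that element is in \<open>L\<close>.\<close>
    then obtain H where H: "H \<in> facets \<Gamma>" "G \<subseteq> H" by (rule face_subset_facet)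
    then obtain i' where i': "i' \<in> {1..<j}" "H \<subseteq> F i' \<inter> F j"
      by (auto simp: facets_def \<Gamma>_def generated_complex_def)
    have "F i' \<inter> F j \<in> \<Gamma>" using i'(1) by (auto simp: \<Gamma>_def generated_complex_def)
    then have eq: "H = F i' \<inter> F j" using H(1) i'(2) by (auto simp: facets_def)
    have "j \<in> {2..k}" using i j by auto
    then have "face_dim H = face_dim (F j) - 1"
      using sh H(1) unfolding shelling_order_def pure_of_dim_def \<Gamma>_def by blast
    then have "card H + 1 = card (F j)" by (simp add: face_dim_def)
    then have "H \<in> {F i \<inter> F j | i. i \<in> {1..<j} \<and> card (F i \<inter> F j) + 1 = card (F j)}"
      using i'(1) eq by blast
    then obtain x where "x \<in> L" "H = F j - {x}" unfolding L by blast
    then show False using \<open>L \<subseteq> G\<close> \<open>G \<subseteq> H\<close> by blast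
  qed
next
  assume *: "\<forall>i\<in>{1..<j}. \<not> G \<subseteq> F i"
  show "L \<subseteq> G"
  proof
    fix x assume "x \<in> L"
    then have "F j - {x} \<in> {F i \<inter> F j | i. i \<in> {1..<j} \<and> card (F i \<inter> F j) + 1 = card (F j)}"
      unfolding L by blast
    then obtain i where "i \<in> {1..<j}" "F j - {x} \<subseteq> F i" by blast
    \<comment> \<open>Otherwise \<open>G\<close> would lie in \<open>F j - {x}\<close> and hence in
      the earlier facet \<open>F i\<close>.\<close>
    then show "x \<in> G" using * G by blast
  qed
qed

lemma sum_alternating_Pow:
  assumes "finite A"
  shows "(\<Sum>B\<in>Pow A. (-1) ^ card B) = (if A = {} then 1 else 0 :: 'a::comm_ring_1)"
  using assms
proof (induction A rule: finite_induct)
  case (insert x A)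
  have "(\<Sum>B\<in>Pow (insert x A). (-1) ^ card B) =
      (\<Sum>B\<in>Pow A. (-1) ^ card B) + (\<Sum>B\<in>insert x ` Pow A. (-1) ^ card B :: 'a)"
    unfolding Pow_insert using insert by (intro sum.union_disjoint) auto
  also have "(\<Sum>B\<in>insert x ` Pow A. (-1) ^ card B :: 'a) = (\<Sum>B\<in>Pow A. (-1) ^ card (insert x B))"
    using insert by (intro sum.reindex_cong[of "insert x"]) (auto simp: inj_on_def)
  also have "\<dots> = (\<Sum>B\<in>Pow A. - ((-1) ^ card B))"
  proof (rule sum.cong[OF refl])
    fix B assume "B \<in> Pow A"
    then have "finite B" "x \<notin> B" using insert finite_subset by auto
    then show "(-1) ^ card (insert x B) = - ((-1) ^ card B :: 'a)" by simp
  qed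
  finally show ?case by (simp add: sum_negf)
qed simp

text \<open>Each monomial supported on a face receives total weight 1. For fixed \<open>j\<close>
  the alternating sum over \<open>A\<close> vanishes unless the support lies between the restriction
  and \<open>F j\<close>, and this happens for exactly one \<open>j\<close>, the first facet
  containing the support.\<close>

lemma card_shelling:
  fixes F :: "nat \<Rightarrow> 'x::finite set" and g :: "'x \<Rightarrow> 'p::finite" and l :: "nat \<Rightarrow> nat \<Rightarrow> 'x"
  assumes \<Delta>: "simplicial_complex \<Delta>" and sh: "shelling_order \<Delta> k F"
    and l: "\<And>j. j \<in> {1..k} \<Longrightarrow> l j ` {1..b j} \<subseteq> F j"
    and L: "\<And>j. j \<in> {1..k} \<Longrightarrow> {F i \<inter> F j | i. i \<in> {1..<j} \<and> card (F i \<inter> F j) + 1 = card (F j)} =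
      {F j - {x} | x. x \<in> l j ` {1..b j}}"
  shows "rat_of_nat (card {m. keys m \<in> \<Delta> \<and> multidegree g m = v}) =
    (\<Sum>j\<in>{1..k}. \<Sum>A\<in>Pow {1..b j}. (-1) ^ card A *
      of_nat (card {m. keys m \<subseteq> F j - l j ` A \<and> multidegree g m = v}))"
proof -
  let ?M = "{m. keys m \<in> \<Delta> \<and> multidegree g m = v}"
  let ?P = "\<lambda>j A m. keys m \<subseteq> F j - l j ` A"
  have "finite {m. keys m \<subseteq> UNIV \<and> multidegree g m = v}" using card_monomials by blast
  from finite_subset[OF _ this] have fin: "finite ?M" by auto
  have F: "F j \<in> \<Delta>" if "j \<in> {1..k}" for j
    using sh that by (auto simp: shelling_order_def bij_betw_def facets_def)
  have one: "(\<Sum>j\<in>{1..k}. \<Sum>A\<in>Pow {1..b j}. (-1) ^ card A * (if ?P j A m then 1 else 0 :: rat)) = 1"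
    if m: "keys m \<in> \<Delta>" for m
  proof -
    have inner: "(\<Sum>A\<in>Pow {1..b j}. (-1) ^ card A * (if ?P j A m then 1 else 0 :: rat)) =
      (if keys m \<subseteq> F j \<and> l j ` {1..b j} \<subseteq> keys m then 1 else 0)" for j
    proof (cases "keys m \<subseteq> F j")
      case True
      \<comment> \<open>For support inside \<open>F j\<close>, the sets \<open>A\<close> that
        contribute are exactly the subsets of \<open>?B\<close>.\<close>
      let ?B = "{i\<in>{1..b j}. l j i \<notin> keys m}"
      have "(\<Sum>A\<in>Pow {1..b j}. (-1) ^ card A * (if ?P j A m then 1 else 0 :: rat)) =
          (\<Sum>A\<in>Pow ?B. (-1) ^ card A)"
        using True by (intro sum.mono_neutral_cong_right) auto
      also have "\<dots> = (if ?B = {} then 1 else 0)" by (rule sum_alternating_Pow) simp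
      also have "?B = {} \<longleftrightarrow> l j ` {1..b j} \<subseteq> keys m" by blast
      finally show ?thesis using True by simp
    next
      case False
      then have "\<not> ?P j A m" for A by blast
      with False show ?thesis by simp
    qed
    obtain H where "H \<in> facets \<Delta>" "keys m \<subseteq> H" using m by (rule face_subset_facet)
    moreover have "F ` {1..k} = facets \<Delta>" using sh by (simp add: shelling_order_def bij_betw_def)
    ultimately have "H \<in> F ` {1..k}" by simp
    then obtain j1 where "j1 \<in> {1..k}" "H = F j1" by (elim imageE)
    then have ex: "\<exists>j. j \<in> {1..k} \<and> keys m \<subseteq> F j" using \<open>keys m \<subseteq> H\<close> by blast
    define j0 where "j0 = (LEAST j. j \<in> {1..k} \<and> keys m \<subseteq> F j)"
    have j0: "j0 \<in> {1..k}" "keys m \<subseteq> F j0"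
      using LeastI_ex[OF ex] unfolding j0_def by blast+
    have iff: "keys m \<subseteq> F j \<and> l j ` {1..b j} \<subseteq> keys m \<longleftrightarrow> j = j0" if j: "j \<in> {1..k}" for j
    proof -
      have least: "j0 \<le> i" if "i \<in> {1..k}" "keys m \<subseteq> F i" for i
        unfolding j0_def by (rule Least_le) (use that in blast)
      have *: "l j ` {1..b j} \<subseteq> keys m \<longleftrightarrow> (\<forall>i\<in>{1..<j}. \<not> keys m \<subseteq> F i)" if "keys m \<subseteq> F j"
        by (rule shelling_restriction[OF sh j l[OF j] L[OF j] that])
      show ?thesis
      proof
        assume "keys m \<subseteq> F j \<and> l j ` {1..b j} \<subseteq> keys m"
        then have "keys m \<subseteq> F j" "\<forall>i\<in>{1..<j}. \<not> keys m \<subseteq> F i" using * by auto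
        then show "j = j0" using least[OF j] j0 by (auto simp: order_le_less)
      next
        assume [simp]: "j = j0"
        have "\<forall>i\<in>{1..<j}. \<not> keys m \<subseteq> F i" using least j by fastforce
        then show "keys m \<subseteq> F j \<and> l j ` {1..b j} \<subseteq> keys m" using * j0(2) by simp
      qed
    qed
    have "(\<Sum>j\<in>{1..k}. \<Sum>A\<in>Pow {1..b j}. (-1) ^ card A * (if ?P j A m then 1 else 0 :: rat)) =
        (\<Sum>j\<in>{1..k}. if j = j0 then 1 else 0)"
      unfolding inner using iff by (intro sum.cong) auto
    also have "\<dots> = 1" using j0 by simp
    finally show ?thesis .
  qed
  have "rat_of_nat (card ?M) = (\<Sum>m\<in>?M. 1)" by simp
  also have "\<dots> = (\<Sum>m\<in>?M. \<Sum>j\<in>{1..k}. \<Sum>A\<in>Pow {1..b j}. (-1) ^ card A * (if ?P j A m then 1 else 0))"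
    using one by (intro sum.cong) auto
  also have "\<dots> = (\<Sum>j\<in>{1..k}. \<Sum>A\<in>Pow {1..b j}. \<Sum>m\<in>?M. (-1) ^ card A * (if ?P j A m then 1 else 0))"
    by (subst sum.swap) (intro sum.cong refl sum.swap)
  also have "\<dots> = (\<Sum>j\<in>{1..k}. \<Sum>A\<in>Pow {1..b j}. (-1) ^ card A *
      of_nat (card {m. keys m \<subseteq> F j - l j ` A \<and> multidegree g m = v}))"
  proof (intro sum.cong refl)
    fix j A assume j: "j \<in> {1..k}"
    have "{m \<in> ?M. ?P j A m} = {m. keys m \<subseteq> F j - l j ` A \<and> multidegree g m = v}"
      using F[OF j] \<Delta> unfolding simplicial_complex_def by blast
    moreover have "(\<Sum>m\<in>?M. if ?P j A m then 1 else 0) = rat_of_nat (card {m \<in> ?M. ?P j A m})"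
      using fin by (simp flip: sum.inter_filter)
    ultimately show "(\<Sum>m\<in>?M. (-1) ^ card A * (if ?P j A m then 1 else 0)) =
        (-1) ^ card A * rat_of_nat (card {m. keys m \<subseteq> F j - l j ` A \<and> multidegree g m = v})"
      by (simp flip: sum_distrib_left)
  qed
  finally show ?thesis .
qed

section \<open>Homogeneous components\<close>

abbreviation component :: "('x::finite \<Rightarrow> 'p) \<Rightarrow> ('p \<Rightarrow> nat) \<Rightarrow> ('x, 'a::zero) mpoly \<Rightarrow> ('x, 'a) mpoly" where
  "component g v \<equiv> mrestrict {m. multidegree g m = v}"

lemma sum_components:
  fixes f :: "('x::finite, 'a::comm_monoid_add) mpoly"
  shows "(\<Sum>v\<in>multidegree g ` keys f. component g v f) = f"
proof (rule poly_mapping_eqI)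
  fix m
  have "lookup (\<Sum>v\<in>multidegree g ` keys f. component g v f) m =
      (\<Sum>v\<in>multidegree g ` keys f. if v = multidegree g m then lookup f m else 0)"
    unfolding lookup_sum by (intro sum.cong) (auto simp: when_def)
  then show "lookup (\<Sum>v\<in>multidegree g ` keys f. component g v f) m = lookup f m"
    by (auto simp: in_keys_iff)
qed

lemma component_in_graded_piece: "component g v f \<in> graded_piece g v"
  by (simp add: graded_piece_def)

lemma component_graded_piece:
  assumes "f \<in> graded_piece g v"
  shows "component g w f = (if w = v then f else 0)"
  using assms by (intro poly_mapping_eqI) (auto simp: graded_piece_def when_def in_keys_iff)

lemma graded_piece_mult:
  fixes f h :: "('x::finite, 'k::field) mpoly"
  assumes "f \<in> graded_piece g v" "h \<in> graded_piece g w"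
  shows "f * h \<in> graded_piece g (\<lambda>i. v i + w i)"
  unfolding graded_piece_def
proof (intro CollectI ballI)
  fix m assume "m \<in> keys (f * h)"
  then obtain m1 m2 where "m = m1 + m2" "m1 \<in> keys f" "m2 \<in> keys h" using keys_mult[of f h] by auto
  then show "multidegree g m = (\<lambda>i. v i + w i)"
    using assms by (auto simp: graded_piece_def multidegree_add)
qed

text \<open>This is the largest homogeneous ideal inside \<open>I\<close>; an ideal generated by
  homogeneous elements of \<open>I\<close> therefore lies in it.\<close>

lemma ideal_components:
  fixes I :: "('x::finite, 'k::field) mpoly set"
  assumes I: "ideal I mpoly_ring"
  shows "ideal {f. \<forall>v. component g v f \<in> I} mpoly_ring"
  unfolding ideal_mpoly_ring_iff
proof (intro conjI ballI allI)
  show "0 \<in> {f. \<forall>v. component g v f \<in> I}" using I by (simp add: ideal_mpoly_ring_iff)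
  fix f assume f: "f \<in> {f. \<forall>v. component g v f \<in> I}"
  show "f + h \<in> {f. \<forall>v. component g v f \<in> I}" if "h \<in> {f. \<forall>v. component g v f \<in> I}" for h
    using f that I by (simp add: ideal_mpoly_ring_iff mrestrict_add)
  show "r * f \<in> {f. \<forall>v. component g v f \<in> I}" for r
  proof (intro CollectI allI)
    fix v
    let ?U = "multidegree g ` keys r" and ?W = "multidegree g ` keys f"
    have "component g v (r * f) = component g v ((\<Sum>u\<in>?U. component g u r) * (\<Sum>w\<in>?W. component g w f))"
      by (simp only: sum_components)
    also have "\<dots> = (\<Sum>u\<in>?U. \<Sum>w\<in>?W. component g v (component g u r * component g w f))"
      by (simp only: sum_product mrestrict_sum)
    \<comment> \<open>Each product of two components is homogeneous, so its component of degree
      \<open>v\<close> is either the product itself or 0.\<close>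
    also have "\<dots> \<in> I"
    proof (intro ideal_mpoly_ring_sum[OF I])
      fix u w
      have "component g u r * component g w f \<in> graded_piece g (\<lambda>i. u i + w i)"
        by (intro graded_piece_mult component_in_graded_piece)
      moreover have "component g u r * component g w f \<in> I"
        using I f unfolding ideal_mpoly_ring_iff by blast
      moreover have "0 \<in> I" using I unfolding ideal_mpoly_ring_iff by blast
      ultimately show "component g v (component g u r * component g w f) \<in> I"
        by (simp add: component_graded_piece)
    qed
    finally show "component g v (r * f) \<in> I" .
  qed
qed

section \<open>Points of the multiprojective scheme\<close>

text \<open>For a prime, the condition on variables says that it does not contain all polynomials
  homogeneous of a degree with positive entries. The points over \<open>J\<close> correspond to such
  primes containing \<open>J\<close>.\<close>

definition relevant_homogeneous_prime :: "('x::finite \<Rightarrow> 'p) \<Rightarrow> ('x, 'k::field) mpoly set \<Rightarrow> bool" where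
  "relevant_homogeneous_prime g P \<longleftrightarrow> primeideal P mpoly_ring \<and>
     (\<forall>f\<in>P. \<forall>v. component g v f \<in> P) \<and> (\<forall>i. \<exists>x. g x = i \<and> Var x \<notin> P)"

locale face_ring =
  fixes g :: "'x::finite \<Rightarrow> 'p::finite" and J :: "('x, 'k::field) mpoly set" and \<Delta> :: "'x set set"
  assumes complex: "simplicial_complex \<Delta>" and J_def: "J = face_ideal \<Delta>"
begin

abbreviation quot :: "('x, 'k) mpoly \<Rightarrow> ('x, 'k) mpoly set" where
  "quot f \<equiv> J +>\<^bsub>mpoly_ring\<^esub> f"

abbreviation R :: "('x, 'k) mpoly set ring" where
  "R \<equiv> mpoly_ring Quot J"

abbreviation X :: "('x, 'k) mpoly set set topology" where
  "X \<equiv> multiproj R (quot_piece g J)"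

abbreviation points :: "('x, 'k) mpoly set set set" where
  "points \<equiv> multiproj_points R (quot_piece g J)"

definition pull :: "('x, 'k) mpoly set set \<Rightarrow> ('x, 'k) mpoly set" where
  "pull P = {f. quot f \<in> P}"

lemma ideal_J: "ideal J mpoly_ring"
  unfolding J_def by (rule ideal_face_ideal[OF complex])

sublocale quot: ring_hom_ring "mpoly_ring :: ('x, 'k) mpoly ring" R quot
  using ideal.rcos_ring_hom_ring[OF ideal_J] .

lemma cring_R: "cring R"
  by (rule ideal.quotient_is_cring[OF ideal_J cring_mpoly_ring])

lemmas quot_simps = Quot_mpoly_ring_simps[OF ideal_J]

lemma quot_mem_image_iff:
  assumes "ideal Q mpoly_ring" "J \<subseteq> Q"
  shows "quot f \<in> quot ` Q \<longleftrightarrow> f \<in> Q"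
proof
  assume "quot f \<in> quot ` Q"
  then obtain q where q: "q \<in> Q" "f - q \<in> Q" using coset_eq_iff[OF ideal_J] assms(2) by blast
  then have "q + (f - q) \<in> Q" using assms(1) unfolding ideal_mpoly_ring_iff by blast
  then show "f \<in> Q" by simp
qed blast

lemma ideal_pull: "ideal P R \<Longrightarrow> ideal (pull P) mpoly_ring"
  using quot.ideal_vimage[of P] by (simp add: pull_def)

lemma primeideal_pull: "primeideal P R \<Longrightarrow> primeideal (pull P) mpoly_ring"
  using quot.primeideal_vimage[OF cring_mpoly_ring, of P] by (simp add: pull_def)

lemma J_subset_pull:
  assumes "ideal P R"
  shows "J \<subseteq> pull P"
proof
  fix f assume "f \<in> J"
  then have "quot f = \<zero>\<^bsub>R\<^esub>" by (simp add: quot_simps coset_eq_iff[OF ideal_J])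
  also have "\<dots> \<in> P" using assms by (simp add: additive_subgroup.zero_closed ideal.axioms(1))
  finally show "f \<in> pull P" by (simp add: pull_def)
qed

lemma image_pull:
  assumes "ideal P R"
  shows "quot ` pull P = P"
proof -
  have "P \<subseteq> carrier R" using assms by (simp add: additive_subgroup.a_subset ideal.axioms(1))
  then show ?thesis by (auto simp: pull_def quot_simps)
qed

lemma quot_piece_eq: "quot_piece g J v = quot ` graded_piece g v"
  by (simp add: quot_piece_def)

text \<open>Relevance: some polynomial of a degree with positive entries is outside the preimage,
  hence so is one of its terms; that term is divisible by a variable of every degree, and none of
  these divisors can be in the preimage.\<close>

lemma relevant_homogeneous_prime_pull:
  assumes "P \<in> points"
  shows "relevant_homogeneous_prime g (pull P)"
proof -
  let ?G = "\<Union>v. quot_piece g J v"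
  have prime: "primeideal P R" and hom: "P = Idl\<^bsub>R\<^esub> (P \<inter> ?G)"
    and rel: "\<not> (\<Union>v\<in>{v. \<forall>i. 0 < v i}. quot_piece g J v) \<subseteq> P"
    using assms by (auto simp: multiproj_points_def homogeneous_ideal_def)
  have ideal: "ideal P R" using prime by (rule primeideal.axioms(1))
  note pull_ideal = ideal_pull[OF ideal]
  \<comment> \<open>The homogeneous part of the preimage. Its image contains the homogeneous
    elements that generate \<open>P\<close>, hence all of \<open>P\<close>, so the preimage equals
    its homogeneous part.\<close>
  define K where "K = {f. \<forall>v. component g v f \<in> pull P}"
  have K: "ideal K mpoly_ring" unfolding K_def by (rule ideal_components[OF pull_ideal])
  have JK: "J \<subseteq> K"
    using J_subset_pull[OF ideal] mrestrict_face_ideal unfolding K_def J_def by blast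
  have "P \<inter> ?G \<subseteq> quot ` K"
  proof
    fix h assume h: "h \<in> P \<inter> ?G"
    then obtain v f where f: "f \<in> graded_piece g v" "h = quot f" by (auto simp: quot_piece_eq)
    have "f \<in> pull P" using h f(2) by (simp add: pull_def)
    moreover have "0 \<in> pull P" using pull_ideal by (simp add: ideal_mpoly_ring_iff)
    ultimately have "f \<in> K" by (simp add: K_def component_graded_piece[OF f(1)])
    then show "h \<in> quot ` K" using f(2) by blast
  qed
  then have "Idl\<^bsub>R\<^esub> (P \<inter> ?G) \<subseteq> quot ` K"
    by (rule quot.S.genideal_minimal[OF quot.R.ring_ideal_imp_quot_ideal[OF ideal_J K]])
  then have "P \<subseteq> quot ` K" by (subst hom)
  then have "pull P \<subseteq> K"
    using quot_mem_image_iff[OF K JK] by (auto simp: pull_def)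
  then have comp: "\<forall>f\<in>pull P. \<forall>v. component g v f \<in> pull P" unfolding K_def by blast
  obtain v f where f: "\<forall>i. 0 < v i" "f \<in> graded_piece g v" "f \<notin> pull P"
    using rel by (auto simp: quot_piece_eq pull_def)
  obtain m where m: "m \<in> keys f" "monomial m (lookup f m) \<notin> pull P"
  proof (rule ccontr)
    assume "\<not> thesis"
    then have "(\<Sum>m\<in>keys f. monomial m (lookup f m)) \<in> pull P"
      using that by (intro ideal_mpoly_ring_sum[OF pull_ideal]) blast
    then show False using f(3) by (simp flip: sum_monomials)
  qed
  have "\<exists>x. g x = i \<and> Var x \<notin> pull P" for i
  proof -
    have "multidegree g m i \<noteq> 0" using f m(1) by (auto simp: graded_piece_def)
    then obtain x where x: "g x = i" "lookup m x \<noteq> 0"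
      unfolding multidegree_def by (auto elim: sum.not_neutral_contains_not_neutral)
    have "m = (m - monomial x 1) + monomial x 1"
      using x(2) by (intro poly_mapping_eqI) (auto simp: lookup_add lookup_minus lookup_single when_def)
    then have "monomial m (lookup f m) = monomial ((m - monomial x 1) + monomial x 1) (lookup f m * 1)" by simp
    then have "monomial m (lookup f m) = monomial (m - monomial x 1) (lookup f m) * Var x"
      by (simp only: Var_def mult_single)
    then have "Var x \<notin> pull P" using m(2) pull_ideal unfolding ideal_mpoly_ring_iff by fastforce
    then show ?thesis using x(1) by blast
  qed
  then show ?thesis
    using comp primeideal_pull[OF prime] by (simp add: relevant_homogeneous_prime_def)
qed

lemma image_in_points:
  assumes Q: "relevant_homogeneous_prime g Q" and JQ: "J \<subseteq> Q"
  shows "quot ` Q \<in> points"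
proof -
  have prime: "primeideal Q mpoly_ring" and comp: "\<And>f v. f \<in> Q \<Longrightarrow> component g v f \<in> Q"
    and rel: "\<forall>i. \<exists>x. g x = i \<and> Var x \<notin> Q"
    using Q by (auto simp: relevant_homogeneous_prime_def)
  have ideal: "ideal Q mpoly_ring" using prime by (simp add: primeideal_mpoly_ring_iff)
  note mem = quot_mem_image_iff[OF ideal JQ]
  have I: "ideal (quot ` Q) R" by (rule quot.R.ring_ideal_imp_quot_ideal[OF ideal_J ideal])
  have "primeideal (quot ` Q) R"
  proof (rule primeidealI[OF I cring_R])
    show "carrier R \<noteq> quot ` Q"
    proof
      assume "carrier R = quot ` Q"
      then have "quot 1 \<in> quot ` Q" by (auto simp: quot_simps)
      then show False
        using mem ideal_mpoly_ring_eq_UNIV[OF ideal] prime by (simp add: primeideal_mpoly_ring_iff)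
    qed
    fix a b assume "a \<in> carrier R" "b \<in> carrier R" and ab: "a \<otimes>\<^bsub>R\<^esub> b \<in> quot ` Q"
    then obtain f h where fh: "a = quot f" "b = quot h" by (auto simp: quot_simps)
    then have "f * h \<in> Q" using ab mem by (simp add: quot_simps)
    then show "a \<in> quot ` Q \<or> b \<in> quot ` Q"
      using prime fh by (auto simp: primeideal_mpoly_ring_iff)
  qed
  moreover
  let ?G = "\<Union>v. quot_piece g J v"
  let ?I = "Idl\<^bsub>R\<^esub> (quot ` Q \<inter> ?G)"
  have sub: "quot ` Q \<inter> ?G \<subseteq> carrier R" by (auto simp: quot_simps)
  have "?I \<subseteq> quot ` Q" by (rule quot.S.genideal_minimal[OF I]) blast
  moreover have "quot ` Q \<subseteq> ?I"
  proof (rule image_subsetI)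
    fix f assume f: "f \<in> Q"
    have "(\<Sum>v\<in>multidegree g ` keys f. component g v f) \<in> pull ?I"
    proof (rule ideal_mpoly_ring_sum[OF ideal_pull[OF quot.S.genideal_ideal[OF sub]]])
      fix v
      have "quot (component g v f) \<in> quot ` Q \<inter> ?G"
        unfolding quot_piece_eq using comp[OF f] component_in_graded_piece[of g v f] by blast
      then show "component g v f \<in> pull ?I"
        using quot.S.genideal_self[OF sub] by (auto simp: pull_def)
    qed
    then show "quot f \<in> ?I" by (simp add: sum_components pull_def)
  qed
  ultimately have "primeideal (quot ` Q) R" "homogeneous_ideal R (quot_piece g J) (quot ` Q)"
    using I by (auto simp: homogeneous_ideal_def)
  moreover have "\<not> (\<Union>v\<in>{v. \<forall>i. 0 < v i}. quot_piece g J v) \<subseteq> quot ` Q"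
  proof
    assume *: "(\<Union>v\<in>{v. \<forall>i. 0 < v i}. quot_piece g J v) \<subseteq> quot ` Q"
    let ?F = "{x. Var x \<notin> Q}"
    \<comment> \<open>The product of all variables outside \<open>Q\<close> has positive degree in
      every coordinate, yet a prime cannot contain it.\<close>
    let ?m = "squarefree_exponent ?F"
    let ?f = "monomial ?m (1 :: 'k)"
    have "0 < multidegree g ?m i" for i
    proof -
      obtain x where "g x = i" "Var x \<notin> Q" using rel by blast
      then show ?thesis
        using lookup_le_multidegree[of ?m x g] by (simp add: lookup_squarefree_exponent)
    qed
    moreover have "quot ?f \<in> quot_piece g J (multidegree g ?m)"
      by (auto simp: quot_piece_eq graded_piece_def)
    ultimately have "quot ?f \<in> quot ` Q" using * by blast
    then have "?f \<in> Q" using mem by blast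
    then obtain x where "x \<in> keys ?m" "Var x \<in> Q"
      by (rule monomial_mem_prime[OF prime, of 1, simplified])
    then show False by simp
  qed
  ultimately show ?thesis by (simp add: multiproj_points_def)
qed

end

section \<open>The dimension of the multiprojective scheme\<close>

context face_ring
begin

abbreviation basic_open :: "('x, 'k) mpoly \<Rightarrow> ('x, 'k) mpoly set set set" where
  "basic_open f \<equiv> {P \<in> points. f \<notin> pull P}"

lemma X_eq: "X = topology_generated_by (basic_open ` (\<Union>v. graded_piece g v))"
proof -
  have "(\<lambda>f. {P \<in> points. f \<notin> P}) ` (\<Union>v. quot_piece g J v) = basic_open ` (\<Union>v. graded_piece g v)"
    by (simp add: quot_piece_eq image_UN image_image pull_def)
  then show ?thesis by (simp add: multiproj_def)
qed

lemma point_ideal: "P \<in> points \<Longrightarrow> ideal P R"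
  by (auto simp: multiproj_points_def intro: primeideal.axioms(1))

lemma point_prime: "P \<in> points \<Longrightarrow> primeideal (pull P) mpoly_ring"
  using relevant_homogeneous_prime_pull by (simp add: relevant_homogeneous_prime_def)

lemma point_not_one: "P \<in> points \<Longrightarrow> 1 \<notin> pull P"
  using point_prime[of P] ideal_mpoly_ring_eq_UNIV[of "pull P"] by (auto simp: primeideal_mpoly_ring_iff)

lemma topspace_X: "topspace X = points"
proof
  show "topspace X \<subseteq> points" by (auto simp: X_eq)
  have "1 \<in> graded_piece g (\<lambda>_. 0)" by (simp add: graded_piece_def multidegree_def fun_eq_iff)
  then have "basic_open 1 \<subseteq> topspace X" unfolding X_eq topology_generated_by_topspace by blast
  then show "points \<subseteq> topspace X" using point_not_one by blast
qed

text \<open>The nonhomogeneous basic open sets are open as well, since points are homogeneous.\<close>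

lemma openin_basic_open: "openin X (basic_open f)"
proof -
  have "basic_open f = (\<Union>v. basic_open (component g v f))"
  proof (intro equalityI subsetI)
    fix P assume P: "P \<in> basic_open f"
    have "\<exists>v. component g v f \<notin> pull P"
    proof (rule ccontr)
      assume "\<nexists>v. component g v f \<notin> pull P"
      then have "(\<Sum>v\<in>multidegree g ` keys f. component g v f) \<in> pull P"
        using point_prime[of P] P by (intro ideal_mpoly_ring_sum) (auto simp: primeideal_mpoly_ring_iff)
      then show False using P by (simp add: sum_components)
    qed
    then show "P \<in> (\<Union>v. basic_open (component g v f))" using P by blast
  next
    fix P assume "P \<in> (\<Union>v. basic_open (component g v f))"
    then show "P \<in> basic_open f"
      using relevant_homogeneous_prime_pull[of P] by (auto simp: relevant_homogeneous_prime_def)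
  qed
  moreover have "openin X (basic_open (component g v f))" for v
    unfolding X_eq using component_in_graded_piece[of g v f] by (intro topology_generated_by_Basis) blast
  ultimately show ?thesis by auto
qed

text \<open>The basic open sets are a basis and not just a subbasis: for primes, the sets of
  \<open>f\<close> and \<open>h\<close> meet in the set of \<open>f * h\<close>.\<close>

lemma open_separation:
  assumes "openin X U" "P \<in> U"
  shows "\<exists>f. P \<in> basic_open f \<and> basic_open f \<subseteq> U"
proof -
  have "generate_topology_on (basic_open ` (\<Union>v. graded_piece g v)) U"
    using assms(1) by (simp add: X_eq openin_topology_generated_by_iff)
  then show ?thesis using assms(2)
  proof (induction U rule: generate_topology_on.induct)
    case (Int a b)
    then obtain f h where fh: "P \<in> basic_open f" "basic_open f \<subseteq> a" "P \<in> basic_open h" "basic_open h \<subseteq> b"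
      by blast
    have "f * h \<notin> pull P" using fh point_prime[of P] by (auto simp: primeideal_mpoly_ring_iff)
    moreover have "basic_open (f * h) \<subseteq> basic_open f \<inter> basic_open h"
    proof
      fix P' assume P': "P' \<in> basic_open (f * h)"
      then have "ideal (pull P') mpoly_ring" using point_prime[of P'] by (simp add: primeideal_mpoly_ring_iff)
      then have "r * q \<in> pull P'" if "q \<in> pull P'" for r q using that unfolding ideal_mpoly_ring_iff by blast
      from this[of h f] this[of f h] show "P' \<in> basic_open f \<inter> basic_open h"
        using P' by (auto simp: mult.commute)
    qed
    ultimately show ?case using fh by blast
  next
    case (UN K)
    then show ?case by blast
  qed blast+
qed

text \<open>An element outside \<open>P\<close> is also outside every smaller point, so basic open
  neighbourhoods pass to smaller points.\<close>

lemma open_generization: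
  assumes "openin X U" "P \<in> U" "P' \<in> points" "P' \<subseteq> P"
  shows "P' \<in> U"
proof -
  obtain f where "P \<in> basic_open f" "basic_open f \<subseteq> U" using open_separation[OF assms(1,2)] by blast
  then show ?thesis using assms(3,4) by (auto simp: pull_def)
qed

lemma closedin_compl_basic_open: "closedin X (points - basic_open f)"
  using closedin_diff[OF closedin_topspace openin_basic_open[of f]] by (simp only: topspace_X)

text \<open>The set is the closure of \<open>P\<close>: any closed set containing \<open>P\<close>
  contains all larger points. One of two closed sets covering it contains \<open>P\<close>, hence
  the whole set.\<close>

lemma irreducible_closure:
  assumes P: "P \<in> points"
  shows "irreducible_closedin X {P' \<in> points. P \<subseteq> P'}"
proof -
  let ?V = "{P' \<in> points. P \<subseteq> P'}"
  have "P \<subseteq> P' \<longleftrightarrow> (\<forall>f\<in>pull P. f \<in> pull P')" for P'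
    using image_subset_iff[of quot "pull P" P']
    by (simp add: image_pull[OF point_ideal[OF P]]) (simp add: pull_def)
  then have "points - ?V = (\<Union>f\<in>pull P. basic_open f)" by auto
  moreover have "openin X (\<Union>f\<in>pull P. basic_open f)" using openin_basic_open by blast
  ultimately have "openin X (topspace X - ?V)" by (simp add: topspace_X)
  then have closed: "closedin X ?V" by (auto simp: closedin_def topspace_X)
  have gen: "?V \<subseteq> A" if "closedin X A" "P \<in> A" for A
  proof (rule ccontr)
    assume "\<not> ?V \<subseteq> A"
    then obtain P' where P': "P' \<in> points" "P \<subseteq> P'" "P' \<notin> A" by blast
    have "openin X (topspace X - A)" using that(1) by blast
    then have "P \<in> topspace X - A"
      by (rule open_generization[of _ P']) (use P' P in \<open>auto simp: topspace_X\<close>)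
    then show False using that(2) by blast
  qed
  show ?thesis
    unfolding irreducible_closedin_def
  proof (intro conjI allI impI closed)
    show "?V \<noteq> {}" using P by blast
    fix A B assume AB: "closedin X A \<and> closedin X B \<and> ?V = A \<union> B"
    then have "P \<in> A \<or> P \<in> B" using P by blast
    then show "?V = A \<or> ?V = B" using gen[of A] gen[of B] AB by blast
  qed
qed

definition vanishing_ideal :: "('x, 'k) mpoly set set set \<Rightarrow> ('x, 'k) mpoly set" where
  "vanishing_ideal T = (\<Inter>P\<in>T. pull P)"

text \<open>If a product vanishes on \<open>T\<close>, then \<open>T\<close> is the union of the
  closed subsets where either factor vanishes, and irreducibility makes one of them all of
  \<open>T\<close>.\<close>

lemma prime_vanishing_ideal:
  assumes T: "irreducible_closedin X T"
  shows "primeideal (vanishing_ideal T) mpoly_ring" "T \<subseteq> points"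
proof -
  have closed: "closedin X T" and ne: "T \<noteq> {}" using T by (auto simp: irreducible_closedin_def)
  show sub: "T \<subseteq> points" using closedin_subset[OF closed] by (simp add: topspace_X)
  have ideal: "ideal (pull P) mpoly_ring" if "P \<in> T" for P
    using point_prime[of P] that sub by (auto simp: primeideal_mpoly_ring_iff)
  show "primeideal (vanishing_ideal T) mpoly_ring"
    unfolding primeideal_mpoly_ring_iff
  proof (intro conjI allI impI)
    show "ideal (vanishing_ideal T) mpoly_ring"
      using ideal by (simp add: ideal_mpoly_ring_iff vanishing_ideal_def)
    obtain P where "P \<in> T" using ne by blast
    then have "1 \<notin> vanishing_ideal T" using sub point_not_one[of P] by (auto simp: vanishing_ideal_def)
    then show "vanishing_ideal T \<noteq> UNIV" by blast
    fix a b assume ab: "a * b \<in> vanishing_ideal T"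
    have "T = (T \<inter> (points - basic_open a)) \<union> (T \<inter> (points - basic_open b))"
    proof -
      have "a \<in> pull P \<or> b \<in> pull P" if "P \<in> T" for P
        using ab that sub point_prime[of P] by (auto simp: vanishing_ideal_def primeideal_mpoly_ring_iff)
      then show ?thesis using sub by blast
    qed
    moreover have "closedin X (T \<inter> (points - basic_open f))" for f
      by (intro closedin_Int closed closedin_compl_basic_open)
    ultimately have "T = T \<inter> (points - basic_open a) \<or> T = T \<inter> (points - basic_open b)"
      using T unfolding irreducible_closedin_def by blast
    then show "a \<in> vanishing_ideal T \<or> b \<in> vanishing_ideal T"
      using sub unfolding vanishing_ideal_def by blast
  qed
qed

text \<open>A point of \<open>T'\<close> outside \<open>T\<close> has a basic open neighbourhood
  disjoint from \<open>T\<close>; its defining element vanishes on \<open>T\<close> but not at the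
  point.\<close>

lemma vanishing_ideal_psubset:
  assumes T: "irreducible_closedin X T" and T': "irreducible_closedin X T'" and sub: "T \<subset> T'"
  shows "vanishing_ideal T' \<subset> vanishing_ideal T"
proof -
  obtain P where P: "P \<in> T'" "P \<notin> T" using sub by blast
  have pts: "T \<subseteq> points" "T' \<subseteq> points" using prime_vanishing_ideal(2) T T' by auto
  have "openin X (topspace X - T)" using T by (simp add: irreducible_closedin_def openin_diff)
  moreover have "P \<in> topspace X - T" using P pts by (auto simp: topspace_X)
  ultimately obtain f where f: "P \<in> basic_open f" "basic_open f \<subseteq> topspace X - T"
    using open_separation by blast
  have "f \<in> vanishing_ideal T" using f(2) pts by (auto simp: vanishing_ideal_def)
  moreover have "f \<notin> vanishing_ideal T'" using f(1) P(1) by (auto simp: vanishing_ideal_def)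
  moreover have "vanishing_ideal T' \<subseteq> vanishing_ideal T" using sub by (auto simp: vanishing_ideal_def)
  ultimately show ?thesis by blast
qed

text \<open>A point omits a variable of every degree; these are independent modulo it and hence
  add their number to the length of any chain of primes below it.\<close>

lemma irreducible_chain_length:
  assumes T: "\<And>i. i \<le> m \<Longrightarrow> irreducible_closedin X (T i)" "\<And>i. i < m \<Longrightarrow> T i \<subset> T (Suc i)"
    and d: "\<And>F. F \<in> \<Delta> \<Longrightarrow> card F \<le> d"
  shows "m + card (UNIV :: 'p set) \<le> d"
proof -
  \<comment> \<open>The order is reversed: the smallest closed set \<open>T 0\<close> has the
    largest ideal, which comes last and lies in the prime of each of its points.\<close>
  let ?Q = "\<lambda>i. vanishing_ideal (T (m - i))"
  have "T 0 \<noteq> {}" using T(1)[of 0] by (auto simp: irreducible_closedin_def)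
  then obtain P where P: "P \<in> T 0" by blast
  then have "P \<in> points" using prime_vanishing_ideal(2)[OF T(1)[of 0]] by blast
  then have rel: "relevant_homogeneous_prime g (pull P)" by (rule relevant_homogeneous_prime_pull)
  then obtain x where x: "\<And>i. g (x i) = i" "\<And>i. Var (x i) \<notin> pull P"
    unfolding relevant_homogeneous_prime_def by metis
  obtain "is" where "is": "set is = (UNIV :: 'p set)" "distinct is"
    using finite_distinct_list[of "UNIV :: 'p set"] by auto
  have "alg_indep_mod (pull P) (map Var (map x is))"
    using rel x "is" by (intro alg_indep_mod_vars[where g = g])
      (auto simp: relevant_homogeneous_prime_def o_def)
  moreover have "?Q m \<subseteq> pull P" using P by (auto simp: vanishing_ideal_def)
  ultimately have indep: "alg_indep_mod (?Q m) (map Var (map x is))" by (rule alg_indep_mod_antimono)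
  have "m + length (map Var (map x is) :: ('x, 'k) mpoly list) \<le> d"
  proof (rule prime_chain_length_le[where Q = ?Q, OF _ _ indep _ d])
    show "primeideal (?Q i) mpoly_ring" for i using T(1) by (intro prime_vanishing_ideal) simp
    show "?Q i \<subset> ?Q (Suc i)" if "i < m" for i
    proof (rule vanishing_ideal_psubset)
      have "m - i = Suc (m - Suc i)" using that by simp
      then show "T (m - Suc i) \<subset> T (m - i)" using T(2)[of "m - Suc i"] that by simp
    qed (use T(1) in auto)
    have "J \<subseteq> ?Q 0"
      using J_subset_pull point_ideal prime_vanishing_ideal(2)[OF T(1)[of m]]
      unfolding vanishing_ideal_def by auto
    then show "face_ideal \<Delta> \<subseteq> ?Q 0" by (simp add: J_def)
  qed
  moreover have "length is = card (UNIV :: 'p set)" using "is" distinct_card by metis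
  ultimately show ?thesis by simp
qed

text \<open>For the lower bound one variable of each degree is fixed in \<open>F\<close>, and the
  other variables of \<open>F\<close> are removed one at a time. The fixed variables keep all the
  primes relevant, and their number is the loss in dimension.\<close>

lemma krull_dim_X:
  assumes F: "F \<in> \<Delta>" "relevant_face g F" and d: "\<And>G. G \<in> \<Delta> \<Longrightarrow> card G \<le> card F"
  shows "krull_dim X = enat (card F - card (UNIV :: 'p set))"
proof (rule antisym)
  show "krull_dim X \<le> enat (card F - card (UNIV :: 'p set))"
    unfolding krull_dim_def
  proof (rule SUP_least, elim CollectE exE conjE)
    fix m and T :: "nat \<Rightarrow> ('x, 'k) mpoly set set set"
    assume "\<forall>i\<le>m. irreducible_closedin X (T i)" "\<forall>i<m. T i \<subset> T (Suc i)"
    then have "m + card (UNIV :: 'p set) \<le> card F" using irreducible_chain_length[of m T] d by blast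
    then show "enat m \<le> enat (card F - card (UNIV :: 'p set))" by simp
  qed
  obtain x where x: "\<And>i. x i \<in> F" "\<And>i. g (x i) = i"
    using F(2) unfolding relevant_face_def by metis
  have cardx: "card (range x) = card (UNIV :: 'p set)"
    by (intro card_image inj_onI) (metis x(2))
  obtain H where H: "H 0 = F" "H (card F - card (range x)) = range x" "\<And>i. range x \<subseteq> H i" "\<And>i. H i \<subseteq> F"
    "\<And>i. i < card F - card (range x) \<Longrightarrow> H (Suc i) \<subset> H i"
    using descending_chain[of "range x" F] x(1) by blast
  let ?n = "card F - card (range x)"
  define P where "P i = quot ` var_ideal (H i)" for i
  \<comment> \<open>Larger primes have smaller closures, so the chain is read backwards.\<close>
  let ?T = "\<lambda>i. {P' \<in> points. P (?n - i) \<subseteq> P'}"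
  have JH: "J \<subseteq> var_ideal (H i)" for i
  proof -
    have "H i \<in> \<Delta>" using complex F(1) H(4) by (auto simp: simplicial_complex_def)
    then show ?thesis using face_ideal_subset_var_ideal_iff[OF complex, of "H i", where 'k='k] by (simp add: J_def)
  qed
  have P: "P i \<in> points" for i
    unfolding P_def
  proof (rule image_in_points[OF _ JH])
    have "x j \<in> H i" for j using H(3) by blast
    then show "relevant_homogeneous_prime g (var_ideal (H i) :: ('x, 'k) mpoly set)"
      unfolding relevant_homogeneous_prime_def using x(2)
      by (auto intro: primeideal_var_ideal mrestrict_face_ideal)
  qed
  have mono: "P i \<subseteq> P j \<longleftrightarrow> H j \<subseteq> H i" for i j
  proof -
    have "P i \<subseteq> P j \<longleftrightarrow> var_ideal (H i) \<subseteq> (var_ideal (H j) :: ('x, 'k) mpoly set)"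
      unfolding P_def image_subset_iff using quot_mem_image_iff[OF ideal_var_ideal JH[of j]] by blast
    then show ?thesis by (simp only: var_ideal_subset_iff)
  qed
  have "?T i \<subset> ?T (Suc i)" if "i < ?n" for i
  proof -
    have "?n - i = Suc (?n - Suc i)" using that by simp
    then have sub: "H (?n - i) \<subset> H (?n - Suc i)" using H(5)[of "?n - Suc i"] that by simp
    then have "P (?n - Suc i) \<subseteq> P (?n - i)" unfolding mono by blast
    moreover have "\<not> P (?n - i) \<subseteq> P (?n - Suc i)" unfolding mono using sub by blast
    moreover have "P (?n - Suc i) \<in> ?T (Suc i)" using P[of "?n - Suc i"] by simp
    ultimately show ?thesis by blast
  qed
  moreover have "irreducible_closedin X (?T i)" for i by (rule irreducible_closure[OF P])
  ultimately have "?n \<in> {m. \<exists>T. (\<forall>i\<le>m. irreducible_closedin X (T i)) \<and> (\<forall>i<m. T i \<subset> T (Suc i))}"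
    by (intro CollectI exI[of _ ?T]) simp
  then show "enat (card F - card (UNIV :: 'p set)) \<le> krull_dim X"
    unfolding krull_dim_def cardx[symmetric] by (rule SUP_upper)
qed

end

section \<open>Hilbert polynomials of shellable complexes\<close>

text \<open>The bound 1 on the entries of \<open>v\<close> suffices, since the face polynomials and
  the Hilbert function both count monomials exactly from there on.\<close>

lemma hilbert_poly_shelling:
  fixes F :: "nat \<Rightarrow> 'x::finite set" and g :: "'x \<Rightarrow> 'p::finite" and l :: "nat \<Rightarrow> nat \<Rightarrow> 'x"
  assumes \<Delta>: "simplicial_complex \<Delta>" "{} \<in> \<Delta>" and sh: "shelling_order \<Delta> k F"
    and l: "\<And>j. j \<in> {1..k} \<Longrightarrow> l j ` {1..b j} \<subseteq> F j"
    and L: "\<And>j. j \<in> {1..k} \<Longrightarrow> {F i \<inter> F j | i. i \<in> {1..<j} \<and> card (F i \<inter> F j) + 1 = card (F j)} =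
      {F j - {x} | x. x \<in> l j ` {1..b j}}"
  shows "hilbert_poly g (face_ideal \<Delta> :: ('x, 'k::field) mpoly set) =
    (\<Sum>j\<in>{1..k}. \<Sum>A\<in>Pow {1..b j}. (-1) ^ card A * face_poly g (F j - l j ` A))"
proof (rule hilbert_poly_eqI[of 1])
  fix v :: "'p \<Rightarrow> nat" assume v: "\<And>i. 1 \<le> v i"
  have "mpoly_eval (-1) u = -1" for u :: "'p \<Rightarrow> rat"
    by (simp add: mpoly_eval_uminus[of 1, simplified])
  moreover have "rat_of_nat (card {m. keys m \<in> \<Delta> \<and> multidegree g m = v}) =
      (\<Sum>j\<in>{1..k}. \<Sum>A\<in>Pow {1..b j}. (-1) ^ card A *
        of_nat (card {m. keys m \<subseteq> F j - l j ` A \<and> multidegree g m = v}))"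
    by (rule card_shelling[OF \<Delta>(1) sh l L])
  ultimately show "mpoly_eval (\<Sum>j\<in>{1..k}. \<Sum>A\<in>Pow {1..b j}. (-1) ^ card A * face_poly g (F j - l j ` A))
      (\<lambda>i. of_nat (v i)) = of_nat (hilbert_function g (face_ideal \<Delta> :: ('x, 'k) mpoly set) v)"
    by (simp add: mpoly_eval_sum mpoly_eval_face_poly[OF v] hilbert_function_face_ideal[OF \<Delta>])
qed

lemma sum_face_index:
  fixes g :: "'x::finite \<Rightarrow> 'p::finite"
  assumes "relevant_face g F"
  shows "(\<Sum>i\<in>UNIV. face_index g F i) + card (UNIV :: 'p set) = card F"
proof -
  have "1 \<le> card {x\<in>F. g x = i}" for i
  proof -
    have "{x\<in>F. g x = i} \<noteq> {}" using assms unfolding relevant_face_def by blast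
    then show ?thesis by (simp add: Suc_le_eq card_gt_0_iff)
  qed
  then have "face_index g F i + 1 = card {x\<in>F. g x = i}" for i
    by (simp only: face_index_def le_add_diff_inverse2)
  then have "(\<Sum>i\<in>UNIV. card {x\<in>F. g x = i}) = (\<Sum>i\<in>UNIV. face_index g F i + 1)"
    by simp
  then have "(\<Sum>i\<in>UNIV. face_index g F i) + card (UNIV :: 'p set) = (\<Sum>i\<in>UNIV. card {x\<in>F. g x = i})"
    by (simp only: sum.distrib) simp
  also have "\<dots> = card F"
    using sum.group[of F UNIV g "\<lambda>_. 1::nat"] by simp
  finally show ?thesis .
qed

lemma minus_one_power_mpoly: "(-1) ^ n = (Const ((-1) ^ n) :: ('p, rat) mpoly)"
  by (induction n) (simp_all add: Const_def single_uminus)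

lemma primary_decomposition_ideals:
  fixes p :: "nat \<Rightarrow> ('x, 'k::field) mpoly set"
  assumes "minimal_primary_decomposition mpoly_ring J k p"
  shows "J = (\<Inter>i\<in>{1..k}. p i)" and "\<And>i. i \<in> {1..k} \<Longrightarrow> ideal (p i) mpoly_ring"
    and "\<And>i. i \<in> {1..k} \<Longrightarrow> p i \<noteq> UNIV"
  using assms by (simp_all add: minimal_primary_decomposition_def primary_ideal_def)

lemma var_ideal_inject: "var_ideal F = (var_ideal G :: ('x, 'k::field) mpoly set) \<longleftrightarrow> F = G"
  by (metis subset_antisym subset_refl var_ideal_subset_iff)

text \<open>The difference may be negative, but it has the same parity as the sum.\<close>

lemma powi_minus_one_of_nat_diff: "(-1 :: rat) powi (int a - int b) = (-1) ^ (a + b)"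
proof -
  have "(-1 :: rat) powi (int a - int b) = (-1) powi (int a) * inverse ((-1) powi (int b))"
    by (simp add: power_int_diff divide_inverse)
  then show ?thesis by (simp add: power_add flip: power_inverse)
qed

theorem corollary4p7:
  fixes g :: "'x::finite \<Rightarrow> 'p::finite"
    and J :: "('x, 'k::field) mpoly set"
    and p :: "nat \<Rightarrow> ('x, 'k) mpoly set"
    and k c :: nat
    and b :: "nat \<Rightarrow> nat"
    and l :: "nat \<Rightarrow> nat \<Rightarrow> 'x"
  assumes "squarefree_monomial_ideal J"
    and "1 \<le> k"
    and "minimal_primary_decomposition mpoly_ring J k p"
    and "shelling_order (stanley_reisner J) k (\<lambda>i. {x. Var x \<notin> p i})"
    and "\<forall>j\<in>{1..k}. codim mpoly_ring (p j) = enat c"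
    and "\<forall>j\<in>{1..k}. inj_on (l j) {1..b j}"
    and "\<forall>j\<in>{1..k}. \<forall>i\<in>{1..b j}. Var (l j i) \<notin> p j"
    and "\<forall>j\<in>{1..k}.
           {p i <+>\<^bsub>mpoly_ring\<^esub> p j | i. i \<in> {1..<j} \<and> codim mpoly_ring (p i <+>\<^bsub>mpoly_ring\<^esub> p j) = enat (c + 1)}
           = {add_vars (p j) {l j i} | i. i \<in> {1..b j}}"
  shows "(\<forall>j\<in>{1..k}. \<forall>A\<subseteq>{1..b j}.
            codim mpoly_ring (add_vars (p j) (l j ` A)) = codim mpoly_ring J + enat (card A))
       \<and> hilbert_poly g J =
           (\<Sum>j\<in>{1..k}. hilbert_poly g (p j) +
              (\<Sum>A\<in>Pow {1..b j} - {{}}. (-1) ^ card A * hilbert_poly g (add_vars (p j) (l j ` A))))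
       \<and> cancellation_free (SIGMA j:{1..k}. Pow {1..b j})
           (\<lambda>(j, A). (-1) ^ card A * hilbert_poly g (add_vars (p j) (l j ` A)))
       \<and> (\<forall>n :: 'p \<Rightarrow> nat.
            0 \<le> (-1 :: rat) powi
                  (int (the_enat (krull_dim (multiproj (mpoly_ring Quot J) (quot_piece g J))))
                     - int (\<Sum>i\<in>UNIV. n i))
                * of_int (hilbert_coeff g J n))"
proof -
  define F where "F i = {x. Var x \<notin> p i}" for i
  define \<Delta> where "\<Delta> = stanley_reisner J"
  \<comment> \<open>The common size of the facets, since each of their complements has
    \<open>c\<close> elements.\<close>
  define d where "d = card (UNIV :: 'x set) - c"
  note decomp = primary_decomposition_ideals[OF assms(3)]
  have J: "J = face_ideal \<Delta>" and \<Delta>: "simplicial_complex \<Delta>"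
    unfolding \<Delta>_def using squarefree_monomial_ideal_eq[OF assms(1)] by blast+
  have sh: "shelling_order \<Delta> k F" using assms(4) by (simp only: \<Delta>_def F_def[abs_def])
  have bij: "bij_betw F {1..k} (facets \<Delta>)" using sh by (simp add: shelling_order_def)
  have p: "p j = var_ideal (F j)" if "j \<in> {1..k}" for j
    by (rule component_eq_var_ideal[OF F_def \<Delta> _ decomp(2) bij that]) (simp_all only: flip: J decomp(1))
  have F\<Delta>: "F j \<in> \<Delta>" if "j \<in> {1..k}" for j
    using bij_betw_apply[OF bij that] by (simp add: facets_def)
  have compl: "card (- F) = card (UNIV :: 'x set) - card F" for F :: "'x set"
    by (simp add: card_Diff_subset Compl_eq_Diff_UNIV)
  have le: "card F \<le> card (UNIV :: 'x set)" for F :: "'x set" by (simp add: card_mono)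
  have cardF: "card (F j) = d" and c: "card (- F j) = c" if "j \<in> {1..k}" for j
  proof -
    have "enat (card (- F j)) = enat c"
      using assms(5) that by (simp add: p codim_var_ideal)
    then show "card (- F j) = c" by simp
    then show "card (F j) = d" using le[of "F j"] by (simp add: d_def compl)
  qed
  have max: "card G \<le> d" if G: "G \<in> \<Delta>" for G
  proof -
    obtain H where H: "H \<in> facets \<Delta>" "G \<subseteq> H" using G by (rule face_subset_facet)
    then have "H \<in> F ` {1..k}" using bij by (simp add: bij_betw_def)
    then have "card H = d" using cardF by blast
    then show ?thesis using H(2) card_mono[of H G] by simp
  qed
  have one: "1 \<in> {1..k}" using assms(2) by simp
  have empty: "{} \<in> \<Delta>" using F\<Delta>[OF one] \<Delta> by (simp add: simplicial_complex_def)
  have l: "l j ` {1..b j} \<subseteq> F j" if "j \<in> {1..k}" for j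
    using assms(7) that unfolding F_def by blast
  have add_vars: "add_vars (p j) (l j ` A) = var_ideal (F j - l j ` A)" if "j \<in> {1..k}" for j A
    by (simp only: p[OF that] add_vars_var_ideal)
  have cardA: "card (F j - l j ` A) + card A = d" if "j \<in> {1..k}" "A \<subseteq> {1..b j}" for j A
  proof -
    have "inj_on (l j) A" using assms(6) that by (meson inj_on_subset)
    then have "card (l j ` A) = card A" by (rule card_image)
    moreover have "l j ` A \<subseteq> F j" using l[OF that(1)] that(2) by blast
    ultimately show ?thesis
      using cardF[OF that(1)] card_mono[of "F j" "l j ` A"] by (simp add: card_Diff_subset)
  qed
  \<comment> \<open>The hypothesis on sums of primes is translated to facets: sums become
    intersections, codimension \<open>c + 1\<close> means one element fewer than a facet, and
    \<open>var_ideal\<close> is injective.\<close>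
  have L: "{F i \<inter> F j | i. i \<in> {1..<j} \<and> card (F i \<inter> F j) + 1 = card (F j)} =
      {F j - {x} | x. x \<in> l j ` {1..b j}}" (is "?A = ?B") if j: "j \<in> {1..k}" for j
  proof -
    have pi: "p i <+>\<^bsub>mpoly_ring\<^esub> p j = var_ideal (F i \<inter> F j)" if "i \<in> {1..<j}" for i
      using that j by (simp add: p var_ideal_add)
    have codim: "codim mpoly_ring (var_ideal (F i \<inter> F j) :: ('x, 'k) mpoly set) = enat (c + 1) \<longleftrightarrow>
        card (F i \<inter> F j) + 1 = card (F j)" for i
      unfolding codim_var_ideal compl
      using c[OF j] le[of "F j"] card_mono[of "F j" "F i \<inter> F j"] by (auto simp: compl)
    have "u = p i <+>\<^bsub>mpoly_ring\<^esub> p j \<and> i \<in> {1..<j} \<and> codim mpoly_ring (p i <+>\<^bsub>mpoly_ring\<^esub> p j) = enat (c + 1) \<longleftrightarrow>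
        u = var_ideal (F i \<inter> F j) \<and> i \<in> {1..<j} \<and> card (F i \<inter> F j) + 1 = card (F j)" for u i
      by (cases "i \<in> {1..<j}") (simp_all only: pi codim simp_thms)
    then have "{p i <+>\<^bsub>mpoly_ring\<^esub> p j | i. i \<in> {1..<j} \<and> codim mpoly_ring (p i <+>\<^bsub>mpoly_ring\<^esub> p j) = enat (c + 1)} =
        {var_ideal (F i \<inter> F j) | i. i \<in> {1..<j} \<and> card (F i \<inter> F j) + 1 = card (F j)}"
      by (simp only:)
    also have "\<dots> = var_ideal ` ?A" by blast
    finally have "{p i <+>\<^bsub>mpoly_ring\<^esub> p j | i. i \<in> {1..<j} \<and> codim mpoly_ring (p i <+>\<^bsub>mpoly_ring\<^esub> p j) = enat (c + 1)} =
        var_ideal ` ?A" .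
    moreover have "{add_vars (p j) {l j i} | i. i \<in> {1..b j}} = var_ideal ` ?B"
      unfolding p[OF j] add_vars_var_ideal by blast
    ultimately have "var_ideal ` ?A = (var_ideal ` ?B :: ('x, 'k) mpoly set set)"
      using assms(8) j by simp
    moreover have "inj (var_ideal :: 'x set \<Rightarrow> ('x, 'k) mpoly set)" by (simp add: inj_def var_ideal_inject)
    ultimately show ?thesis by (simp only: inj_image_eq_iff)
  qed
  have hp: "hilbert_poly g (add_vars (p j) (l j ` A)) = face_poly g (F j - l j ` A)" if "j \<in> {1..k}" for j A
    by (simp only: add_vars[OF that] hilbert_poly_var_ideal)
  let ?I = "SIGMA j:{1..k}. Pow {1..b j}"
  let ?E = "\<lambda>(j, A). F j - l j ` A"
  have hilbert: "hilbert_poly g J = (\<Sum>j\<in>{1..k}. \<Sum>A\<in>Pow {1..b j}. (-1) ^ card A * face_poly g (F j - l j ` A))"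
    unfolding J by (rule hilbert_poly_shelling[OF \<Delta> empty sh l L])

  have codimJ: "codim mpoly_ring J = enat c"
    unfolding J using codim_face_ideal[OF \<Delta> F\<Delta>[OF one]] max cardF[OF one] c[OF one] by simp
  have part1: "codim mpoly_ring (add_vars (p j) (l j ` A)) = codim mpoly_ring J + enat (card A)"
    if "j \<in> {1..k}" "A \<subseteq> {1..b j}" for j A
  proof -
    have "card (- (F j - l j ` A)) = c + card A"
      using cardA[OF that] c[OF that(1)] cardF[OF that(1)] le[of "F j"] le[of "F j - l j ` A"]
      by (simp only: compl)
    then show ?thesis by (simp add: add_vars[OF that(1)] codim_var_ideal codimJ)
  qed

  have part2: "hilbert_poly g J = (\<Sum>j\<in>{1..k}. hilbert_poly g (p j) +
      (\<Sum>A\<in>Pow {1..b j} - {{}}. (-1) ^ card A * hilbert_poly g (add_vars (p j) (l j ` A))))"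
    unfolding hilbert
  proof (rule sum.cong[OF refl])
    fix j assume j: "j \<in> {1..k}"
    have "(\<Sum>A\<in>Pow {1..b j}. (-1) ^ card A * face_poly g (F j - l j ` A)) =
        face_poly g (F j) + (\<Sum>A\<in>Pow {1..b j} - {{}}. (-1) ^ card A * face_poly g (F j - l j ` A))"
      by (subst sum.remove[of _ "{}"]) simp_all
    then show "(\<Sum>A\<in>Pow {1..b j}. (-1) ^ card A * face_poly g (F j - l j ` A)) = hilbert_poly g (p j) +
      (\<Sum>A\<in>Pow {1..b j} - {{}}. (-1) ^ card A * hilbert_poly g (add_vars (p j) (l j ` A)))"
      by (simp only: p[OF j] add_vars_var_ideal hilbert_poly_var_ideal)
  qed

  text \<open>The index of a face determines its size, hence the parity of \<open>A\<close>.\<close>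

  have parity: "(\<Sum>i\<in>UNIV. face_index g (F j - l j ` A) i) + card (UNIV :: 'p set) + card A = d"
    if "j \<in> {1..k}" "A \<subseteq> {1..b j}" "relevant_face g (F j - l j ` A)" for j A
    using sum_face_index[OF that(3)] cardA[OF that(1,2)] by simp

  have part3: "cancellation_free ?I (\<lambda>(j, A). (-1) ^ card A * hilbert_poly g (add_vars (p j) (l j ` A)))"
    unfolding cancellation_free_def
  proof (intro ballI allI impI, elim conjE)
    fix s s' n and a a' :: rat
    let ?f = "\<lambda>(j, A). (-1) ^ card A * hilbert_poly g (add_vars (p j) (l j ` A))"
    assume s: "s \<in> ?I" "s' \<in> ?I" and nz: "?f s \<noteq> 0" "?f s' \<noteq> 0"
      and eq: "?f s = Const a * binom_prod n" "?f s' = Const a' * binom_prod n"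
    \<comment> \<open>A nonzero summand is a sign times one binomial product, so \<open>n\<close>
      must be the index of its face and \<open>a\<close> its sign.\<close>
    have *: "a = (-1) ^ card A \<and> (\<Sum>i\<in>UNIV. n i) + card (UNIV :: 'p set) + card A = d"
      if j: "j \<in> {1..k}" and A: "A \<subseteq> {1..b j}" and "?f (j, A) \<noteq> 0" "?f (j, A) = Const a * binom_prod n"
      for j A a
    proof -
      have f: "?f (j, A) = Const ((-1) ^ card A) * face_poly g (F j - l j ` A)"
        by (simp add: hp[OF j] minus_one_power_mpoly)
      then have rel: "relevant_face g (F j - l j ` A)"
        using \<open>?f (j, A) \<noteq> 0\<close> by (auto simp: face_poly_def split: if_splits)
      then have "Const ((-1) ^ card A) * binom_prod (face_index g (F j - l j ` A)) = Const a * binom_prod n"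
        using f that(4) by (simp add: face_poly_def)
      from binom_prod_scalar_eq[OF this] parity[OF j A rel] show ?thesis by auto
    qed
    obtain j A j' A' where sA: "s = (j, A)" "j \<in> {1..k}" "A \<subseteq> {1..b j}"
      "s' = (j', A')" "j' \<in> {1..k}" "A' \<subseteq> {1..b j'}"
      using s by auto
    have "a = (-1) ^ card A" "(\<Sum>i\<in>UNIV. n i) + card (UNIV :: 'p set) + card A = d"
      using *[OF sA(2,3), of a] nz(1) eq(1) unfolding sA by blast+
    moreover have "a' = (-1) ^ card A'" "(\<Sum>i\<in>UNIV. n i) + card (UNIV :: 'p set) + card A' = d"
      using *[OF sA(5,6), of a'] nz(2) eq(2) unfolding sA by blast+
    ultimately have "card A = card A'" by linarith
    then show "sgn a = sgn a'" using \<open>a = _\<close> \<open>a' = _\<close> by simp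
  qed

  have part4: "0 \<le> (-1 :: rat) powi
      (int (the_enat (krull_dim (multiproj (mpoly_ring Quot J) (quot_piece g J)))) - int (\<Sum>i\<in>UNIV. n i))
        * of_int (hilbert_coeff g J n)" for n
  proof -
    let ?K = "{s \<in> ?I. relevant_face g (?E s)}"
    have fin: "finite ?I" by auto
    have "hilbert_poly g J = (\<Sum>s\<in>?I. (-1) ^ card (snd s) * face_poly g (?E s))"
      unfolding hilbert by (subst sum.Sigma) (auto simp: case_prod_unfold)
    also have "\<dots> = (\<Sum>s\<in>?K. of_int ((-1) ^ card (snd s)) * binom_prod (face_index g (?E s)))"
      using fin by (intro sum.mono_neutral_cong_right) (auto simp: face_poly_def)
    finally have coeff: "hilbert_coeff g J n = (\<Sum>s | s \<in> ?K \<and> face_index g (?E s) = n. (-1) ^ card (snd s))"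
      using fin by (intro hilbert_coeff_eqI) simp_all
    let ?N = "{s. s \<in> ?K \<and> face_index g (?E s) = n}"
    show ?thesis
    proof (cases "?N = {}")
      case True
      then show ?thesis unfolding coeff by (simp only: sum.empty)
    next
      case False
      have card: "(\<Sum>i\<in>UNIV. n i) + card (UNIV :: 'p set) + card (snd s) = d" if "s \<in> ?N" for s
        using that parity[of "fst s" "snd s"] by (auto simp: case_prod_unfold)
      \<comment> \<open>A contributing face meets every degree, and so does the facet above it; this
        supplies the relevant facet for the dimension formula. Without a contributing face the
        coefficient is 0.\<close>
      from False obtain j A where jA: "j \<in> {1..k}" "relevant_face g (F j - l j ` A)" by auto
      then have rel: "relevant_face g (F j)" unfolding relevant_face_def by blast
      interpret face_ring g J \<Delta> by unfold_locales (fact \<Delta>, fact J)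
      have "krull_dim (multiproj (mpoly_ring Quot J) (quot_piece g J)) = enat (d - card (UNIV :: 'p set))"
        using krull_dim_X[OF F\<Delta>[OF jA(1)] rel] max by (simp add: cardF[OF jA(1)])
      then have dim: "the_enat (krull_dim (multiproj (mpoly_ring Quot J) (quot_piece g J))) = d - card (UNIV :: 'p set)"
        by simp
      have "of_int (hilbert_coeff g J n) = (\<Sum>s\<in>?N. (-1) ^ card (snd s) :: rat)"
        unfolding coeff by simp
      then have "(-1) powi (int (d - card (UNIV :: 'p set)) - int (\<Sum>i\<in>UNIV. n i)) * of_int (hilbert_coeff g J n) =
          (\<Sum>s\<in>?N. (-1) ^ (d - card (UNIV :: 'p set) + (\<Sum>i\<in>UNIV. n i)) * (-1) ^ card (snd s) :: rat)"
        by (simp only: powi_minus_one_of_nat_diff sum_distrib_left)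
      also have "\<dots> = (\<Sum>s\<in>?N. 1)"
      proof (rule sum.cong[OF refl])
        fix s assume "s \<in> ?N"
        \<comment> \<open>The truncated difference is exact because \<open>d\<close> is the sum of
          \<open>n\<close>, the number of degrees and \<open>card (snd s)\<close>.\<close>
        from card[OF this] have "d - card (UNIV :: 'p set) + (\<Sum>i\<in>UNIV. n i) + card (snd s) =
            2 * ((\<Sum>i\<in>UNIV. n i) + card (snd s))" by auto
        then have "even (d - card (UNIV :: 'p set) + (\<Sum>i\<in>UNIV. n i) + card (snd s))" by (simp only: dvd_triv_left)
        then show "(-1) ^ (d - card (UNIV :: 'p set) + (\<Sum>i\<in>UNIV. n i)) * (-1) ^ card (snd s) = (1 :: rat)"
          by (simp only: power_add[symmetric] neg_one_even_power)
      qed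
      finally show ?thesis unfolding dim by (simp add: sum_nonneg)
    qed
  qed
  show ?thesis using part1 part2 part3 part4 by blast
qed

end
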